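(* Let $s\in\mathbb{N}\cup\{0\}$ and $p\in\mathbb{N}$ (so $p\ge 1$) with $s\ge 2(p-1)$. Let $R$ be a root system in $\mathbb{R}^n$ with multiplicity function $\kappa\ge 0$ and associated Dunkl Laplacian $\Delta_h$. Let $f\in C^{2p}(\mathbb{R}^n)$ be a real-valued function with $\Delta_h^p f=0$ on $\mathbb{R}^n$. Then $f$ is a polynomial of degree $\le s$ if and only if $$\liminf_{r\to\infty}\frac{M_1(r,f^+)}{r^{s+n-1+2\gamma}}\in[0,+\infty).$$ Moreover, when $s>2(p-1)$, we have: (i) $f$ is a polynomial of degree $<s$ if and only if $$\liminf_{r\to\infty}\frac{M_1(r,f^+)}{r^{s+n-1+2\gamma}}=0;$$ (ii) $f$ is a polynomial of degree $s$ if and only if $$\liminf_{r\to\infty}\frac{M_1(r,f^+)}{r^{s+n-1+2\gamma}}\in(0,+\infty).$$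
   Context: For a nonzero vector $v\in\mathbb{R}^n$, $\sigma_v x = x-2\frac{\langle x,v\rangle}{|v|^2}v$ is the reflection in the hyperplane orthogonal to $v$, where $\langle\cdot,\cdot\rangle$ is the Euclidean inner product and $|x|^2=\langle x,x\rangle$. A root system $R$ is a finite set of nonzero vectors in $\mathbb{R}^n$ such that $\sigma_v R=R$ and $R\cap\mathbb{R}v=\{\pm v\}$ for all $v\in R$. The Coxeter group $G$ is the subgroup of $O(n)$ generated by $\{\sigma_v: v\in R\}$. A positive subsystem $R_+\subset R$ is a subset such that $R=R_+\cup(-R_+)$, where $R_+$ and $-R_+$ are separated by some hyperplane through the origin; one such $R_+$ is fixed. A multiplicity function is a $G$-invariant function $\kappa:R\to\mathbb{C}$, $v\mapsto\kappa_v$ (i.e. $\kappa_{gv}=\kappa_v$ for all $g\in G$); it is assumed throughout that $\kappa_v\ge 0$ for all $v\in R$. Put $\gamma=\sum_{v\in R_+}\kappa_v$. The Dunkl operators are $$\mathcal{D}_jf(x)=\frac{\partial f}{\partial x_j}(x)+\sum_{v\in R_+}\kappa_v\frac{f(x)-f(\sigma_v x)}{\langle x,v\rangle}v_j,\qquad j=1,\dots,n,$$ (the quotient being understood by continuous extension where $\langle x,v\rangle=0$), and the Dunkl Laplacian is $\Delta_h=\sum_{j=1}^n\mathcal{D}_j^2$. Let $d\sigma$ denote Lebesgue surface measure on spheres, $h_k(x)=\prod_{v\in R_+}|\langle v,x\rangle|^{\kappa_v}$, $f^+=\frac{|f|+f}{2}$, and $$M_1(r,f)=\int_{|y|=r}|f(y)|\,h_k^2(y)\,d\sigma(y).$$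 The zero polynomial is regarded as having degree less than every nonnegative integer. *)

theory Defs
  imports "HOL-Analysis.Analysis" "HOL-Algebra.Generated_Groups" "HOL-Library.Poly_Mapping"
begin

definition reflection :: "real^'n \<Rightarrow> real^'n \<Rightarrow> real^'n" where
  "reflection v x = x - (2 * (x \<bullet> v) / (norm v)\<^sup>2) *\<^sub>R v"

definition root_system :: "(real^'n) set \<Rightarrow> bool" where
  "root_system R \<longleftrightarrow> finite R \<and> 0 \<notin> R \<and>
     (\<forall>v\<in>R. reflection v ` R = R \<and> R \<inter> range (\<lambda>c. c *\<^sub>R v) = {v, - v})"

definition orthogonal_group :: "(real^'n \<Rightarrow> real^'n) monoid" where
  "orthogonal_group =
     \<lparr>carrier = {g. orthogonal_transformation g}, monoid.mult = (\<circ>), one = id\<rparr>"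

definition coxeter_group :: "(real^'n) set \<Rightarrow> (real^'n \<Rightarrow> real^'n) set" where
  "coxeter_group R = generate orthogonal_group (reflection ` R)"

text \<open>The vector \<^term>\<open>u\<close> is a normal of the separating hyperplane; the separation is strict,
  that is, no root lies on the hyperplane.\<close>

definition positive_subsystem :: "(real^'n) set \<Rightarrow> (real^'n) set \<Rightarrow> bool" where
  "positive_subsystem R Rp \<longleftrightarrow> Rp \<subseteq> R \<and> R = Rp \<union> uminus ` Rp \<and>
     (\<exists>u. u \<noteq> 0 \<and> (\<forall>v\<in>Rp. u \<bullet> v > 0) \<and> (\<forall>v\<in>uminus ` Rp. u \<bullet> v < 0))"

definition multiplicity_function :: "(real^'n) set \<Rightarrow> (real^'n \<Rightarrow> real) \<Rightarrow> bool" where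
  "multiplicity_function R \<kappa> \<longleftrightarrow> (\<forall>g\<in>coxeter_group R. \<forall>v\<in>R. \<kappa> (g v) = \<kappa> v)"

definition has_partial :: "'n \<Rightarrow> (real^'n \<Rightarrow> real) \<Rightarrow> real^'n \<Rightarrow> bool" where
  "has_partial j f x \<longleftrightarrow> (\<lambda>t::real. f (x + t *\<^sub>R axis j 1)) differentiable (at 0)"

definition partial :: "'n \<Rightarrow> (real^'n \<Rightarrow> real) \<Rightarrow> real^'n \<Rightarrow> real" where
  "partial j f x = deriv (\<lambda>t::real. f (x + t *\<^sub>R axis j 1)) 0"

primrec C_class :: "nat \<Rightarrow> (real^'n \<Rightarrow> real) \<Rightarrow> bool" where
  "C_class 0 f \<longleftrightarrow> continuous_on UNIV f"
| "C_class (Suc m) f \<longleftrightarrow> continuous_on UNIV f \<and>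
     (\<forall>j. (\<forall>x. has_partial j f x) \<and> C_class m (partial j f))"

text \<open>On the hyperplane orthogonal to \<^term>\<open>v\<close> the difference quotient is the limit from off the
  hyperplane; this limit exists whenever \<^term>\<open>f\<close> is continuously differentiable.\<close>

definition dunkl_quotient :: "(real^'n \<Rightarrow> real) \<Rightarrow> real^'n \<Rightarrow> real^'n \<Rightarrow> real" where
  "dunkl_quotient f v x =
     (if x \<bullet> v \<noteq> 0 then (f x - f (reflection v x)) / (x \<bullet> v)
      else Lim (at x within {y. y \<bullet> v \<noteq> 0}) (\<lambda>y. (f y - f (reflection v y)) / (y \<bullet> v)))"

definition dunkl_operator ::
    "(real^'n) set \<Rightarrow> (real^'n \<Rightarrow> real) \<Rightarrow> 'n \<Rightarrow> (real^'n \<Rightarrow> real) \<Rightarrow> real^'n \<Rightarrow> real" where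
  "dunkl_operator Rp \<kappa> j f x =
     partial j f x + (\<Sum>v\<in>Rp. \<kappa> v * dunkl_quotient f v x * v $ j)"

definition dunkl_laplacian ::
    "(real^'n) set \<Rightarrow> (real^'n \<Rightarrow> real) \<Rightarrow> (real^'n \<Rightarrow> real) \<Rightarrow> real^'n \<Rightarrow> real" where
  "dunkl_laplacian Rp \<kappa> f x =
     (\<Sum>j\<in>UNIV. dunkl_operator Rp \<kappa> j (dunkl_operator Rp \<kappa> j f) x)"

text \<open>Surface measure on the sphere of radius $r > 0$ about the origin, as a Borel measure on the
  whole space concentrated on the sphere. The surface measure of a subset $A$ of the sphere is
  $n/r$ times the volume of the cone of all $t y$ with $y \in A$ and $0 < t < 1$, so that total
  mass is $n \omega_n r^{n-1}$ with $\omega_n$ the volume of the unit ball. In dimension 1 this is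
  counting measure on the two points of the sphere.\<close>

definition surface_measure :: "real \<Rightarrow> (real^'n) measure" where
  "surface_measure r = scale_measure (ennreal (real CARD('n) / r))
     (distr (restrict_space lborel (ball 0 r)) borel (\<lambda>x. (r / norm x) *\<^sub>R x))"

text \<open>The case distinction implements $0^0 = 1$, whereas \<^term>\<open>0 powr 0 = (0::real)\<close>.\<close>

definition dunkl_weight :: "(real^'n) set \<Rightarrow> (real^'n \<Rightarrow> real) \<Rightarrow> real^'n \<Rightarrow> real" where
  "dunkl_weight Rp \<kappa> x = (\<Prod>v\<in>Rp. if \<kappa> v = 0 then 1 else \<bar>v \<bullet> x\<bar> powr \<kappa> v)"

definition M1 :: "(real^'n) set \<Rightarrow> (real^'n \<Rightarrow> real) \<Rightarrow> real \<Rightarrow> (real^'n \<Rightarrow> real) \<Rightarrow> real" where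
  "M1 Rp \<kappa> r f = (LINT y|surface_measure r. \<bar>f y\<bar> * (dunkl_weight Rp \<kappa> y)\<^sup>2)"

definition fplus :: "(real^'n \<Rightarrow> real) \<Rightarrow> real^'n \<Rightarrow> real" where
  "fplus f x = (\<bar>f x\<bar> + f x) / 2"

text \<open>A polynomial is a finitely supported family of coefficients indexed by the exponent
  vectors of the monomials.\<close>

type_synonym 'n mpolynomial = "(nat^'n) \<Rightarrow>\<^sub>0 real"

definition mpoly_fun :: "'n::finite mpolynomial \<Rightarrow> real^'n \<Rightarrow> real" where
  "mpoly_fun P x = (\<Sum>m\<in>Poly_Mapping.keys P. Poly_Mapping.lookup P m * (\<Prod>i\<in>UNIV. (x $ i) ^ (m $ i)))"

text \<open>Total degree; the zero polynomial has degree \<^term>\<open>-1::int\<close>.\<close>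

definition mpoly_degree :: "'n::finite mpolynomial \<Rightarrow> int" where
  "mpoly_degree P = Max (insert (- 1) ((\<lambda>m. int (\<Sum>i\<in>UNIV. m $ i)) ` Poly_Mapping.keys P))"

end

theory Submission
  imports Defs
begin

text \<open>Write \<open>W = h\<^sup>2\<close> for the weight, \<open>L\<close> for the Dunkl Laplacian and, for a homogeneous polynomial
\<open>H\<close> with \<open>L H = 0\<close> of degree \<open>m\<close> (a harmonic, below), \<open>coef f H t\<close> for the integral of
\<open>f (t y) H(y) W(y)\<close> over the unit sphere. Everything rests on the fact that \<open>L\<^sup>p f = 0\<close> determines
the shape of these coefficients as functions of the radius: \<open>coef f H t\<close> is \<open>t\<^sup>m\<close> times a
polynomial in \<open>t\<^sup>2\<close> with \<open>p\<close> terms (\<open>coef_polyharmonic\<close>). For \<open>H = 1\<close> this is Pizzetti's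
formula: the weighted mean of \<open>f\<close> grows at most like \<open>t\<close> to the power \<open>2 (p - 1)\<close>.

Suppose the lower limit is finite. The mean of \<open>f\<^sup>+\<close> is then bounded by a multiple of \<open>t\<^sup>s\<close> for
arbitrarily large \<open>t\<close>, and since \<open>\<bar>f\<bar> = 2 f\<^sup>+ - f\<close> and \<open>s \<ge> 2 (p - 1)\<close>, so is the mean of \<open>\<bar>f\<bar>\<close>.
Hence every coefficient \<open>coef f H t\<close> is bounded in the same way, along an unbounded set of radii.
As it is a polynomial in \<open>t\<close>, this leaves only the powers \<open>t\<^sup>k\<close> with \<open>k \<le> s\<close>; in particular
\<open>f (t \<cdot>)\<close> is orthogonal on the sphere to the harmonics of degree above \<open>s\<close>. Polynomials are
dense on the sphere and are sums of harmonics there (\<open>fischer_decomposition\<close>), so \<open>f (t \<cdot>)\<close> equals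
its projection to the finitely many harmonics of degree at most \<open>s\<close>, with coefficients
polynomial in \<open>t\<close>: \<open>f\<close> is a polynomial of degree at most \<open>s\<close> (\<open>polynomial_of_growth\<close>).

Conversely, for such a polynomial with part \<open>f\<^sub>s\<close> of degree \<open>s\<close> the lower limit is a limit, namely
the dimension times the mean of \<open>f\<^sub>s\<^sup>+\<close> (\<open>polynomial_mean_tendsto\<close>), and is finite. If \<open>s > 2 (p - 1)\<close>,
the mean of \<open>f\<^sub>s\<close> vanishes by Pizzetti's formula; so when the limit is zero, \<open>\<bar>f\<^sub>s\<bar>\<close> has mean zero
and \<open>f\<^sub>s = 0\<close> (\<open>top_part_zero\<close>). This separates the degrees below \<open>s\<close> from \<open>s\<close> itself.

The formula for the coefficients is proved weakly. The Dunkl operators are antisymmetric for the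
measure \<open>W dx\<close> (\<open>D_antisym\<close>), so \<open>L\<close> is symmetric. Tested against \<open>\<psi>(\<bar>x\<bar>\<^sup>2) H(x)\<close>, on which \<open>L\<close> acts as
an ordinary differential operator in the radius, the symmetry says that the coefficient of \<open>f\<close>
with respect to \<open>H\<close> solves, in polar coordinates and in the weak sense, a radial equation whose
right-hand side is the coefficient of \<open>L f\<close>. Taking the primitive of a cut-off copy of the
unknown as the test function shows that the homogeneous equation has, up to a factor, the
single solution \<open>t\<^sup>m\<close> (\<open>coef_const_interval\<close>). An inhomogeneous right-hand side is removed by
subtracting multiples of \<open>\<bar>x\<bar>\<close> to the power \<open>2 j\<close> times \<open>H\<close>, and induction on \<open>p\<close> finishes.\<close>

section \<open>Functions of class C^k\<close>

lemma has_partialD: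
  assumes "has_partial j f x"
  shows "((\<lambda>t::real. f (x + t *\<^sub>R axis j 1)) has_real_derivative partial j f x) (at 0)"
  using assms unfolding has_partial_def partial_def
  by (simp add: DERIV_deriv_iff_real_differentiable)

lemma partialI:
  assumes "((\<lambda>t::real. f (x + t *\<^sub>R axis j 1)) has_real_derivative D) (at 0)"
  shows "has_partial j f x" "partial j f x = D"
  using assms DERIV_imp_deriv real_differentiable_def
  unfolding has_partial_def partial_def by blast+

lemma C_class_cont: "C_class m f \<Longrightarrow> continuous_on UNIV f"
  by (cases m) auto

lemma C_class_SucI:
  assumes "continuous_on UNIV f"
    and "\<And>j x. ((\<lambda>t::real. f (x + t *\<^sub>R axis j 1)) has_real_derivative g j x) (at 0)"
    and "\<And>j. C_class m (g j)"
  shows "C_class (Suc m) f"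
proof -
  have "partial j f = g j" for j using partialI(2)[OF assms(2)] by blast
  then show ?thesis using assms partialI(1)[OF assms(2)] by simp
qed

lemma C_class_SucD:
  assumes "C_class (Suc m) f"
  shows "has_partial j f x" "C_class m (partial j f)"
    "((\<lambda>t::real. f (x + t *\<^sub>R axis j 1)) has_real_derivative partial j f x) (at 0)"
  using assms has_partialD[of j f x] by auto

lemma C_class_less: "C_class (Suc m) f \<Longrightarrow> C_class m f"
  by (induction m arbitrary: f) auto

lemma C_class_mono: "C_class k f \<Longrightarrow> m \<le> k \<Longrightarrow> C_class m f"
  by (induction k) (use C_class_less le_Suc_eq in blast)+

lemma C_class_const [simp]: "C_class m (\<lambda>x. c)"
proof (induction m arbitrary: c)
  case (Suc m)
  show ?case by (rule C_class_SucI[where g="\<lambda>_ _. 0"]) (auto intro!: derivative_eq_intros Suc)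
qed auto

lemma C_class_add: "C_class m f \<Longrightarrow> C_class m g \<Longrightarrow> C_class m (\<lambda>x. f x + g x)"
proof (induction m arbitrary: f g)
  case 0 then show ?case by (auto intro: continuous_intros)
next
  case (Suc m)
  show ?case
  proof (rule C_class_SucI[where g="\<lambda>j x. partial j f x + partial j g x"])
    show "C_class m (\<lambda>x. partial j f x + partial j g x)" for j
      by (rule Suc.IH) (use Suc.prems in auto)
  qed (use Suc.prems C_class_SucD(3) in \<open>auto intro!: continuous_intros derivative_intros\<close>)
qed

lemma C_class_sum: "(\<And>i. i \<in> I \<Longrightarrow> C_class m (f i)) \<Longrightarrow> C_class m (\<lambda>x. \<Sum>i\<in>I. f i x)"
  by (induction I rule: infinite_finite_induct) (auto intro: C_class_add)

lemma C_class_mult: "C_class m f \<Longrightarrow> C_class m g \<Longrightarrow> C_class m (\<lambda>x. f x * g x)"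
proof (induction m arbitrary: f g)
  case 0 then show ?case by (auto intro: continuous_intros)
next
  case (Suc m)
  show ?case
  proof (rule C_class_SucI[where g="\<lambda>j x. partial j f x * g x + f x * partial j g x"])
    show "C_class m (\<lambda>x. partial j f x * g x + f x * partial j g x)" for j
      by (intro C_class_add Suc.IH C_class_less[OF Suc.prems(1)] C_class_less[OF Suc.prems(2)]
          C_class_SucD(2)[OF Suc.prems(1)] C_class_SucD(2)[OF Suc.prems(2)])
    show "((\<lambda>t::real. f (x + t *\<^sub>R axis j 1) * g (x + t *\<^sub>R axis j 1)) has_real_derivative
          partial j f x * g x + f x * partial j g x) (at 0)" for j x
      using C_class_SucD(3)[OF Suc.prems(1), of x j] C_class_SucD(3)[OF Suc.prems(2), of x j]
      by (auto intro!: derivative_eq_intros)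
  qed (use Suc.prems in \<open>auto intro!: continuous_intros\<close>)
qed

lemma C_class_cmult: "C_class m f \<Longrightarrow> C_class m (\<lambda>x. c * f x)"
  by (simp add: C_class_mult)

lemma C_class_diff: "C_class m f \<Longrightarrow> C_class m g \<Longrightarrow> C_class m (\<lambda>x. f x - g x)"
  using C_class_add[of m f "\<lambda>x. - 1 * g x"] C_class_cmult[of m g "-1"] by simp

lemma partial_along_line:
  assumes "\<And>x. has_partial j f x"
  shows "((\<lambda>t::real. f (x + t *\<^sub>R axis j 1)) has_real_derivative partial j f (x + s *\<^sub>R axis j 1)) (at s)"
proof -
  have h: "((\<lambda>t::real. f ((x + s *\<^sub>R axis j 1) + t *\<^sub>R axis j 1)) has_real_derivative partial j f (x + s *\<^sub>R axis j 1)) (at (s - s))"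
    using has_partialD[OF assms] by simp
  have d: "((\<lambda>t. t - s) has_real_derivative 1) (at s)" by (auto intro!: derivative_eq_intros)
  from DERIV_chain2[where g="\<lambda>t. t - s", OF h d]
  have "((\<lambda>t::real. f ((x + s *\<^sub>R axis j 1) + (t - s) *\<^sub>R axis j 1)) has_real_derivative partial j f (x + s *\<^sub>R axis j 1)) (at s)"
    by simp
  then show ?thesis by (simp add: algebra_simps)
qed

text \<open>Continuous partial derivatives give the total derivative. It is needed for the chain rule along
the segments from a point to its mirror image, which are not parallel to the axes.\<close>

lemma C_class_has_derivative:
  fixes f :: "real^'n \<Rightarrow> real"
  assumes f: "C_class (Suc 0) f"
  shows "(f has_derivative (\<lambda>h. \<Sum>i\<in>UNIV. partial i f x * h $ i)) (at x)"
  unfolding has_derivative_at_alt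
proof (intro conjI allI impI)
  show "bounded_linear (\<lambda>h. \<Sum>i\<in>UNIV. partial i f x * h $ i)"
    by (intro bounded_linear_sum bounded_linear_const_mult bounded_linear_vec_nth)
  fix e :: real assume e: "e > 0"
  define e' where "e' = e / real CARD('n)"
  have e': "e' > 0" using e by (simp add: e'_def)
  have "\<forall>i. \<exists>d>0. \<forall>z. norm (z - x) < d \<longrightarrow> \<bar>partial i f z - partial i f x\<bar> < e'"
  proof
    fix i
    have "continuous_on UNIV (partial i f)" using C_class_SucD(2)[OF f] by (rule C_class_cont)
    then show "\<exists>d>0. \<forall>z. norm (z - x) < d \<longrightarrow> \<bar>partial i f z - partial i f x\<bar> < e'"
      unfolding continuous_on_iff dist_norm using e' by (auto simp: dist_norm)
  qed
  then obtain d where d: "\<And>i. d i > 0" "\<And>i z. norm (z - x) < d i \<Longrightarrow> \<bar>partial i f z - partial i f x\<bar> < e'"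
    by metis
  define d0 where "d0 = Min (range d)"
  have d0: "d0 > 0" "\<And>i. d0 \<le> d i" using d(1) by (auto simp: d0_def)
  show "\<exists>d>0. \<forall>y. norm (y - x) < d \<longrightarrow>
      norm (f y - f x - (\<Sum>i\<in>UNIV. partial i f x * (y - x) $ i)) \<le> e * norm (y - x)"
  proof (intro exI conjI allI impI)
    show "d0 > 0" by fact
    fix y assume y: "norm (y - x) < d0"
    \<comment> \<open>Change the coordinates of x into those of y one at a time, with the mean value theorem
      for each change.\<close>
    define Y where "Y S = (\<chi> i. if i \<in> S then y $ i else x $ i)" for S
    have main: "\<bar>f (Y S) - f x - (\<Sum>i\<in>S. partial i f x * (y - x) $ i)\<bar> \<le> e' * (\<Sum>i\<in>S. \<bar>(y - x) $ i\<bar>)" for S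
    proof (induction S rule: finite_induct[OF finite])
      case 1
      have "Y {} = x" by (simp add: Y_def vec_eq_iff)
      then show ?case by simp
    next
      case (2 k S)
      define a where "a = (y - x) $ k"
      have Yk: "Y (insert k S) = Y S + a *\<^sub>R axis k 1"
        using 2 by (auto simp: Y_def a_def vec_eq_iff axis_def)
      define F where "F t = f (Y S + t *\<^sub>R axis k 1) - t * partial k f x" for t :: real
      have F': "(F has_real_derivative (partial k f (Y S + t *\<^sub>R axis k 1) - partial k f x)) (at t)" for t
        unfolding F_def
        by (auto intro!: derivative_eq_intros partial_along_line C_class_SucD(1)[OF f])
      have bd: "\<bar>partial k f (Y S + t *\<^sub>R axis k 1) - partial k f x\<bar> \<le> e'" if "t \<in> closed_segment 0 a" for t
      proof -
        have "\<bar>t\<bar> \<le> \<bar>a\<bar>" using that by (auto simp: closed_segment_eq_real_ivl split: if_splits)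
        then have "norm (Y S + t *\<^sub>R axis k 1 - x) \<le> norm (y - x)"
          using 2 by (intro norm_le_componentwise_cart) (auto simp: Y_def a_def axis_def)
        then show ?thesis using y d0(2)[of k] d(2)[of "Y S + t *\<^sub>R axis k 1" k] by simp
      qed
      have "\<bar>F a - F 0\<bar> \<le> e' * \<bar>a - 0\<bar>"
        using field_differentiable_bound[of "closed_segment 0 a" F "\<lambda>t. partial k f (Y S + t *\<^sub>R axis k 1) - partial k f x" e' a 0]
          F' bd by (auto intro: has_field_derivative_at_within)
      then have "\<bar>f (Y (insert k S)) - f (Y S) - partial k f x * a\<bar> \<le> e' * \<bar>a\<bar>"
        by (simp add: F_def Yk algebra_simps)
      moreover have "(\<Sum>i\<in>insert k S. partial i f x * (y - x) $ i) = partial k f x * a + (\<Sum>i\<in>S. partial i f x * (y - x) $ i)"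
        "e' * (\<Sum>i\<in>insert k S. \<bar>(y - x) $ i\<bar>) = e' * \<bar>a\<bar> + e' * (\<Sum>i\<in>S. \<bar>(y - x) $ i\<bar>)"
        using 2 by (simp_all add: a_def distrib_left)
      ultimately show ?case using 2 by linarith
    qed
    have "Y UNIV = y" by (simp add: Y_def vec_eq_iff)
    then have "norm (f y - f x - (\<Sum>i\<in>UNIV. partial i f x * (y - x) $ i)) \<le> e' * (\<Sum>i\<in>UNIV. \<bar>(y - x) $ i\<bar>)"
      using main[of UNIV] by simp
    also have "\<dots> \<le> e' * (real CARD('n) * norm (y - x))"
    proof -
      have "(\<Sum>i\<in>UNIV. \<bar>(y - x) $ i\<bar>) \<le> (\<Sum>i\<in>(UNIV::'n set). norm (y - x))"
        by (intro sum_mono component_le_norm_cart)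
      then show ?thesis using e' by simp
    qed
    also have "\<dots> = e * norm (y - x)" by (simp add: e'_def)
    finally show "norm (f y - f x - (\<Sum>i\<in>UNIV. partial i f x * (y - x) $ i)) \<le> e * norm (y - x)" .
  qed
qed

lemma C_class_derivative_along:
  fixes f :: "real^'n \<Rightarrow> real"
  assumes f: "C_class (Suc 0) f" and p: "(p has_vector_derivative p') (at t)"
  shows "((\<lambda>t. f (p t)) has_real_derivative (\<Sum>i\<in>UNIV. partial i f (p t) * p' $ i)) (at t)"
proof -
  have "((\<lambda>t. f (p t)) has_derivative (\<lambda>h. \<Sum>i\<in>UNIV. partial i f (p t) * (h *\<^sub>R p') $ i)) (at t)"
    using diff_chain_at[OF p[unfolded has_vector_derivative_def] C_class_has_derivative[OF f, of "p t"]]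
    by (simp add: o_def)
  moreover have "(\<lambda>h. \<Sum>i\<in>UNIV. partial i f (p t) * (h *\<^sub>R p') $ i)
      = (*) (\<Sum>i\<in>UNIV. partial i f (p t) * p' $ i)"
    by (rule ext) (simp add: sum_distrib_left sum_distrib_right mult_ac)
  ultimately show ?thesis unfolding has_field_derivative_def by simp
qed

section \<open>Regularity of the Dunkl operators\<close>

text \<open>At \<open>t = 1\<close> the argument of \<open>g\<close> is the mirror image of \<open>x\<close>. The case \<open>l = 0\<close> is the average of \<open>g\<close>
over the segment from \<open>x\<close> to its mirror image; the other moments appear when the average is
differentiated in \<open>x\<close>.\<close>

definition line_average :: "nat \<Rightarrow> (real^'n \<Rightarrow> real) \<Rightarrow> real^'n \<Rightarrow> real^'n \<Rightarrow> real" where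
  "line_average l g v x = integral {0..1} (\<lambda>t. t ^ l * g (x - (t * (2 * (x \<bullet> v) / (norm v)\<^sup>2)) *\<^sub>R v))"

lemma line_average_continuous:
  assumes "continuous_on UNIV g" "v \<noteq> 0"
  shows "continuous_on UNIV (line_average l g v)"
proof -
  have "continuous_on (UNIV \<times> cbox 0 1) (\<lambda>(x, t::real). t ^ l * g (x - (t * (2 * (x \<bullet> v) / (norm v)\<^sup>2)) *\<^sub>R v))"
    unfolding split_beta
    by (intro continuous_intros continuous_on_compose2[OF assms(1)]) (use assms(2) in auto)
  from integral_continuous_on_param[OF this] show ?thesis
    unfolding line_average_def[abs_def] by simp
qed

text \<open>Differentiation under the integral sign expresses a partial derivative of the average through
averages of partial derivatives, with the moment raised by one at most; so the induction has to
run over all moments at once.\<close>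

lemma line_average_C_class:
  fixes g :: "real^'n \<Rightarrow> real"
  assumes v: "v \<noteq> 0"
  shows "C_class k g \<Longrightarrow> C_class k (line_average l g v)"
proof (induction k arbitrary: g l)
  case 0 then show ?case using line_average_continuous v by simp
next
  case (Suc k)
  have g1: "C_class (Suc 0) g" using Suc.prems by (rule C_class_mono) simp
  define b where "b x = 2 * (x \<bullet> v) / (norm v)\<^sup>2" for x :: "real^'n"
  have cp: "continuous_on UNIV (partial i g)" for i using C_class_SucD(2)[OF g1] C_class_cont by blast
  have cg: "continuous_on UNIV g" using g1 C_class_cont by blast
  show ?case
  proof (rule C_class_SucI)
    show "continuous_on UNIV (line_average l g v)" using line_average_continuous cg v by blast
    fix j :: 'n
    define G where "G x = line_average l (partial j g) v x
        - b (axis j 1) * (\<Sum>i\<in>UNIV. v $ i * line_average (Suc l) (partial i g) v x)" for x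
    show "C_class k (G)"
      unfolding G_def
      by (intro C_class_diff C_class_cmult C_class_sum Suc.IH C_class_SucD(2)[OF Suc.prems])
    fix x :: "real^'n"
    define p where "p \<tau> t = (x + \<tau> *\<^sub>R axis j 1) - (t * b (x + \<tau> *\<^sub>R axis j 1)) *\<^sub>R v" for \<tau> t :: real
    have bl: "b (x + \<tau> *\<^sub>R axis j 1) = b x + \<tau> * b (axis j 1)" for \<tau>
      by (simp add: b_def inner_add_left algebra_simps add_divide_distrib)
    define D where "D \<tau> t = (\<Sum>i\<in>UNIV. partial i g (p \<tau> t) * (axis j 1 - (t * b (axis j 1)) *\<^sub>R v) $ i)" for \<tau> t
    have pl: "(\<lambda>\<tau>. p \<tau> t) = (\<lambda>\<tau>. (x - (t * b x) *\<^sub>R v) + \<tau> *\<^sub>R (axis j 1 - (t * b (axis j 1)) *\<^sub>R v))" for t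
      by (rule ext) (simp add: p_def bl algebra_simps)
    have pd: "((\<lambda>\<tau>. p \<tau> t) has_vector_derivative axis j 1 - (t * b (axis j 1)) *\<^sub>R v) (at \<tau>)" for \<tau> t
      unfolding pl by (auto intro!: derivative_eq_intros)
    have der: "((\<lambda>\<tau>. t ^ l * g (p \<tau> t)) has_real_derivative t ^ l * D \<tau> t) (at \<tau>)" for \<tau> t
      unfolding D_def
      by (intro DERIV_cmult C_class_derivative_along[OF g1] pd)
    have pc: "continuous_on (UNIV \<times> cbox 0 (1::real)) (\<lambda>z. p (fst z) (snd z))"
      unfolding p_def bl by (intro continuous_intros)
    have Dc: "continuous_on (UNIV \<times> cbox 0 1) (\<lambda>(\<tau>, t). t ^ l * D \<tau> t)"
      unfolding D_def split_beta
      by (intro continuous_intros continuous_on_compose2[OF cp pc]) auto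
    have int: "(\<lambda>t. t ^ l * g (p \<tau> t)) integrable_on cbox 0 1" for \<tau>
      unfolding p_def
      by (intro integrable_continuous continuous_intros continuous_on_compose2[OF cg]) auto
    have "((\<lambda>\<tau>. integral (cbox 0 1) (\<lambda>t. t ^ l * g (p \<tau> t))) has_field_derivative
        integral (cbox 0 1) (\<lambda>t. t ^ l * D 0 t)) (at 0 within UNIV)"
      by (rule leibniz_rule_field_derivative[OF _ int Dc]) (auto intro: der)
    moreover have "integral (cbox 0 1) (\<lambda>t. t ^ l * D 0 t) = G x"
    proof -
      have ii: "(\<lambda>t. t ^ m * partial i g (p 0 t)) integrable_on cbox 0 1" for i m
        unfolding p_def
        by (intro integrable_continuous continuous_intros continuous_on_compose2[OF cp]) auto
      have "t ^ l * D 0 t = t ^ l * partial j g (p 0 t)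
          - b (axis j 1) * (\<Sum>i\<in>UNIV. v $ i * (t ^ Suc l * partial i g (p 0 t)))" for t
      proof -
        have "D 0 t = (\<Sum>i\<in>UNIV. if i = j then partial i g (p 0 t) else 0)
           - (\<Sum>i\<in>UNIV. t * b (axis j 1) * v $ i * partial i g (p 0 t))"
          unfolding D_def sum_subtractf[symmetric]
          by (intro sum.cong) (auto simp: axis_def algebra_simps)
        also have "(\<Sum>i\<in>UNIV. t * b (axis j 1) * v $ i * partial i g (p 0 t))
           = t * b (axis j 1) * (\<Sum>i\<in>UNIV. v $ i * partial i g (p 0 t))"
          by (simp add: sum_distrib_left mult_ac)
        finally have Deq: "D 0 t = partial j g (p 0 t)
            - t * b (axis j 1) * (\<Sum>i\<in>UNIV. v $ i * partial i g (p 0 t))" by simp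
        have "t ^ l * D 0 t = t ^ l * partial j g (p 0 t)
            - b (axis j 1) * (t ^ Suc l * (\<Sum>i\<in>UNIV. v $ i * partial i g (p 0 t)))"
          unfolding Deq by (simp add: algebra_simps)
        also have "t ^ Suc l * (\<Sum>i\<in>UNIV. v $ i * partial i g (p 0 t)) = (\<Sum>i\<in>UNIV. v $ i * (t ^ Suc l * partial i g (p 0 t)))"
          by (simp add: sum_distrib_left mult_ac)
        finally show ?thesis .
      qed
      then have "integral (cbox 0 1) (\<lambda>t. t ^ l * D 0 t) = integral (cbox 0 1) (\<lambda>t. t ^ l * partial j g (p 0 t))
          - integral (cbox 0 1) (\<lambda>t. b (axis j 1) * (\<Sum>i\<in>UNIV. v $ i * (t ^ Suc l * partial i g (p 0 t))))"
        by (simp only:) (rule integral_diff, use ii in \<open>auto intro!: integrable_on_mult_right integrable_sum simp del: power_Suc\<close>)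
      also have "\<dots> = G x"
        unfolding G_def line_average_def p_def b_def
        by (subst integral_mult_right, subst integral_sum)
          (use ii in \<open>auto intro!: integrable_on_mult_right simp: p_def b_def simp del: power_Suc\<close>)
      finally show ?thesis .
    qed
    ultimately show "((\<lambda>t. line_average l g v (x + t *\<^sub>R axis j 1)) has_real_derivative G x) (at 0)"
      unfolding line_average_def p_def b_def by simp
  qed
qed

lemma reflection_diff_line_average:
  fixes f :: "real^'n \<Rightarrow> real"
  assumes f: "C_class (Suc 0) f" and v: "v \<noteq> 0"
  shows "f x - f (reflection v x) = (2 / (norm v)\<^sup>2) * (\<Sum>i\<in>UNIV. v $ i * line_average 0 (partial i f) v x) * (x \<bullet> v)"
proof -
  define b where "b = 2 * (x \<bullet> v) / (norm v)\<^sup>2"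
  define p where "p t = x - (t * b) *\<^sub>R v" for t :: real
  have cp: "continuous_on UNIV (partial i f)" for i using C_class_SucD(2)[OF f] C_class_cont by blast
  have ii: "(\<lambda>t. partial i f (p t)) integrable_on {0..1}" for i
    unfolding p_def
    by (intro integrable_continuous_real continuous_intros continuous_on_compose2[OF cp]) auto
  have "((\<lambda>t. f (p t)) has_real_derivative (\<Sum>i\<in>UNIV. partial i f (p t) * (- b *\<^sub>R v) $ i)) (at t)" for t
    by (rule C_class_derivative_along[OF f]) (auto simp: p_def intro!: derivative_eq_intros)
  then have "((\<lambda>t. \<Sum>i\<in>UNIV. partial i f (p t) * (- b *\<^sub>R v) $ i) has_integral (f (p 1) - f (p 0))) {0..1}"
    by (intro fundamental_theorem_of_calculus)
      (auto simp: has_real_derivative_iff_has_vector_derivative[symmetric] intro: has_field_derivative_at_within)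
  from integral_unique[OF this]
  have "f (p 1) - f (p 0) = integral {0..1} (\<lambda>t. \<Sum>i\<in>UNIV. (- b * v $ i) * partial i f (p t))"
    by (simp add: mult_ac)
  also have "\<dots> = (\<Sum>i\<in>UNIV. (- b * v $ i) * integral {0..1} (\<lambda>t. partial i f (p t)))"
    using ii by (subst integral_sum) (auto intro!: integrable_neg integrable_on_mult_right simp: mult.assoc)
  finally have "f (p 0) - f (p 1) = (\<Sum>i\<in>UNIV. (b * v $ i) * integral {0..1} (\<lambda>t. partial i f (p t)))"
    by (simp add: sum_negf)
  then show ?thesis
    by (simp add: p_def b_def reflection_def line_average_def sum_distrib_left sum_distrib_right algebra_simps)
qed

text \<open>The complement of a hyperplane is dense, so the limit that defines the quotient on the
hyperplane is the value of any continuous extension.\<close>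

lemma dunkl_quotient_eqI:
  fixes f :: "real^'n \<Rightarrow> real"
  assumes Q: "continuous_on UNIV Q" and eq: "\<And>x. Q x * (x \<bullet> v) = f x - f (reflection v x)" and v: "v \<noteq> 0"
  shows "dunkl_quotient f v = Q"
proof
  fix x
  let ?A = "{y. y \<bullet> v \<noteq> 0}"
  have off: "(f y - f (reflection v y)) / (y \<bullet> v) = Q y" if "y \<bullet> v \<noteq> 0" for y
    using eq[of y] that by (simp add: field_simps)
  show "dunkl_quotient f v x = Q x"
  proof (cases "x \<bullet> v = 0")
    case False then show ?thesis by (simp add: dunkl_quotient_def off)
  next
    case True
    have nb: "at x within ?A \<noteq> bot"
    proof -
      have "x islimpt ?A"
        unfolding islimpt_approachable
      proof (intro allI impI)
        fix e :: real assume e: "e > 0"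
        define d where "d = e / (2 * norm v)"
        have d: "d > 0" using e v by (simp add: d_def)
        have "(x + d *\<^sub>R v) \<in> ?A" using True d v by (simp add: inner_add_left)
        moreover have "dist (x + d *\<^sub>R v) x < e" using e v d by (simp add: dist_norm d_def)
        moreover have "x + d *\<^sub>R v \<noteq> x" using d v by simp
        ultimately show "\<exists>x'\<in>?A. x' \<noteq> x \<and> dist x' x < e" by blast
      qed
      then show ?thesis by (simp add: trivial_limit_within)
    qed
    have "(Q \<longlongrightarrow> Q x) (at x within ?A)"
      using Q by (metis continuous_on_eq_continuous_within UNIV_I continuous_within_subset subset_UNIV continuous_within)
    then have "((\<lambda>y. (f y - f (reflection v y)) / (y \<bullet> v)) \<longlongrightarrow> Q x) (at x within ?A)"
      by (rule Lim_transform_eventually) (auto simp: eventually_at_filter off)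
    then show ?thesis using True nb by (simp add: dunkl_quotient_def tendsto_Lim)
  qed
qed

text \<open>By the fundamental theorem of calculus the difference quotient is an average of the directional
derivative, which loses one order of differentiability and has no singularity.\<close>

lemma C_class_dunkl_quotient:
  fixes f :: "real^'n \<Rightarrow> real"
  assumes f: "C_class (Suc k) f" and v: "v \<noteq> 0"
  shows "C_class k (dunkl_quotient f v)"
    and "dunkl_quotient f v x * (x \<bullet> v) = f x - f (reflection v x)"
proof -
  let ?Q = "\<lambda>x. (2 / (norm v)\<^sup>2) * (\<Sum>i\<in>UNIV. v $ i * line_average 0 (partial i f) v x)"
  have f1: "C_class (Suc 0) f" using f by (rule C_class_mono) simp
  have Q: "C_class k ?Q"
    by (intro C_class_cmult C_class_sum line_average_C_class v C_class_SucD(2)[OF f])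
  have eq: "?Q x * (x \<bullet> v) = f x - f (reflection v x)" for x
    using reflection_diff_line_average[OF f1 v, of x] by simp
  have "dunkl_quotient f v = ?Q"
    by (rule dunkl_quotient_eqI[OF C_class_cont[OF Q] eq v])
  then show "C_class k (dunkl_quotient f v)" "dunkl_quotient f v x * (x \<bullet> v) = f x - f (reflection v x)"
    using Q eq[of x] by auto
qed

lemma C_class_dunkl_operator:
  assumes "C_class (Suc k) f" "0 \<notin> Rp"
  shows "C_class k (dunkl_operator Rp \<kappa> j f)"
proof -
  have "C_class k (\<lambda>x. partial j f x + (\<Sum>v\<in>Rp. (\<kappa> v * v $ j) * dunkl_quotient f v x))"
    by (intro C_class_add C_class_sum C_class_cmult C_class_SucD(2)[OF assms(1)] C_class_dunkl_quotient(1)[OF assms(1)])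
      (use assms(2) in auto)
  then show ?thesis unfolding dunkl_operator_def[abs_def] by (simp add: mult_ac)
qed

lemma C_class_dunkl_laplacian:
  assumes "C_class (Suc (Suc k)) f" "0 \<notin> Rp"
  shows "C_class k (dunkl_laplacian Rp \<kappa> f)"
  unfolding dunkl_laplacian_def[abs_def]
  by (intro C_class_sum C_class_dunkl_operator assms)

section \<open>Reflections and radial functions\<close>

lemma reflection_inner: "reflection v x \<bullet> v = - (x \<bullet> v)"
  by (cases "v = 0") (simp_all add: reflection_def inner_diff_left power2_norm_eq_inner)

lemma reflection_inner_self: "reflection v x \<bullet> reflection v x = x \<bullet> x"
proof (cases "v = 0")
  case False
  then have vv: "v \<bullet> v \<noteq> 0" by simp
  show ?thesis unfolding reflection_def power2_norm_eq_inner
    using vv by (simp add: inner_diff_left inner_diff_right inner_commute[of v x] field_simps)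
qed (simp add: reflection_def)

lemma norm_reflection: "norm (reflection v x) = norm x"
  by (simp add: norm_eq_sqrt_inner reflection_inner_self)

lemma reflection_nth: "reflection v x $ i = x $ i - 2 * v $ i / (norm v)\<^sup>2 * (x \<bullet> v)"
  by (simp add: reflection_def)

lemma linear_reflection: "linear (reflection v)"
  by (rule linearI) (auto simp: reflection_def inner_add_left algebra_simps add_divide_distrib)

lemma continuous_on_reflection [continuous_intros]: "continuous_on S (reflection v)"
  using linear_reflection linear_continuous_on linear_conv_bounded_linear by blast

lemma reflection_reflection: "reflection v (reflection v x) = x"
proof (cases "v = 0")
  case False
  have "reflection v (reflection v x) = reflection v x - (2 * (reflection v x \<bullet> v) / (norm v)\<^sup>2) *\<^sub>R v"
    by (subst reflection_def) simp
  also have "\<dots> = x" unfolding reflection_inner by (simp add: reflection_def)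
  finally show ?thesis .
qed (simp add: reflection_def)

lemma has_real_derivative_continuous_on:
  "(\<And>u. (\<psi> has_real_derivative \<psi>' u) (at u)) \<Longrightarrow> continuous_on UNIV \<psi>"
  by (rule DERIV_continuous_on)

lemma has_partial_coord: "((\<lambda>t::real. (x + t *\<^sub>R axis j 1) $ i) has_real_derivative (if i = j then 1 else 0)) (at 0)"
  by (auto simp: axis_def intro!: derivative_eq_intros)

lemma C_class_coord [simp]: "C_class m (\<lambda>x. x $ i)"
proof (cases m)
  case (Suc l)
  show ?thesis unfolding Suc
    by (rule C_class_SucI[OF _ has_partial_coord]) (auto intro!: continuous_intros)
qed (auto intro!: continuous_intros)

text \<open>Radial functions are written as functions of \<open>x \<bullet> x\<close>, which is smooth at the origin.\<close>

lemma has_partial_radial: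
  assumes "\<And>u. (\<psi> has_real_derivative \<psi>' u) (at u)"
  shows "((\<lambda>t::real. \<psi> ((x + t *\<^sub>R axis j 1) \<bullet> (x + t *\<^sub>R axis j 1))) has_real_derivative 2 * x $ j * \<psi>' (x \<bullet> x)) (at 0)"
proof -
  have "((\<lambda>t::real. (x + t *\<^sub>R axis j 1) \<bullet> (x + t *\<^sub>R axis j 1)) has_real_derivative 2 * x $ j) (at 0)"
    by (auto simp: inner_add_left inner_add_right inner_axis inner_axis' inner_commute algebra_simps intro!: derivative_eq_intros)
  from DERIV_chain2[OF assms this] show ?thesis by (simp add: mult_ac)
qed

lemma C_class_1_radial:
  assumes "\<And>u. (\<psi> has_real_derivative \<psi>' u) (at u)" "continuous_on UNIV \<psi>'"
  shows "C_class (Suc 0) (\<lambda>x::real^'n. \<psi> (x \<bullet> x))"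
proof (rule C_class_SucI[OF _ has_partial_radial[OF assms(1)]])
  have "continuous_on UNIV \<psi>" using assms(1) by (rule has_real_derivative_continuous_on)
  from continuous_on_compose2[OF this, of UNIV "\<lambda>x::real^'n. x \<bullet> x"] show "continuous_on UNIV (\<lambda>x::real^'n. \<psi> (x \<bullet> x))"
    by (simp add: continuous_on_inner)
  show "C_class 0 (\<lambda>x. 2 * x $ j * \<psi>' (x \<bullet> x))" for j :: 'n
    by simp (intro continuous_on_compose2[OF assms(2)] continuous_intros, auto)
qed

lemma C_class_2_radial:
  assumes "\<And>u. (\<psi> has_real_derivative \<psi>' u) (at u)" "\<And>u. (\<psi>' has_real_derivative \<psi>'' u) (at u)"
    "continuous_on UNIV \<psi>''"
  shows "C_class (Suc (Suc 0)) (\<lambda>x::real^'n. \<psi> (x \<bullet> x))"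
proof (rule C_class_SucI[OF _ has_partial_radial[OF assms(1)]])
  have "continuous_on UNIV \<psi>" using assms(1) by (rule has_real_derivative_continuous_on)
  from continuous_on_compose2[OF this, of UNIV "\<lambda>x::real^'n. x \<bullet> x"] show "continuous_on UNIV (\<lambda>x::real^'n. \<psi> (x \<bullet> x))"
    by (simp add: continuous_on_inner)
  show "C_class (Suc 0) (\<lambda>x. 2 * x $ j * \<psi>' (x \<bullet> x))" for j :: 'n
    by (intro C_class_mult C_class_const C_class_coord C_class_1_radial[OF assms(2,3)])
qed

section \<open>Homogeneous polynomials\<close>

text \<open>Multiplying by one coordinate at a time makes the product rules for partial derivatives and for
difference quotients the induction steps.\<close>

inductive hpoly :: "nat \<Rightarrow> (real^'n \<Rightarrow> real) \<Rightarrow> bool" where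
  hpoly_const: "hpoly 0 (\<lambda>x. c)"
| hpoly_coord: "hpoly k q \<Longrightarrow> hpoly (Suc k) (\<lambda>x. x $ i * q x)"
| hpoly_add: "hpoly k q \<Longrightarrow> hpoly k q' \<Longrightarrow> hpoly k (\<lambda>x. q x + q' x)"

lemma hpoly_cmult: "hpoly k q \<Longrightarrow> hpoly k (\<lambda>x. c * q x)"
proof (induction rule: hpoly.induct)
  case (hpoly_coord k q i)
  from hpoly.hpoly_coord[OF this(2), of i] show ?case by (simp add: mult_ac)
next
  case (hpoly_add k q q')
  from hpoly.hpoly_add[OF this(3,4)] show ?case by (simp add: distrib_left)
qed (rule hpoly.hpoly_const)

lemma hpoly_zero [simp]: "hpoly k (\<lambda>x. 0)"
proof (induction k)
  case (Suc k)
  from hpoly.hpoly_coord[OF this] show ?case by simp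
qed (rule hpoly.hpoly_const)

lemma hpoly_sum: "(\<And>i. i \<in> I \<Longrightarrow> hpoly k (q i)) \<Longrightarrow> hpoly k (\<lambda>x. \<Sum>i\<in>I. q i x)"
  by (induction I rule: infinite_finite_induct) (auto intro: hpoly_add)

lemma hpoly_diff: "hpoly k q \<Longrightarrow> hpoly k q' \<Longrightarrow> hpoly k (\<lambda>x. q x - q' x)"
  using hpoly_add[of k q "\<lambda>x. -1 * q' x"] hpoly_cmult[of k q' "-1"] by simp

lemma hpoly_inner: "hpoly k q \<Longrightarrow> hpoly (Suc k) (\<lambda>x. (x \<bullet> u) * q x)"
proof -
  assume q: "hpoly k q"
  have "(\<lambda>x. (x \<bullet> u) * q x) = (\<lambda>x. \<Sum>i\<in>UNIV. u $ i * (x $ i * q x))"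
    by (simp add: inner_vec_def sum_distrib_left sum_distrib_right mult_ac)
  then show ?thesis using q by (auto intro!: hpoly_sum hpoly_cmult hpoly_coord)
qed

lemma hpoly_mult: "hpoly k q \<Longrightarrow> hpoly l q' \<Longrightarrow> hpoly (k + l) (\<lambda>x. q x * q' x)"
proof (induction rule: hpoly.induct)
  case (hpoly_coord k q i)
  from hpoly.hpoly_coord[OF hpoly_coord.IH[OF hpoly_coord.prems], of i] show ?case by (simp add: mult_ac)
next
  case (hpoly_add k q1 q2)
  from hpoly.hpoly_add[OF hpoly_add.IH(1)[OF hpoly_add.prems] hpoly_add.IH(2)[OF hpoly_add.prems]]
  show ?case by (simp add: distrib_right)
qed (simp add: hpoly_cmult)

lemma hpoly_radial: "hpoly (2 * i) (\<lambda>x. (x \<bullet> x) ^ i)"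
proof (induction i)
  case 0 then show ?case by (simp add: hpoly_const)
next
  case (Suc i)
  have "hpoly 2 (\<lambda>x::real^'a. x \<bullet> x)"
  proof -
    have "hpoly (Suc (Suc 0)) (\<lambda>x::real^'a. \<Sum>i\<in>UNIV. x $ i * (x $ i * 1))"
      by (intro hpoly_sum hpoly_coord hpoly_const)
    then show ?thesis by (simp add: inner_vec_def numeral_2_eq_2)
  qed
  from hpoly_mult[OF this Suc] show ?case by simp
qed

lemma hpoly_reflection: "hpoly k q \<Longrightarrow> hpoly k (\<lambda>x. q (reflection v x))"
proof (induction rule: hpoly.induct)
  case (hpoly_coord k q i)
  have eq: "(\<lambda>x. reflection v x $ i * q (reflection v x)) =
      (\<lambda>x. x $ i * q (reflection v x) - 2 * v $ i / (norm v)\<^sup>2 * ((x \<bullet> v) * q (reflection v x)))"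
    by (rule ext) (simp only: reflection_nth left_diff_distrib mult.assoc)
  show ?case unfolding eq by (intro hpoly_diff hpoly_cmult hpoly_inner hpoly.hpoly_coord hpoly_coord.IH)
qed (auto intro: hpoly.intros)

lemma hpoly_C_class: "hpoly k q \<Longrightarrow> C_class m q"
  by (induction rule: hpoly.induct) (auto intro: C_class_add C_class_mult)

lemma hpoly_continuous: "hpoly k q \<Longrightarrow> continuous_on S q"
  using C_class_cont[OF hpoly_C_class] continuous_on_subset by blast

lemma hpoly_scale: "hpoly k q \<Longrightarrow> q (t *\<^sub>R x) = t ^ k * q x"
  by (induction rule: hpoly.induct) (auto simp: algebra_simps)

lemma hpoly_partial_exists:
  "hpoly k q \<Longrightarrow> \<exists>q'. (\<forall>x. ((\<lambda>t::real. q (x + t *\<^sub>R axis j 1)) has_real_derivative q' x) (at 0)) \<and>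
     (k = 0 \<longrightarrow> q' = (\<lambda>x. 0)) \<and> hpoly (k - 1) q'"
proof (induction rule: hpoly.induct)
  case (hpoly_const c)
  show ?case by (rule exI[of _ "\<lambda>x. 0"]) auto
next
  case (hpoly_coord k q i)
  then obtain q' where q': "\<And>x. ((\<lambda>t::real. q (x + t *\<^sub>R axis j 1)) has_real_derivative q' x) (at 0)"
    "k = 0 \<longrightarrow> q' = (\<lambda>x. 0)" "hpoly (k - 1) q'" by metis
  have h: "hpoly k (\<lambda>x. x $ i * q' x)"
    using q'(2,3) hpoly.hpoly_coord[OF q'(3), of i] by (cases k) auto
  show ?case
  proof (intro exI conjI allI impI)
    show "((\<lambda>t. (x + t *\<^sub>R axis j 1) $ i * q (x + t *\<^sub>R axis j 1)) has_real_derivative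
        (if i = j then 1 else 0) * q x + x $ i * q' x) (at 0)" for x
      using DERIV_mult[OF has_partial_coord[of x j i] q'(1)[of x]] by (simp add: mult_ac)
    show "hpoly (Suc k - 1) (\<lambda>x. (if i = j then 1 else 0) * q x + x $ i * q' x)"
      using hpoly_add[OF hpoly_cmult[OF hpoly_coord.hyps, of "if i = j then 1 else 0"] h] by simp
  qed auto
next
  case (hpoly_add k q1 q2)
  from hpoly_add.IH(1) obtain q1' where q1': "\<And>x. ((\<lambda>t::real. q1 (x + t *\<^sub>R axis j 1)) has_real_derivative q1' x) (at 0)"
    "k = 0 \<longrightarrow> q1' = (\<lambda>x. 0)" "hpoly (k - 1) q1'" by metis
  from hpoly_add.IH(2) obtain q2' where q2': "\<And>x. ((\<lambda>t::real. q2 (x + t *\<^sub>R axis j 1)) has_real_derivative q2' x) (at 0)"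
    "k = 0 \<longrightarrow> q2' = (\<lambda>x. 0)" "hpoly (k - 1) q2'" by metis
  show ?case
    by (rule exI[of _ "\<lambda>x. q1' x + q2' x"]) (use q1' q2' in \<open>auto intro!: derivative_intros hpoly.hpoly_add\<close>)
qed

lemma hpoly_partial:
  assumes "hpoly k q"
  shows "hpoly (k - 1) (partial j q)" "k = 0 \<Longrightarrow> partial j q = (\<lambda>x. 0)"
proof -
  obtain q' where q': "\<And>x. ((\<lambda>t::real. q (x + t *\<^sub>R axis j 1)) has_real_derivative q' x) (at 0)"
     "k = 0 \<longrightarrow> q' = (\<lambda>x. 0)" "hpoly (k - 1) q'"
    using hpoly_partial_exists[OF assms, of j] by metis
  have "partial j q = q'" using partialI(2)[OF q'(1)] by blast
  then show "hpoly (k - 1) (partial j q)" "k = 0 \<Longrightarrow> partial j q = (\<lambda>x. 0)" using q' by auto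
qed

text \<open>The difference quotient obeys a twisted Leibniz rule, and the quotient of a coordinate is
constant; so the quotient of a polynomial is again a polynomial, of one degree less.\<close>

lemma hpoly_quotient_exists:
  assumes v: "v \<noteq> 0"
  shows "hpoly k q \<Longrightarrow> \<exists>Q. (\<forall>x. Q x * (x \<bullet> v) = q x - q (reflection v x)) \<and>
     (k = 0 \<longrightarrow> Q = (\<lambda>x. 0)) \<and> hpoly (k - 1) Q"
proof (induction rule: hpoly.induct)
  case (hpoly_const c)
  show ?case by (rule exI[of _ "\<lambda>x. 0"]) auto
next
  case (hpoly_coord k q i)
  then obtain Q where Q: "\<And>x. Q x * (x \<bullet> v) = q x - q (reflection v x)"
    "k = 0 \<longrightarrow> Q = (\<lambda>x. 0)" "hpoly (k - 1) Q" by metis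
  have h: "hpoly k (\<lambda>x. x $ i * Q x)"
    using Q(2,3) hpoly.hpoly_coord[OF Q(3), of i] by (cases k) auto
  show ?case
  proof (intro exI conjI allI impI)
    show "(x $ i * Q x + 2 * v $ i / (norm v)\<^sup>2 * q (reflection v x)) * (x \<bullet> v)
      = x $ i * q x - reflection v x $ i * q (reflection v x)" for x
    proof -
      have "x $ i * (Q x * (x \<bullet> v)) = x $ i * (q x - q (reflection v x))" by (simp add: Q(1))
      then show ?thesis unfolding reflection_nth by (simp add: algebra_simps)
    qed
    show "hpoly (Suc k - 1) (\<lambda>x. x $ i * Q x + 2 * v $ i / (norm v)\<^sup>2 * q (reflection v x))"
      unfolding diff_Suc_1 by (intro hpoly.hpoly_add h hpoly_cmult hpoly_reflection hpoly_coord.hyps)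
  qed auto
next
  case (hpoly_add k q1 q2)
  from hpoly_add.IH(1) obtain Q1 where Q1: "\<And>x. Q1 x * (x \<bullet> v) = q1 x - q1 (reflection v x)"
    "k = 0 \<longrightarrow> Q1 = (\<lambda>x. 0)" "hpoly (k - 1) Q1" by metis
  from hpoly_add.IH(2) obtain Q2 where Q2: "\<And>x. Q2 x * (x \<bullet> v) = q2 x - q2 (reflection v x)"
    "k = 0 \<longrightarrow> Q2 = (\<lambda>x. 0)" "hpoly (k - 1) Q2" by metis
  show ?case
    by (rule exI[of _ "\<lambda>x. Q1 x + Q2 x"]) (use Q1 Q2 in \<open>auto intro!: hpoly.hpoly_add simp: distrib_right\<close>)
qed

lemma hpoly_dunkl_quotient:
  assumes "hpoly k q" "v \<noteq> 0"
  shows "hpoly (k - 1) (dunkl_quotient q v)" "k = 0 \<Longrightarrow> dunkl_quotient q v = (\<lambda>x. 0)"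
proof -
  obtain Q where Q: "\<And>x. Q x * (x \<bullet> v) = q x - q (reflection v x)"
     "k = 0 \<longrightarrow> Q = (\<lambda>x. 0)" "hpoly (k - 1) Q"
    using hpoly_quotient_exists[OF assms(2,1)] by metis
  have "dunkl_quotient q v = Q"
    by (rule dunkl_quotient_eqI[OF hpoly_continuous[OF Q(3)] Q(1) assms(2)])
  then show "hpoly (k - 1) (dunkl_quotient q v)" "k = 0 \<Longrightarrow> dunkl_quotient q v = (\<lambda>x. 0)" using Q by auto
qed

lemma hpoly_euler:
  assumes "hpoly k q"
  shows "(\<Sum>j\<in>UNIV. x $ j * partial j q x) = real k * q x"
proof -
  have "((\<lambda>t. q (t *\<^sub>R x)) has_real_derivative (\<Sum>i\<in>UNIV. partial i q (1 *\<^sub>R x) * x $ i)) (at 1)"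
    by (rule C_class_derivative_along[OF hpoly_C_class[OF assms]]) (auto intro!: derivative_eq_intros)
  moreover have "((\<lambda>t. q (t *\<^sub>R x)) has_real_derivative real k * q x) (at 1)"
    unfolding hpoly_scale[OF assms] by (auto intro!: derivative_eq_intros)
  ultimately show ?thesis by (auto dest: DERIV_unique simp: mult_ac)
qed

section \<open>Product rules for the Dunkl operators\<close>

locale dunkl =
  fixes R Rp :: "(real^'n) set" and \<kappa> :: "real^'n \<Rightarrow> real"
  assumes root_system: "root_system R" and positive_subsystem: "positive_subsystem R Rp"
    and multiplicity: "multiplicity_function R \<kappa>" and nonneg: "\<forall>v\<in>R. \<kappa> v \<ge> 0"
begin

abbreviation "D \<equiv> dunkl_operator Rp \<kappa>"
abbreviation "L \<equiv> dunkl_laplacian Rp \<kappa>"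
definition "\<gamma> = (\<Sum>v\<in>Rp. \<kappa> v)"
definition "euler (f :: real^'n \<Rightarrow> real) x = (\<Sum>j\<in>UNIV. x $ j * partial j f x)"

lemma Rp_sub: "Rp \<subseteq> R" using positive_subsystem by (simp add: positive_subsystem_def)
lemma finite_Rp: "finite Rp" using Rp_sub root_system finite_subset by (auto simp: root_system_def)
lemma zero_notin_Rp: "0 \<notin> Rp" using Rp_sub root_system by (auto simp: root_system_def)
lemma Rp_nonzero: "v \<in> Rp \<Longrightarrow> v \<noteq> 0" using zero_notin_Rp by auto
lemma kappa_nonneg: "v \<in> Rp \<Longrightarrow> \<kappa> v \<ge> 0" using nonneg Rp_sub by auto
lemma gamma_nonneg: "\<gamma> \<ge> 0" unfolding \<gamma>_def by (intro sum_nonneg kappa_nonneg)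

lemma dunkl_operator_eqI:
  assumes f: "\<And>x. ((\<lambda>t::real. f (x + t *\<^sub>R axis j 1)) has_real_derivative f' x) (at 0)"
    and Q: "\<And>v. v \<in> Rp \<Longrightarrow> continuous_on UNIV (Q v)"
      "\<And>v x. v \<in> Rp \<Longrightarrow> Q v x * (x \<bullet> v) = f x - f (reflection v x)"
  shows "D j f x = f' x + (\<Sum>v\<in>Rp. \<kappa> v * Q v x * v $ j)"
proof -
  have "dunkl_quotient f v = Q v" if "v \<in> Rp" for v
    by (rule dunkl_quotient_eqI[OF Q(1)[OF that] Q(2)[OF that] Rp_nonzero[OF that]])
  then show ?thesis unfolding dunkl_operator_def partialI(2)[OF f] by simp
qed

lemma D_add:
  assumes f: "C_class (Suc 0) f" and g: "C_class (Suc 0) g"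
  shows "D j (\<lambda>x. f x + g x) x = D j f x + D j g x"
proof -
  have "D j (\<lambda>x. f x + g x) x = (partial j f x + partial j g x)
      + (\<Sum>v\<in>Rp. \<kappa> v * (dunkl_quotient f v x + dunkl_quotient g v x) * v $ j)"
    by (rule dunkl_operator_eqI)
      (auto intro!: derivative_intros continuous_intros C_class_SucD(3) f g C_class_dunkl_quotient
        simp: distrib_right C_class_dunkl_quotient(2)[OF f Rp_nonzero] C_class_dunkl_quotient(2)[OF g Rp_nonzero]
        C_class_cont[OF C_class_dunkl_quotient(1)[OF f Rp_nonzero]] C_class_cont[OF C_class_dunkl_quotient(1)[OF g Rp_nonzero]])
  then show ?thesis by (simp add: dunkl_operator_def sum.distrib algebra_simps)
qed

text \<open>Radial functions are invariant under all reflections, so the difference part is linear over them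
and only the differential part contributes a new term.\<close>

lemma D_radial_mult:
  assumes f: "C_class (Suc 0) f" and \<psi>: "\<And>u. (\<psi> has_real_derivative \<psi>' u) (at u)"
  shows "D j (\<lambda>x. \<psi> (x \<bullet> x) * f x) x = \<psi> (x \<bullet> x) * D j f x + 2 * (\<psi>' (x \<bullet> x) * (x $ j * f x))"
proof -
  have c: "continuous_on UNIV \<psi>" using \<psi> by (rule has_real_derivative_continuous_on)
  have "D j (\<lambda>x. \<psi> (x \<bullet> x) * f x) x = (2 * x $ j * \<psi>' (x \<bullet> x) * f x + \<psi> (x \<bullet> x) * partial j f x)
      + (\<Sum>v\<in>Rp. \<kappa> v * (\<psi> (x \<bullet> x) * dunkl_quotient f v x) * v $ j)"
  proof (rule dunkl_operator_eqI)
    show "((\<lambda>t. \<psi> ((x + t *\<^sub>R axis j 1) \<bullet> (x + t *\<^sub>R axis j 1)) * f (x + t *\<^sub>R axis j 1)) has_real_derivative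
      2 * x $ j * \<psi>' (x \<bullet> x) * f x + \<psi> (x \<bullet> x) * partial j f x) (at 0)" for x
      using DERIV_mult[OF has_partial_radial[OF \<psi>, of x j] C_class_SucD(3)[OF f, of x j]] by (simp add: mult_ac)
    show "continuous_on UNIV (\<lambda>x. \<psi> (x \<bullet> x) * dunkl_quotient f v x)" if "v \<in> Rp" for v
      by (intro continuous_intros continuous_on_compose2[OF c] C_class_cont[OF C_class_dunkl_quotient(1)[OF f Rp_nonzero[OF that]]]) auto
    show "\<psi> (x \<bullet> x) * dunkl_quotient f v x * (x \<bullet> v) = \<psi> (x \<bullet> x) * f x - \<psi> (reflection v x \<bullet> reflection v x) * f (reflection v x)"
      if "v \<in> Rp" for v x
      using C_class_dunkl_quotient(2)[OF f Rp_nonzero[OF that], of x]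
      by (simp add: mult.assoc reflection_inner_self right_diff_distrib)
  qed
  then show ?thesis by (simp add: dunkl_operator_def sum_distrib_left algebra_simps)
qed

lemma D_cmult:
  assumes f: "C_class (Suc 0) f"
  shows "D j (\<lambda>x. c * f x) x = c * D j f x"
  using D_radial_mult[OF f, of "\<lambda>_. c" "\<lambda>_. 0" j x] by simp

lemma D_coord_mult:
  assumes f: "C_class (Suc 0) f"
  shows "D j (\<lambda>x. x $ j * f x) x = x $ j * D j f x + f x
     + 2 * (\<Sum>v\<in>Rp. \<kappa> v * f (reflection v x) * ((v $ j)\<^sup>2 / (norm v)\<^sup>2))"
proof -
  have "D j (\<lambda>x. x $ j * f x) x = (f x + x $ j * partial j f x)
      + (\<Sum>v\<in>Rp. \<kappa> v * (x $ j * dunkl_quotient f v x + 2 * v $ j / (norm v)\<^sup>2 * f (reflection v x)) * v $ j)"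
  proof (rule dunkl_operator_eqI)
    show "((\<lambda>t. (x + t *\<^sub>R axis j 1) $ j * f (x + t *\<^sub>R axis j 1)) has_real_derivative
      f x + x $ j * partial j f x) (at 0)" for x
      using DERIV_mult[OF has_partial_coord[of x j j] C_class_SucD(3)[OF f, of x j]] by (simp add: mult_ac)
    fix v assume v: "v \<in> Rp"
    show "continuous_on UNIV (\<lambda>x. x $ j * dunkl_quotient f v x + 2 * v $ j / (norm v)\<^sup>2 * f (reflection v x))"
      by (intro continuous_intros continuous_on_compose2[OF C_class_cont[OF f] continuous_on_reflection]
            C_class_cont[OF C_class_dunkl_quotient(1)[OF f Rp_nonzero[OF v]]]) (use Rp_nonzero[OF v] in auto)
    fix x
    have "x $ j * (dunkl_quotient f v x * (x \<bullet> v)) = x $ j * (f x - f (reflection v x))"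
      by (simp add: C_class_dunkl_quotient(2)[OF f Rp_nonzero[OF v], of x])
    then show "(x $ j * dunkl_quotient f v x + 2 * v $ j / (norm v)\<^sup>2 * f (reflection v x)) * (x \<bullet> v)
        = x $ j * f x - reflection v x $ j * f (reflection v x)"
      unfolding reflection_nth by (simp add: algebra_simps)
  qed
  also have "(\<Sum>v\<in>Rp. \<kappa> v * (x $ j * dunkl_quotient f v x + 2 * v $ j / (norm v)\<^sup>2 * f (reflection v x)) * v $ j)
    = x $ j * (\<Sum>v\<in>Rp. \<kappa> v * dunkl_quotient f v x * v $ j)
     + 2 * (\<Sum>v\<in>Rp. \<kappa> v * f (reflection v x) * ((v $ j)\<^sup>2 / (norm v)\<^sup>2))"
    unfolding sum_distrib_left sum.distrib[symmetric]
    by (intro sum.cong) (auto simp: power2_eq_square algebra_simps)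
  finally show ?thesis by (simp add: dunkl_operator_def algebra_simps)
qed

lemma sum_x_D:
  assumes f: "C_class (Suc 0) f"
  shows "(\<Sum>j\<in>UNIV. x $ j * D j f x) = euler f x + (\<Sum>v\<in>Rp. \<kappa> v * (f x - f (reflection v x)))"
proof -
  have "(\<Sum>j\<in>UNIV. x $ j * D j f x) = euler f x
     + (\<Sum>j\<in>UNIV. \<Sum>v\<in>Rp. \<kappa> v * dunkl_quotient f v x * (x $ j * v $ j))"
    by (simp add: dunkl_operator_def euler_def sum.distrib distrib_left sum_distrib_left mult_ac)
  also have "(\<Sum>j\<in>UNIV. \<Sum>v\<in>Rp. \<kappa> v * dunkl_quotient f v x * (x $ j * v $ j))
    = (\<Sum>v\<in>Rp. \<kappa> v * (dunkl_quotient f v x * (x \<bullet> v)))"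
    by (subst sum.swap) (simp add: inner_vec_def sum_distrib_left mult_ac)
  also have "\<dots> = (\<Sum>v\<in>Rp. \<kappa> v * (f x - f (reflection v x)))"
    by (intro sum.cong) (auto simp: C_class_dunkl_quotient(2)[OF f Rp_nonzero])
  finally show ?thesis .
qed

text \<open>The reflection terms of \<open>\<Sum> x\<^sub>j D\<^sub>j f\<close> and \<open>\<Sum> D\<^sub>j (x\<^sub>j f)\<close> cancel in the sum. What remains is the
Euclidean expression with the dimension raised from \<open>n\<close> to \<open>n + 2\<gamma>\<close>.\<close>

lemma sum_D_x:
  assumes f: "C_class (Suc 0) f"
  shows "(\<Sum>j\<in>UNIV. x $ j * D j f x + D j (\<lambda>x. x $ j * f x) x)
     = 2 * euler f x + (real CARD('n) + 2 * \<gamma>) * f x"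
proof -
  have "(\<Sum>j\<in>UNIV. \<Sum>v\<in>Rp. \<kappa> v * f (reflection v x) * ((v $ j)\<^sup>2 / (norm v)\<^sup>2))
     = (\<Sum>v\<in>Rp. \<kappa> v * f (reflection v x) * (\<Sum>j\<in>UNIV. (v $ j)\<^sup>2 / (norm v)\<^sup>2))"
    by (subst sum.swap) (simp add: sum_distrib_left)
  also have "\<dots> = (\<Sum>v\<in>Rp. \<kappa> v * f (reflection v x))"
  proof (intro sum.cong refl)
    fix v assume "v \<in> Rp"
    have "(\<Sum>j\<in>UNIV. (v $ j)\<^sup>2 / (norm v)\<^sup>2) = (v \<bullet> v) / (norm v)\<^sup>2"
      unfolding sum_divide_distrib[symmetric] by (simp add: inner_vec_def power2_eq_square)
    also have "\<dots> = 1" using Rp_nonzero[OF \<open>v \<in> Rp\<close>] by (simp add: power2_norm_eq_inner)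
    finally show "\<kappa> v * f (reflection v x) * (\<Sum>j\<in>UNIV. (v $ j)\<^sup>2 / (norm v)\<^sup>2) = \<kappa> v * f (reflection v x)" by simp
  qed
  finally have e: "(\<Sum>j\<in>UNIV. \<Sum>v\<in>Rp. \<kappa> v * f (reflection v x) * ((v $ j)\<^sup>2 / (norm v)\<^sup>2)) = (\<Sum>v\<in>Rp. \<kappa> v * f (reflection v x))" .
  have "(\<Sum>j\<in>UNIV. x $ j * D j f x + D j (\<lambda>x. x $ j * f x) x)
     = (\<Sum>j\<in>UNIV. 2 * (x $ j * D j f x) + f x + 2 * (\<Sum>v\<in>Rp. \<kappa> v * f (reflection v x) * ((v $ j)\<^sup>2 / (norm v)\<^sup>2)))"
    by (intro sum.cong) (auto simp: D_coord_mult[OF f])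
  also have "\<dots> = 2 * (\<Sum>j\<in>UNIV. x $ j * D j f x) + real CARD('n) * f x + 2 * (\<Sum>v\<in>Rp. \<kappa> v * f (reflection v x))"
    by (simp only: sum.distrib sum_distrib_left[symmetric] e) simp
  also have "\<dots> = 2 * euler f x + (real CARD('n) + 2 * \<gamma>) * f x"
  proof -
    have g: "(\<Sum>v\<in>Rp. \<kappa> v * f x) = \<gamma> * f x" by (simp add: \<gamma>_def sum_distrib_right)
    have "(\<Sum>v\<in>Rp. \<kappa> v * (f x - f (reflection v x))) = \<gamma> * f x - (\<Sum>v\<in>Rp. \<kappa> v * f (reflection v x))"
      by (simp add: right_diff_distrib sum_subtractf g)
    then show ?thesis unfolding sum_x_D[OF f] by (simp add: algebra_simps)
  qed
  finally show ?thesis .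
qed

text \<open>Apply the product rules twice and sum over the coordinates. The terms with \<open>\<psi>'\<close> then combine
as in \<open>sum_D_x\<close>.\<close>

lemma L_radial_mult:
  assumes f: "C_class (Suc (Suc 0)) f"
    and \<psi>: "\<And>u. (\<psi> has_real_derivative \<psi>' u) (at u)" "\<And>u. (\<psi>' has_real_derivative \<psi>'' u) (at u)"
      "continuous_on UNIV \<psi>''"
  shows "L (\<lambda>x. \<psi> (x \<bullet> x) * f x) x = \<psi> (x \<bullet> x) * L f x
     + \<psi>' (x \<bullet> x) * (4 * euler f x + 2 * (real CARD('n) + 2 * \<gamma>) * f x) + 4 * (x \<bullet> x) * \<psi>'' (x \<bullet> x) * f x"
proof -
  have f1: "C_class (Suc 0) f" using f by (rule C_class_less)
  have Df: "C_class (Suc 0) (D j f)" for j by (rule C_class_dunkl_operator[OF f zero_notin_Rp])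
  have xf: "C_class (Suc 0) (\<lambda>x. x $ j * f x)" for j by (intro C_class_mult C_class_coord f1)
  have c': "continuous_on UNIV \<psi>'" using \<psi>(2) by (rule has_real_derivative_continuous_on)
  have r: "C_class (Suc 0) (\<lambda>x. \<psi> (x \<bullet> x))" "C_class (Suc 0) (\<lambda>x. \<psi>' (x \<bullet> x))"
    by (rule C_class_1_radial[OF \<psi>(1) c'], rule C_class_1_radial[OF \<psi>(2,3)])
  have "D j (D j (\<lambda>x. \<psi> (x \<bullet> x) * f x)) x
     = \<psi> (x \<bullet> x) * D j (D j f) x + 2 * \<psi>' (x \<bullet> x) * (x $ j * D j f x + D j (\<lambda>x. x $ j * f x) x)
       + 4 * \<psi>'' (x \<bullet> x) * f x * (x $ j * x $ j)" for j
  proof -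
    have "D j (\<lambda>x. \<psi> (x \<bullet> x) * f x) = (\<lambda>x. \<psi> (x \<bullet> x) * D j f x + 2 * (\<psi>' (x \<bullet> x) * (x $ j * f x)))"
      by (rule ext) (rule D_radial_mult[OF f1 \<psi>(1)])
    then have "D j (D j (\<lambda>x. \<psi> (x \<bullet> x) * f x)) x =
        D j (\<lambda>x. \<psi> (x \<bullet> x) * D j f x) x + 2 * D j (\<lambda>x. \<psi>' (x \<bullet> x) * (x $ j * f x)) x"
      by (simp only:) (subst D_add, (intro C_class_cmult C_class_mult r Df xf f1 C_class_coord)+,
            subst D_cmult, (intro C_class_mult r xf f1 C_class_coord)+, rule refl)
    then show ?thesis unfolding D_radial_mult[OF Df \<psi>(1)] D_radial_mult[OF xf \<psi>(2)]
      by (simp add: algebra_simps)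
  qed
  then have "L (\<lambda>x. \<psi> (x \<bullet> x) * f x) x = (\<Sum>j\<in>UNIV. \<psi> (x \<bullet> x) * D j (D j f) x
        + 2 * \<psi>' (x \<bullet> x) * (x $ j * D j f x + D j (\<lambda>x. x $ j * f x) x)
       + 4 * \<psi>'' (x \<bullet> x) * f x * (x $ j * x $ j))"
    by (simp add: dunkl_laplacian_def)
  also have "\<dots> = \<psi> (x \<bullet> x) * L f x + 2 * \<psi>' (x \<bullet> x) * (2 * euler f x + (real CARD('n) + 2 * \<gamma>) * f x)
       + 4 * \<psi>'' (x \<bullet> x) * f x * (x \<bullet> x)"
    unfolding sum.distrib sum_distrib_left[symmetric]
    by (simp only: dunkl_laplacian_def sum_D_x[OF f1, unfolded sum.distrib] inner_vec_def inner_real_def sum.distrib)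
  finally show ?thesis by (simp add: algebra_simps)
qed

lemma L_add:
  assumes f: "C_class (Suc (Suc 0)) f" and g: "C_class (Suc (Suc 0)) g"
  shows "L (\<lambda>x. f x + g x) x = L f x + L g x"
proof -
  have "D j (\<lambda>x. f x + g x) = (\<lambda>x. D j f x + D j g x)" for j
    by (rule ext) (intro D_add C_class_less[OF f] C_class_less[OF g])
  moreover have "D j (\<lambda>x. D j f x + D j g x) x = D j (D j f) x + D j (D j g) x" for j
    by (intro D_add C_class_dunkl_operator[OF f zero_notin_Rp] C_class_dunkl_operator[OF g zero_notin_Rp])
  ultimately show ?thesis unfolding dunkl_laplacian_def by (simp add: sum.distrib)
qed

lemma L_cmult:
  assumes f: "C_class (Suc (Suc 0)) f"
  shows "L (\<lambda>x. c * f x) x = c * L f x"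
proof -
  have "D j (\<lambda>x. c * f x) = (\<lambda>x. c * D j f x)" for j
    by (rule ext) (intro D_cmult C_class_less[OF f])
  moreover have "D j (\<lambda>x. c * D j f x) x = c * D j (D j f) x" for j
    by (intro D_cmult C_class_dunkl_operator[OF f zero_notin_Rp])
  ultimately show ?thesis unfolding dunkl_laplacian_def by (simp add: sum_distrib_left)
qed

lemma L_diff:
  assumes f: "C_class (Suc (Suc 0)) f" and g: "C_class (Suc (Suc 0)) g"
  shows "L (\<lambda>x. f x - g x) x = L f x - L g x"
  using L_add[OF f C_class_cmult[OF g, of "-1"], of x] L_cmult[OF g, of "-1" x] by simp

lemma L_const: "L (\<lambda>x. c) x = 0"
proof -
  have "D j (\<lambda>x. 0) y = 0" for j y using D_cmult[of "\<lambda>x. 0" j 0 y] by simp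
  moreover have "D j (\<lambda>x. c) y = 0" for j y
    using dunkl_operator_eqI[of "\<lambda>x. c" j "\<lambda>x. 0" "\<lambda>v x. 0" y] by simp
  then have "D j (\<lambda>x. c) = (\<lambda>x. 0)" for j by blast
  ultimately show ?thesis by (simp add: dunkl_laplacian_def)
qed

lemma L_sum:
  assumes "\<And>i. i \<in> I \<Longrightarrow> C_class (Suc (Suc 0)) (f i)"
  shows "L (\<lambda>x. \<Sum>i\<in>I. f i x) x = (\<Sum>i\<in>I. L (f i) x)"
  using assms
proof (induction I rule: infinite_finite_induct)
  case (insert i I)
  then show ?case by (simp add: L_add C_class_sum del: C_class.simps)
qed (simp_all add: L_const)

lemma hpoly_D:
  assumes "hpoly k q"
  shows "hpoly (k - 1) (D j q)" "k = 0 \<Longrightarrow> D j q = (\<lambda>x. 0)"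
proof -
  have eq: "D j q = (\<lambda>x. partial j q x + (\<Sum>v\<in>Rp. (\<kappa> v * v $ j) * dunkl_quotient q v x))"
    by (rule ext) (simp add: dunkl_operator_def mult_ac)
  show "hpoly (k - 1) (D j q)" unfolding eq
    by (intro hpoly_add hpoly_sum hpoly_cmult hpoly_partial hpoly_dunkl_quotient assms Rp_nonzero)
  show "D j q = (\<lambda>x. 0)" if "k = 0" unfolding eq
    by (simp add: hpoly_partial(2)[OF assms that] hpoly_dunkl_quotient(2)[OF assms Rp_nonzero that])
qed

lemma hpoly_L:
  assumes "hpoly k q"
  shows "hpoly (k - 2) (L q)" "k < 2 \<Longrightarrow> L q x = 0"
proof -
  show "hpoly (k - 2) (L q)"
    using hpoly_sum[of UNIV "k - 2" "\<lambda>j. D j (D j q)"] hpoly_D(1)[OF hpoly_D(1)[OF assms]]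
    unfolding dunkl_laplacian_def[abs_def] by (simp add: numeral_2_eq_2)
  assume "k < 2"
  then have "k - 1 = 0" by simp
  then have "D j (D j q) = (\<lambda>x. 0)" for j using hpoly_D(2)[OF hpoly_D(1)[OF assms]] by blast
  then show "L q x = 0" by (simp add: dunkl_laplacian_def)
qed

section \<open>Harmonics and the Fischer decomposition\<close>

definition harmonic :: "nat \<Rightarrow> (real^'n \<Rightarrow> real) \<Rightarrow> bool" where
  "harmonic m H \<longleftrightarrow> hpoly m H \<and> (\<forall>x. L H x = 0)"

text \<open>The radial part of \<open>L\<close> on \<open>\<psi>(\<bar>x\<bar>\<^sup>2) H\<close> is that of the Euclidean Laplacian on radial functions in
dimension \<open>M m\<close>, where \<open>m\<close> is the degree of \<open>H\<close>.\<close>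

definition "M m = 2 * real m + real CARD('n) + 2 * \<gamma>"

lemma M_pos: "M m > 0"
  using gamma_nonneg by (simp add: M_def add_nonneg_pos add_pos_nonneg)

lemma L_radial_harmonic:
  assumes H: "harmonic m H" and \<psi>: "\<And>u. (\<psi> has_real_derivative \<psi>' u) (at u)" "\<And>u. (\<psi>' has_real_derivative \<psi>'' u) (at u)"
      "continuous_on UNIV \<psi>''"
  shows "L (\<lambda>x. \<psi> (x \<bullet> x) * H x) x = (4 * (x \<bullet> x) * \<psi>'' (x \<bullet> x) + 2 * M m * \<psi>' (x \<bullet> x)) * H x"
proof -
  have h: "hpoly m H" using H by (simp add: harmonic_def)
  have "euler H x = m * H x" unfolding euler_def by (rule hpoly_euler[OF h])
  moreover have "L H x = 0" using H by (simp add: harmonic_def)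
  ultimately show ?thesis
    using L_radial_mult[OF hpoly_C_class[OF h] \<psi>, of x] by (simp add: M_def algebra_simps)
qed

lemma L_power_harmonic:
  assumes H: "harmonic m H"
  shows "L (\<lambda>x. (x \<bullet> x) ^ Suc i * H x) x = 2 * real (Suc i) * (2 * real i + M m) * ((x \<bullet> x) ^ i * H x)"
proof -
  have e: "(x \<bullet> x) * (real i * (x \<bullet> x) ^ (i - 1)) = real i * (x \<bullet> x) ^ i"
    by (cases i) auto
  have "L (\<lambda>x. (x \<bullet> x) ^ Suc i * H x) x
    = (4 * (x \<bullet> x) * (real (Suc i) * (real i * (x \<bullet> x) ^ (i - 1))) + 2 * M m * (real (Suc i) * (x \<bullet> x) ^ i)) * H x"
    by (rule L_radial_harmonic[OF H])
      (auto intro!: derivative_eq_intros continuous_intros simp del: power_Suc, (cases i, auto)?)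
  also have "4 * (x \<bullet> x) * (real (Suc i) * (real i * (x \<bullet> x) ^ (i - 1))) = 4 * real (Suc i) * (real i * (x \<bullet> x) ^ i)"
    unfolding e[symmetric] by simp
  finally show ?thesis by (simp add: algebra_simps)
qed

text \<open>Decompose \<open>L q\<close> by induction and solve \<open>L u = L q\<close> by raising the power of \<open>\<bar>x\<bar>\<^sup>2\<close> in each term. This
is possible because \<open>L\<close> returns the term with a positive factor. Then \<open>q - u\<close> is a harmonic.\<close>

lemma fischer_decomposition:
  "hpoly k q \<Longrightarrow> \<exists>H. (\<forall>i\<le>k div 2. harmonic (k - 2 * i) (H i)) \<and> (\<forall>x. q x = (\<Sum>i\<le>k div 2. (x \<bullet> x) ^ i * H i x))"
proof (induction k arbitrary: q rule: less_induct)
  case (less k)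
  show ?case
  proof (cases "k < 2")
    case True
    then show ?thesis using less.prems hpoly_L(2)[OF less.prems True]
      by (intro exI[of _ "\<lambda>i. q"]) (auto simp: harmonic_def)
  next
    case False
    define l where "l = k - 2"
    have k: "k = Suc (Suc l)" using False by (simp add: l_def)
    have Lq: "hpoly l (L q)" using hpoly_L(1)[OF less.prems] k by simp
    obtain H where H: "\<And>i. i \<le> l div 2 \<Longrightarrow> harmonic (l - 2 * i) (H i)"
      "\<And>x. L q x = (\<Sum>i\<le>l div 2. (x \<bullet> x) ^ i * H i x)"
      using less.IH[OF _ Lq] k by auto
    have hH: "hpoly (l - 2 * i) (H i)" if "i \<le> l div 2" for i using H(1)[OF that] by (simp add: harmonic_def)
    \<comment> \<open>The reciprocals of the factors with which \<open>L\<close> lowers the power of \<open>\<bar>x\<bar>\<^sup>2\<close>.\<close>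
    define c where "c i = 1 / (2 * real (Suc i) * (2 * real i + M (l - 2 * i)))" for i
    define u where "u x = (\<Sum>i\<le>l div 2. c i * ((x \<bullet> x) ^ Suc i * H i x))" for x
    have t: "hpoly k (\<lambda>x. (x \<bullet> x) ^ Suc i * H i x)" if "i \<le> l div 2" for i
    proof -
      have "2 * Suc i + (l - 2 * i) = k" using that k by simp
      then show ?thesis using hpoly_mult[OF hpoly_radial[of "Suc i"] hH[OF that]] by simp
    qed
    have u: "hpoly k u" unfolding u_def[abs_def] by (intro hpoly_sum hpoly_cmult t) auto
    have Lu: "L u x = L q x" for x
    proof -
      have "L u x = (\<Sum>i\<le>l div 2. L (\<lambda>x. c i * ((x \<bullet> x) ^ Suc i * H i x)) x)"
        unfolding u_def[abs_def] by (rule L_sum) (auto intro!: C_class_cmult hpoly_C_class[OF t] simp del: C_class.simps power_Suc)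
      also have "\<dots> = (\<Sum>i\<le>l div 2. (x \<bullet> x) ^ i * H i x)"
      proof (intro sum.cong refl)
        fix i assume "i \<in> {..l div 2}"
        then have i: "i \<le> l div 2" by simp
        have "L (\<lambda>x. c i * ((x \<bullet> x) ^ Suc i * H i x)) x = c i * (2 * real (Suc i) * (2 * real i + M (l - 2 * i)) * ((x \<bullet> x) ^ i * H i x))"
          by (subst L_cmult[OF hpoly_C_class[OF t[OF i]]], subst L_power_harmonic[OF H(1)[OF i]]) simp
        also have "\<dots> = (c i * (2 * real (Suc i) * (2 * real i + M (l - 2 * i)))) * ((x \<bullet> x) ^ i * H i x)"
          by (simp only: mult.assoc)
        also have "c i * (2 * real (Suc i) * (2 * real i + M (l - 2 * i))) = 1"
          using M_pos[of "l - 2 * i"] unfolding c_def by (simp add: add_nonneg_eq_0_iff)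
        finally show "L (\<lambda>x. c i * ((x \<bullet> x) ^ Suc i * H i x)) x = (x \<bullet> x) ^ i * H i x" by simp
      qed
      finally show ?thesis using H(2) by simp
    qed
    define H' where "H' i = (case i of 0 \<Rightarrow> (\<lambda>x. q x - u x) | Suc i \<Rightarrow> (\<lambda>x. c i * H i x))" for i
    have kd: "k div 2 = Suc (l div 2)" using k by simp
    show ?thesis
    proof (intro exI conjI allI impI)
      fix i assume "i \<le> k div 2"
      show "harmonic (k - 2 * i) (H' i)"
      proof (cases i)
        case 0
        then show ?thesis using hpoly_diff[OF less.prems u] L_diff[OF hpoly_C_class[OF less.prems] hpoly_C_class[OF u]] Lu
          by (simp add: H'_def harmonic_def)
      next
        case (Suc i')
        then have i': "i' \<le> l div 2" using \<open>i \<le> k div 2\<close> kd by simp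
        show ?thesis using Suc k hpoly_cmult[OF hH[OF i'], of "c i'"] L_cmult[OF hpoly_C_class[OF hH[OF i']], of "c i'"] H(1)[OF i']
          by (simp add: H'_def harmonic_def)
      qed
    next
      show "q x = (\<Sum>i\<le>k div 2. (x \<bullet> x) ^ i * H' i x)" for x
        unfolding kd sum.atMost_Suc_shift by (simp add: H'_def u_def mult_ac)
    qed
  qed
qed

end

section \<open>Integrals of derivatives and of reflected functions\<close>

lemma integrable_compact_support:
  fixes h :: "real^'n \<Rightarrow> real"
  assumes h: "continuous_on UNIV h" and T: "\<And>x. norm x > T \<Longrightarrow> h x = 0"
  shows "integrable lborel h"
proof -
  have "integrable lborel (\<lambda>x. indicator (cball 0 T) x *\<^sub>R h x)"
    by (rule borel_integrable_compact) (use h continuous_on_subset in auto)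
  moreover have "(\<lambda>x. indicator (cball 0 T) x *\<^sub>R h x) = h"
    using T by (auto simp: indicator_def fun_eq_iff not_le)
  ultimately show ?thesis by simp
qed

lemma continuous_bounded_on_cball:
  fixes h :: "real^'n \<Rightarrow> real"
  assumes h: "continuous_on UNIV h"
  obtains B where "B \<ge> 0" "\<And>x. norm x \<le> T \<Longrightarrow> \<bar>h x\<bar> \<le> B"
proof -
  have "bounded (h ` cball 0 T)"
    by (intro compact_imp_bounded compact_continuous_image continuous_on_subset[OF h]) auto
  then obtain B where B: "\<forall>y\<in>h ` cball 0 T. norm y \<le> B" unfolding bounded_iff by blast
  have "\<bar>h x\<bar> \<le> \<bar>B\<bar>" if "norm x \<le> T" for x
    using B[rule_format, of "h x"] that by auto
  then show ?thesis using that[of "\<bar>B\<bar>"] by simp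
qed

lemma bounded_compact_support:
  fixes h :: "real^'n \<Rightarrow> real"
  assumes h: "continuous_on UNIV h" and T: "\<And>x. norm x > T \<Longrightarrow> h x = 0"
  obtains B where "B \<ge> 0" "\<And>x. \<bar>h x\<bar> \<le> B"
proof -
  obtain B where B: "B \<ge> 0" "\<And>x. norm x \<le> T \<Longrightarrow> \<bar>h x\<bar> \<le> B"
    using continuous_bounded_on_cball[OF h] by blast
  then have "\<bar>h x\<bar> \<le> B" for x using T[of x] by (cases "norm x \<le> T") auto
  then show ?thesis using that B by blast
qed

lemma integral_translate:
  fixes g :: "real^'n \<Rightarrow> real"
  assumes "g \<in> borel_measurable borel"
  shows "(\<integral>x. g (x + c) \<partial>lborel) = (\<integral>x. g x \<partial>lborel)"
proof -
  have "(\<integral>x. g x \<partial>lborel) = (\<integral>x. g x \<partial>distr lborel borel ((+) c))" by (simp add: lborel_distr_plus)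
  also have "\<dots> = (\<integral>x. g (c + x) \<partial>lborel)" using assms by (subst integral_distr) auto
  finally show ?thesis by (simp add: add.commute)
qed

text \<open>The integral does not change under translation. So the difference quotients have integral zero,
and the derivative is their dominated limit.\<close>

lemma integral_line_derivative_zero:
  fixes G :: "real^'n \<Rightarrow> real"
  assumes G: "continuous_on UNIV G" and G': "continuous_on UNIV G'"
    and der: "\<And>x. ((\<lambda>t::real. G (x + t *\<^sub>R axis j 1)) has_real_derivative G' x) (at 0)"
    and T: "\<And>x. norm x > T \<Longrightarrow> G x = 0"
  shows "(\<integral>x. G' x \<partial>lborel) = 0"
proof -
  have hp: "has_partial j G x" and pG: "partial j G x = G' x" for x using partialI[OF der] by auto
  have line: "((\<lambda>t::real. G (x + t *\<^sub>R axis j 1)) has_real_derivative G' (x + s *\<^sub>R axis j 1)) (at s)" for x s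
    using partial_along_line[OF hp] by (simp add: pG)
  have T': "G' x = 0" if "norm x > T" for x
  proof -
    have "open {x::real^'n. T < norm x}" by (intro open_Collect_less continuous_intros)
    then have "open ((\<lambda>t::real. x + t *\<^sub>R axis j 1) -` {x::real^'n. T < norm x})"
      by (intro continuous_open_vimage) (auto intro!: continuous_intros)
    from has_field_derivative_transform_within_open[OF der this, where g="\<lambda>_. 0"]
    have "((\<lambda>t::real. 0) has_real_derivative G' x) (at (0::real))" using that T by simp
    then show ?thesis using DERIV_unique DERIV_const by blast
  qed
  obtain B where B: "B \<ge> 0" "\<And>x. \<bar>G' x\<bar> \<le> B" using bounded_compact_support[OF G' T'] by blast
  define h where "h k = inverse (real (Suc k))" for k
  have h: "0 < h k" "h k \<le> 1" for k by (auto simp: h_def field_simps)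
  have h0: "h \<longlonglongrightarrow> 0" unfolding h_def by (rule LIMSEQ_inverse_real_of_nat)
  define q where "q k x = (G (x + h k *\<^sub>R axis j 1) - G x) / h k" for k x
  have iG: "integrable lborel G" by (rule integrable_compact_support[OF G T])
  have mG [measurable]: "G \<in> borel_measurable borel" by (rule borel_measurable_continuous_onI[OF G])
  have mG' [measurable]: "G' \<in> borel_measurable borel" by (rule borel_measurable_continuous_onI[OF G'])
  have iGt: "integrable lborel (\<lambda>x. G (x + c))" for c
  proof (rule integrable_compact_support)
    show "continuous_on UNIV (\<lambda>x. G (x + c))" by (intro continuous_on_compose2[OF G] continuous_intros) auto
    show "G (x + c) = 0" if "norm x > T + norm c" for x
      using that norm_diff_ineq[of x c] by (intro T) linarith
  qed
  have q0: "(\<integral>x. q k x \<partial>lborel) = 0" for k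
    unfolding q_def using iG iGt by (simp add: integral_translate)
  have lim: "(\<lambda>k. \<integral>x. q k x \<partial>lborel) \<longlonglongrightarrow> (\<integral>x. G' x \<partial>lborel)"
  proof (rule integral_dominated_convergence[where w="\<lambda>x. indicator (cball 0 (T + 1)) x * B"])
    show "integrable lborel (\<lambda>x. indicator (cball (0::real^'n) (T + 1)) x * B)"
      using borel_integrable_compact[of "cball (0::real^'n) (T + 1)" "\<lambda>_. B"] by simp
    show "AE x in lborel. (\<lambda>k. q k x) \<longlonglongrightarrow> G' x"
    proof (rule AE_I2)
      fix x
      have "((\<lambda>t. (G (x + t *\<^sub>R axis j 1) - G x) / t) \<longlongrightarrow> G' x) (at 0)"
        using der[of x] by (simp add: DERIV_def)
      moreover have "filterlim h (at 0) sequentially"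
        using h0 h(1) by (auto simp: filterlim_at intro!: always_eventually simp: less_imp_neq[symmetric])
      ultimately show "(\<lambda>k. q k x) \<longlonglongrightarrow> G' x"
        unfolding q_def by (rule filterlim_compose)
    qed
    show "AE x in lborel. norm (q k x) \<le> indicator (cball 0 (T + 1)) x * B" for k
    proof (rule AE_I2)
      fix x
      show "norm (q k x) \<le> indicator (cball 0 (T + 1)) x * B"
      proof (cases "norm x \<le> T + 1")
        case True
        have "norm (G (x + h k *\<^sub>R axis j 1) - G (x + 0 *\<^sub>R axis j 1)) \<le> B * norm (h k - 0)"
          by (rule field_differentiable_bound[of "{0..h k}" _ "\<lambda>s. G' (x + s *\<^sub>R axis j 1)"])
            (use line B h in \<open>auto intro: has_field_derivative_at_within less_imp_le\<close>)
        then show ?thesis using True h[of k] by (simp add: q_def abs_divide field_simps)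
      next
        case False
        have "norm (h k *\<^sub>R axis j (1::real)) \<le> 1" using h[of k] by (simp add: norm_axis_1)
        then have "norm (x + h k *\<^sub>R axis j 1) > T"
          using False norm_diff_ineq[of x "h k *\<^sub>R axis j 1"] by linarith
        then show ?thesis using False T[of x] T[of "x + h k *\<^sub>R axis j 1"] by (simp add: q_def)
      qed
    qed
  qed (auto simp: q_def)
  then show ?thesis unfolding q0 using LIMSEQ_unique tendsto_const by blast
qed

lemma nn_integral_translate:
  fixes g :: "real^'n \<Rightarrow> ennreal"
  assumes "g \<in> borel_measurable borel"
  shows "(\<integral>\<^sup>+x. g (x + c) \<partial>lborel) = (\<integral>\<^sup>+x. g x \<partial>lborel)"
proof -
  have "(\<integral>\<^sup>+x. g x \<partial>lborel) = (\<integral>\<^sup>+x. g x \<partial>distr lborel borel ((+) c))" by (simp add: lborel_distr_plus)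
  also have "\<dots> = (\<integral>\<^sup>+x. g (c + x) \<partial>lborel)" using assms by (subst nn_integral_distr) auto
  finally show ?thesis by (simp add: add.commute)
qed

text \<open>This is the uniqueness argument for translation-invariant measures, with the unit ball as the
reference set: the reflected measure is translation invariant because the reflection is linear,
and it gives the ball the same mass because the reflection preserves the norm.\<close>

lemma distr_lborel_reflection: "distr lborel borel (reflection v) = (lborel :: (real^'n) measure)"
proof (rule measure_eqI)
  have m [measurable]: "reflection v \<in> borel \<rightarrow>\<^sub>M borel"
    by (intro borel_measurable_continuous_onI continuous_on_reflection)
  fix A :: "(real^'n) set" assume "A \<in> sets (distr lborel borel (reflection v))"
  then have A [measurable]: "A \<in> sets borel" by simp
  define g :: "real^'n \<Rightarrow> ennreal" where "g = indicator A"
  define h :: "real^'n \<Rightarrow> ennreal" where "h = indicator (ball 0 1)"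
  have [measurable]: "g \<in> borel_measurable borel" "h \<in> borel_measurable borel" unfolding g_def h_def by (rule borel_measurable_indicator, simp)+
  have lin: "reflection v (x + reflection v y) = reflection v x + y" for x y :: "real^'n"
    by (simp add: linear_add[OF linear_reflection] reflection_reflection)
  \<comment> \<open>The double integral of \<open>g (\<sigma> x) h (y - \<sigma> x)\<close> is evaluated in both orders; \<open>h\<close> is invariant under \<open>\<sigma>\<close>.\<close>
  have tr: "(\<integral>\<^sup>+x. g (reflection v (x + c)) * h (y + (- reflection v (x + c))) \<partial>lborel)
     = (\<integral>\<^sup>+x. g (reflection v x) * h (y + (- reflection v x)) \<partial>lborel)" for y c
    by (rule nn_integral_translate[of "\<lambda>x. g (reflection v x) * h (y + (- reflection v x))"]) measurable
  have hr: "h (- reflection v x) = h x" for x :: "real^'n" by (simp add: h_def indicator_def norm_reflection)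
  have "(\<integral>\<^sup>+x. g (reflection v x) \<partial>lborel) * (\<integral>\<^sup>+y. h y \<partial>lborel)
      = (\<integral>\<^sup>+x. \<integral>\<^sup>+y. g (reflection v x) * h y \<partial>lborel \<partial>lborel)"
    by (simp add: nn_integral_cmult nn_integral_multc)
  also have "\<dots> = (\<integral>\<^sup>+x. \<integral>\<^sup>+y. g (reflection v x) * h (y + (- reflection v x)) \<partial>lborel \<partial>lborel)"
    by (simp add: nn_integral_cmult nn_integral_translate[of h] del: add_uminus_conv_diff)
  also have "\<dots> = (\<integral>\<^sup>+y. \<integral>\<^sup>+x. g (reflection v x) * h (y + (- reflection v x)) \<partial>lborel \<partial>lborel)"
    by (rule lborel_pair.Fubini'[symmetric]) measurable
  also have "\<dots> = (\<integral>\<^sup>+y. \<integral>\<^sup>+x. g (reflection v (x + reflection v y)) * h (y + (- reflection v (x + reflection v y))) \<partial>lborel \<partial>lborel)"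
    by (intro nn_integral_cong tr[symmetric])
  also have "\<dots> = (\<integral>\<^sup>+y. \<integral>\<^sup>+x. g (y + reflection v x) * h x \<partial>lborel \<partial>lborel)"
    by (simp add: lin hr add.commute del: add_uminus_conv_diff) (simp add: hr)?
  also have "\<dots> = (\<integral>\<^sup>+x. \<integral>\<^sup>+y. g (y + reflection v x) * h x \<partial>lborel \<partial>lborel)"
    by (rule lborel_pair.Fubini') measurable
  also have "\<dots> = (\<integral>\<^sup>+x. \<integral>\<^sup>+y. g y * h x \<partial>lborel \<partial>lborel)"
    by (simp add: nn_integral_multc nn_integral_translate[of g])
  also have "\<dots> = (\<integral>\<^sup>+y. g y \<partial>lborel) * (\<integral>\<^sup>+x. h x \<partial>lborel)"
    by (simp add: nn_integral_cmult nn_integral_multc)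
  finally have eq: "(\<integral>\<^sup>+x. g (reflection v x) \<partial>lborel) * (\<integral>\<^sup>+y. h y \<partial>lborel)
     = (\<integral>\<^sup>+y. g y \<partial>lborel) * (\<integral>\<^sup>+y. h y \<partial>lborel)" .
  have h: "(\<integral>\<^sup>+y. h y \<partial>lborel) = emeasure lborel (ball (0::real^'n) 1)" by (simp add: h_def)
  have "emeasure lborel (ball (0::real^'n) 1) \<noteq> 0"
    using content_ball_pos[of 1 "0::real^'n"] by (simp add: measure_def) (metis enn2real_0 less_irrefl)
  moreover have "emeasure lborel (ball (0::real^'n) 1) \<noteq> \<infinity>"
    using emeasure_lborel_ball_finite[of "0::real^'n" 1] by (simp add: less_top)
  ultimately have cancel: "a * emeasure lborel (ball (0::real^'n) 1) / emeasure lborel (ball (0::real^'n) 1) = a" for a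
    using mult_divide_eq_ennreal by simp
  have "(\<integral>\<^sup>+x. g (reflection v x) \<partial>lborel) = (\<integral>\<^sup>+y. g y \<partial>lborel)"
    using arg_cong[OF eq, of "\<lambda>a. a / emeasure lborel (ball (0::real^'n) 1)"] unfolding h cancel .
  moreover have "emeasure (distr lborel borel (reflection v)) A = (\<integral>\<^sup>+x. g x \<partial>distr lborel borel (reflection v))"
    by (simp add: g_def)
  moreover have "\<dots> = (\<integral>\<^sup>+x. g (reflection v x) \<partial>lborel)" by (rule nn_integral_distr) measurable
  ultimately show "emeasure (distr lborel borel (reflection v)) A = emeasure lborel A"
    by (simp add: g_def)
qed simp

lemma integral_reflection:
  fixes g :: "real^'n \<Rightarrow> real"
  assumes "g \<in> borel_measurable borel"
  shows "(\<integral>x. g (reflection v x) \<partial>lborel) = (\<integral>x. g x \<partial>lborel)"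
proof -
  have m [measurable]: "reflection v \<in> borel \<rightarrow>\<^sub>M borel"
    by (intro borel_measurable_continuous_onI continuous_on_reflection)
  have "(\<integral>x. g x \<partial>lborel) = (\<integral>x. g x \<partial>distr lborel borel (reflection v))" by (simp add: distr_lborel_reflection)
  also have "\<dots> = (\<integral>x. g (reflection v x) \<partial>lborel)" using assms by (subst integral_distr) auto
  finally show ?thesis by simp
qed

section \<open>Truncation of the weight\<close>

text \<open>For small exponents the weight is not differentiable on the mirrors. It is replaced by
\<open>s \<rho>\<^sup>2\<close>, where \<open>s\<close> is its value and \<open>\<rho> = max 0 (s - e) / s\<close> is this ratio. The truncated weight is
continuously differentiable in \<open>s\<close> and vanishes near \<open>s = 0\<close>. As a function of the weight it
keeps the invariance under the reflections.\<close>

definition trunc_ratio :: "real \<Rightarrow> real \<Rightarrow> real" where "trunc_ratio e s = max 0 (s - e) / s"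

lemma max_square_derivative: "((\<lambda>s::real. (max 0 s)\<^sup>2) has_real_derivative 2 * max 0 s) (at s)"
proof -
  consider "s < 0" | "s = 0" | "s > 0" by linarith
  then show ?thesis
  proof cases
    case 1
    then have "((\<lambda>s::real. 0) has_real_derivative 2 * max 0 s) (at s)" by simp
    from has_field_derivative_transform_within_open[OF this, of "{..<0}"] show ?thesis using 1 by simp
  next
    case 2
    have "((\<lambda>h::real. ((max 0 (0 + h))\<^sup>2 - (max 0 0)\<^sup>2) / h) \<longlongrightarrow> 0) (at 0)"
    proof (rule Lim_null_comparison)
      show "\<forall>\<^sub>F h::real in at 0. norm (((max 0 (0 + h))\<^sup>2 - (max 0 0)\<^sup>2) / h) \<le> \<bar>h\<bar>"
        by (rule always_eventually) (auto simp: max_def power2_eq_square)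
      show "((\<lambda>h::real. \<bar>h\<bar>) \<longlongrightarrow> 0) (at 0)" by (auto intro!: tendsto_eq_intros)
    qed
    then show ?thesis using 2 by (simp add: DERIV_def)
  next
    case 3
    then have "((\<lambda>s::real. s\<^sup>2) has_real_derivative 2 * max 0 s) (at s)" by (auto intro!: derivative_eq_intros)
    from has_field_derivative_transform_within_open[OF this, of "{0<..}"] show ?thesis using 3 by simp
  qed
qed

text \<open>The derivative lies between 0 and 1 and tends to 1 as \<open>e\<close> tends to 0, which allows dominated
convergence when the truncation is removed.\<close>

lemma trunc_derivative:
  assumes "s > 0"
  shows "((\<lambda>s. s * (trunc_ratio e s)\<^sup>2) has_real_derivative 1 - (1 - trunc_ratio e s)\<^sup>2) (at s)"
proof -
  have "((\<lambda>s. (max 0 (s - e))\<^sup>2) has_real_derivative 2 * max 0 (s - e)) (at s)"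
  proof -
    have d: "((\<lambda>s. s - e) has_real_derivative 1) (at s)" by (auto intro!: derivative_eq_intros)
    show ?thesis using DERIV_chain2[OF max_square_derivative d] by simp
  qed
  from DERIV_divide[OF this DERIV_ident] assms
  have "((\<lambda>s. (max 0 (s - e))\<^sup>2 / s) has_real_derivative 1 - (1 - trunc_ratio e s)\<^sup>2) (at s)"
    by (simp add: trunc_ratio_def power2_eq_square field_simps)
  from has_field_derivative_transform_within_open[OF this, of "{0<..}"] assms
  show ?thesis by (simp add: trunc_ratio_def power2_eq_square)
qed

lemma trunc_ratio_bounds: "e > 0 \<Longrightarrow> s \<ge> 0 \<Longrightarrow> 0 \<le> trunc_ratio e s \<and> trunc_ratio e s \<le> 1"
  by (auto simp: trunc_ratio_def max_def field_simps)

lemma trunc_ratio_zero: "s \<le> e \<Longrightarrow> trunc_ratio e s = 0" by (simp add: trunc_ratio_def)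

lemma trunc_ratio_tendsto: "s > 0 \<Longrightarrow> (\<lambda>k. trunc_ratio (inverse (real (Suc k))) s) \<longlonglongrightarrow> 1"
proof -
  assume s: "s > 0"
  have "(\<lambda>k. max 0 (s - inverse (real (Suc k))) / s) \<longlonglongrightarrow> max 0 (s - 0) / s"
    by (intro tendsto_intros LIMSEQ_inverse_real_of_nat) (use s in auto)
  then show ?thesis using s by (simp add: trunc_ratio_def)
qed

context dunkl begin

section \<open>The weight\<close>

definition "W x = (dunkl_weight Rp \<kappa> x)\<^sup>2"

lemma kappa_reflection: "v \<in> R \<Longrightarrow> w \<in> R \<Longrightarrow> \<kappa> (reflection v w) = \<kappa> w"
  using multiplicity unfolding multiplicity_function_def coxeter_group_def
  by (blast intro: generate.incl)

lemma kappa_minus: assumes "v \<in> R" shows "\<kappa> (- v) = \<kappa> v"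
proof -
  have "v \<noteq> 0" using assms root_system by (auto simp: root_system_def)
  then have "reflection v v = - v" by (simp add: reflection_def power2_norm_eq_inner scaleR_2)
  then show ?thesis using kappa_reflection[OF assms assms] by simp
qed

definition "weight_factor v s = (if \<kappa> v = 0 then 1 else (s\<^sup>2) powr \<kappa> v)"

lemma W_eq: "W x = (\<Prod>v\<in>Rp. weight_factor v (v \<bullet> x))"
  unfolding W_def dunkl_weight_def weight_factor_def prod_power_distrib
proof (intro prod.cong refl)
  fix v
  have "(\<bar>v \<bullet> x\<bar> powr \<kappa> v)\<^sup>2 = (v \<bullet> x)\<^sup>2 powr \<kappa> v"
    by (cases "v \<bullet> x = 0") (simp_all add: powr_power powr_powr power2_eq_square powr_mult[symmetric] flip: abs_mult)
  then show "(if \<kappa> v = 0 then 1 else \<bar>v \<bullet> x\<bar> powr \<kappa> v)\<^sup>2 = (if \<kappa> v = 0 then 1 else (v \<bullet> x)\<^sup>2 powr \<kappa> v)" by simp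
qed

lemma W_nonneg: "W x \<ge> 0" by (simp add: W_def)

lemma W_eq_0_iff: "W x = 0 \<longleftrightarrow> (\<exists>v\<in>Rp. \<kappa> v \<noteq> 0 \<and> v \<bullet> x = 0)"
  unfolding W_eq using finite_Rp by (auto simp: prod_zero_iff weight_factor_def)

lemma W_continuous: "continuous_on S W"
proof -
  have "continuous_on S (\<lambda>x. weight_factor v (v \<bullet> x))" if "v \<in> Rp" for v
    using kappa_nonneg[OF that] unfolding weight_factor_def
    by (cases "\<kappa> v = 0") (auto intro!: continuous_intros continuous_on_powr')
  then show ?thesis unfolding W_eq by (intro continuous_on_prod)
qed

lemma W_scale: assumes "t > 0" shows "W (t *\<^sub>R x) = t powr (2 * \<gamma>) * W x"
proof -
  have "weight_factor v (v \<bullet> (t *\<^sub>R x)) = t powr (2 * \<kappa> v) * weight_factor v (v \<bullet> x)" for v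
    using assms by (simp add: weight_factor_def powr_mult power_mult_distrib powr_powr flip: powr_numeral)
  then have "W (t *\<^sub>R x) = (\<Prod>v\<in>Rp. t powr (2 * \<kappa> v)) * W x"
    unfolding W_eq by (simp only: prod.distrib)
  also have "(\<Prod>v\<in>Rp. t powr (2 * \<kappa> v)) = t powr (2 * \<gamma>)"
    using assms by (simp add: powr_sum[symmetric] \<gamma>_def sum_distrib_left finite_Rp)
  finally show ?thesis .
qed

lemma W_square_eq: "(W x)\<^sup>2 = (\<Prod>v\<in>R. weight_factor v (v \<bullet> x))"
proof -
  obtain u where u: "\<forall>v\<in>Rp. u \<bullet> v > 0" "\<forall>v\<in>uminus ` Rp. u \<bullet> v < 0" and RR: "R = Rp \<union> uminus ` Rp"
    using positive_subsystem unfolding positive_subsystem_def by blast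
  have dj: "Rp \<inter> uminus ` Rp = {}" using u by (meson disjoint_iff less_asym)
  have "(\<Prod>v\<in>R. weight_factor v (v \<bullet> x)) = W x * (\<Prod>v\<in>uminus ` Rp. weight_factor v (v \<bullet> x))"
    unfolding RR W_eq using finite_Rp dj by (intro prod.union_disjoint) auto
  also have "(\<Prod>v\<in>uminus ` Rp. weight_factor v (v \<bullet> x)) = (\<Prod>v\<in>Rp. weight_factor (- v) (- v \<bullet> x))"
    by (subst prod.reindex) (auto simp: inj_on_def)
  also have "\<dots> = W x"
    unfolding W_eq using Rp_sub by (intro prod.cong) (auto simp: weight_factor_def kappa_minus subset_iff)
  finally show ?thesis by (simp add: power2_eq_square)
qed

text \<open>The square of the weight is a product over all roots, and a reflection permutes the roots. It does
not preserve the set of positive roots.\<close>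

lemma W_reflection: assumes v: "v \<in> Rp" shows "W (reflection v x) = W x"
proof -
  have vR: "v \<in> R" using v Rp_sub by blast
  have im: "reflection v ` R = R" using vR root_system by (auto simp: root_system_def)
  have inj: "inj_on (reflection v) R" by (metis inj_onI reflection_reflection)
  have sym: "w \<bullet> reflection v x = reflection v w \<bullet> x" for w
    by (simp add: reflection_def inner_diff_left inner_diff_right inner_commute)
  have "(\<Prod>w\<in>R. weight_factor w (w \<bullet> x)) = (\<Prod>w\<in>reflection v ` R. weight_factor w (w \<bullet> x))" by (simp add: im)
  also have "\<dots> = (\<Prod>w\<in>R. weight_factor (reflection v w) (reflection v w \<bullet> x))"
    by (subst prod.reindex[OF inj]) simp
  also have "\<dots> = (\<Prod>w\<in>R. weight_factor w (w \<bullet> reflection v x))"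
    by (intro prod.cong) (auto simp: weight_factor_def kappa_reflection[OF vR] sym)
  finally have "(W x)\<^sup>2 = (W (reflection v x))\<^sup>2" by (simp add: W_square_eq)
  then show ?thesis using W_nonneg by (simp add: power2_eq_iff_nonneg)
qed

text \<open>Logarithmic differentiation. For \<open>\<kappa> v = 0\<close> the summand is zero, even where the denominator
vanishes.\<close>

lemma W_partial:
  assumes "W x > 0"
  shows "((\<lambda>t::real. W (x + t *\<^sub>R axis j 1)) has_real_derivative
     W x * (\<Sum>v\<in>Rp. 2 * \<kappa> v * v $ j / (x \<bullet> v))) (at 0)"
proof -
  have ne: "v \<bullet> x \<noteq> 0" if "v \<in> Rp" "\<kappa> v \<noteq> 0" for v using that assms W_eq_0_iff[of x] by auto
  have d: "((\<lambda>t::real. weight_factor v (v \<bullet> (x + t *\<^sub>R axis j 1))) has_real_derivative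
       weight_factor v (v \<bullet> x) * (2 * \<kappa> v * v $ j / (x \<bullet> v))) (at 0)" if v: "v \<in> Rp" for v
  proof (cases "\<kappa> v = 0")
    case False
    define q where "q t = (v \<bullet> (x + t *\<^sub>R axis j 1))\<^sup>2" for t :: real
    have q0: "q 0 > 0" using ne[OF v False] by (simp add: q_def)
    have "(q has_real_derivative 2 * (v \<bullet> x) * v $ j) (at 0)"
      unfolding q_def by (auto simp: inner_add_right inner_axis intro!: derivative_eq_intros)
    from DERIV_chain2[OF has_real_derivative_powr[OF q0, of "\<kappa> v"] this]
    have "((\<lambda>t. q t powr \<kappa> v) has_real_derivative \<kappa> v * q 0 powr (\<kappa> v - 1) * (2 * (v \<bullet> x) * v $ j)) (at 0)" .
    also have "\<kappa> v * q 0 powr (\<kappa> v - 1) * (2 * (v \<bullet> x) * v $ j) = q 0 powr \<kappa> v * (2 * \<kappa> v * v $ j / (x \<bullet> v))"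
      using q0 ne[OF v False] by (simp add: powr_diff, simp add: q_def power2_eq_square inner_commute field_simps)
    finally show ?thesis using False by (simp add: weight_factor_def q_def)
  qed (simp add: weight_factor_def)
  have nz': "weight_factor v (v \<bullet> (x + 0 *\<^sub>R axis j 1)) \<noteq> 0" if "v \<in> Rp" for v using ne[OF that] by (auto simp: weight_factor_def)
  have "((\<lambda>t::real. \<Prod>v\<in>Rp. weight_factor v (v \<bullet> (x + t *\<^sub>R axis j 1))) has_real_derivative
     (\<Prod>v\<in>Rp. weight_factor v (v \<bullet> (x + 0 *\<^sub>R axis j 1))) *
     (\<Sum>v\<in>Rp. weight_factor v (v \<bullet> x) * (2 * \<kappa> v * v $ j / (x \<bullet> v)) / weight_factor v (v \<bullet> (x + 0 *\<^sub>R axis j 1)))) (at 0)"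
    by (rule has_field_derivative_prod'[OF nz' d])
  also have "(\<Sum>v\<in>Rp. weight_factor v (v \<bullet> x) * (2 * \<kappa> v * v $ j / (x \<bullet> v)) / weight_factor v (v \<bullet> (x + 0 *\<^sub>R axis j 1)))
      = (\<Sum>v\<in>Rp. 2 * \<kappa> v * v $ j / (x \<bullet> v))"
    using nz' by (intro sum.cong) auto
  finally show ?thesis unfolding W_eq by simp
qed

lemma W_zero_on_hyperplane: "v \<in> Rp \<Longrightarrow> \<kappa> v \<noteq> 0 \<Longrightarrow> x \<bullet> v = 0 \<Longrightarrow> W x = 0"
  using W_eq_0_iff by (auto simp: inner_commute)

section \<open>Antisymmetry of the Dunkl operators\<close>

text \<open>The derivative of the truncated weight is a combination of these functions over the positive
roots with nonzero multiplicity. For such a root the pole at the mirror is harmless, since the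
numerator vanishes in a neighbourhood of the mirror.\<close>

definition sing_factor :: "real \<Rightarrow> real^'n \<Rightarrow> real^'n \<Rightarrow> real" where
  "sing_factor e v x = (1 - (1 - trunc_ratio e (W x))\<^sup>2) * W x / (x \<bullet> v)"

lemma trunc_W_continuous: assumes "e > 0" shows "continuous_on UNIV (\<lambda>x. trunc_ratio e (W x))"
proof -
  \<comment> \<open>A form without a vanishing denominator.\<close>
  have "trunc_ratio e s = max 0 (s - e) / max s e" for s
    using assms by (auto simp: trunc_ratio_def max_def)
  moreover have "continuous_on UNIV (\<lambda>x. max 0 (W x - e) / max (W x) e)"
    using assms by (intro continuous_intros W_continuous) auto
  ultimately show ?thesis by simp
qed

lemma sing_factor_continuous:
  assumes e: "e > 0" and v: "v \<in> Rp" "\<kappa> v \<noteq> 0"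
  shows "continuous_on UNIV (sing_factor e v)"
proof -
  have o: "open {x. W x > 0}" "open {x. W x < e}"
    by (intro open_Collect_less W_continuous continuous_intros)+
  have 1: "continuous_on {x. W x > 0} (sing_factor e v)"
    unfolding sing_factor_def
  proof (intro continuous_intros W_continuous continuous_on_subset[OF trunc_W_continuous[OF e]])
    show "\<forall>x\<in>{x. 0 < W x}. x \<bullet> v \<noteq> 0" using W_zero_on_hyperplane[OF v] by auto
  qed auto
  have 2: "continuous_on {x. W x < e} (sing_factor e v)"
  proof -
    have "sing_factor e v x = 0" if "W x < e" for x using that by (simp add: sing_factor_def trunc_ratio_zero)
    then show ?thesis by (subst continuous_on_cong[OF refl, where g="\<lambda>_. 0"]) auto
  qed
  have "{x. W x > 0} \<union> {x. W x < e} = UNIV" using e by force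
  then show ?thesis using continuous_on_open_Un[OF o 1 2] by simp
qed

lemma sing_factor_reflection:
  assumes "v \<in> Rp" shows "sing_factor e v (reflection v x) = - sing_factor e v x"
  by (simp add: sing_factor_def W_reflection[OF assms] reflection_inner)

lemma trunc_W_partial:
  assumes e: "e > 0"
  shows "((\<lambda>t::real. W (x + t *\<^sub>R axis j 1) * (trunc_ratio e (W (x + t *\<^sub>R axis j 1)))\<^sup>2) has_real_derivative
     (\<Sum>v\<in>Rp. 2 * \<kappa> v * v $ j * sing_factor e v x)) (at 0)"
proof (cases "W x = 0")
  case True
  have "open {x. W x < e}" by (intro open_Collect_less W_continuous continuous_intros)
  then have "open ((\<lambda>t::real. x + t *\<^sub>R axis j 1) -` {x. W x < e})"
    by (intro open_vimage) (auto intro!: continuous_intros)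
  moreover have d: "((\<lambda>t::real. 0) has_real_derivative (\<Sum>v\<in>Rp. 2 * \<kappa> v * v $ j * sing_factor e v x)) (at (0::real))"
    by (simp add: sing_factor_def True)
  ultimately show ?thesis
    using e True by (intro has_field_derivative_transform_within_open[OF d]) (auto simp: trunc_ratio_zero)
next
  case False
  then have pos: "W (x + 0 *\<^sub>R axis j 1) > 0" using W_nonneg[of x] by simp
  have "((\<lambda>t::real. W (x + t *\<^sub>R axis j 1)) has_real_derivative
     W x * (\<Sum>v\<in>Rp. 2 * \<kappa> v * v $ j / (x \<bullet> v))) (at 0)" using W_partial pos by simp
  note d = DERIV_chain2[OF trunc_derivative[OF pos, of e] this]
  define c where "c = 1 - (1 - trunc_ratio e (W x))\<^sup>2"
  have "sing_factor e v x = c * W x / (x \<bullet> v)" for v by (simp add: sing_factor_def c_def)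
  then show ?thesis using d by (simp add: c_def[symmetric] sum_distrib_left mult_ac)
qed

lemma partial_compact_support:
  fixes g :: "real^'n \<Rightarrow> real"
  assumes g: "C_class (Suc 0) g" and T: "\<And>x. norm x > T \<Longrightarrow> g x = 0" and x: "norm x > T"
  shows "partial j g x = 0"
proof -
  have "open {x::real^'n. T < norm x}" by (intro open_Collect_less continuous_intros)
  then have "open ((\<lambda>t::real. x + t *\<^sub>R axis j 1) -` {x::real^'n. T < norm x})"
    by (intro open_vimage) (auto intro!: continuous_intros)
  from has_field_derivative_transform_within_open[OF C_class_SucD(3)[OF g] this, where g="\<lambda>_. 0"]
  have "((\<lambda>t::real. 0) has_real_derivative partial j g x) (at (0::real))" using T x by simp
  then show "partial j g x = 0" using DERIV_unique DERIV_const by blast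
qed

text \<open>Differentiating \<open>f g\<close> times the truncated weight gives the singular terms \<open>2 f g / \<langle>x, v\<rangle>\<close>. The Dunkl
quotients give \<open>2 f g / \<langle>x, v\<rangle>\<close> minus \<open>K / \<langle>x, v\<rangle>\<close> with \<open>K = (f \<circ> \<sigma>) g + f (g \<circ> \<sigma>)\<close>. The difference, the
term with \<open>K\<close>, is odd under the reflection \<open>\<sigma>\<close> and integrates to zero. The truncation makes each
of these terms integrable by itself.\<close>

lemma D_antisym_trunc:
  assumes e: "e > 0" and f: "C_class (Suc 0) f" and g: "C_class (Suc 0) g"
    and T: "\<And>x. norm x > T \<Longrightarrow> g x = 0"
  shows "(\<integral>x. (partial j f x * g x + f x * partial j g x) * (W x * (trunc_ratio e (W x))\<^sup>2)
     + (\<Sum>v\<in>Rp. \<kappa> v * v $ j * (dunkl_quotient f v x * g x + f x * dunkl_quotient g v x))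
        * ((1 - (1 - trunc_ratio e (W x))\<^sup>2) * W x) \<partial>lborel) = 0"
    (is "(\<integral>x. ?I x \<partial>lborel) = 0")
proof -
  note cf = C_class_cont[OF f] and cg = C_class_cont[OF g]
  have cpf: "continuous_on UNIV (partial j f)" "continuous_on UNIV (partial j g)"
    using C_class_SucD(2)[OF f] C_class_SucD(2)[OF g] by auto
  define F where "F x = f x * g x" for x
  \<comment> \<open>The part of the quotient terms that is even under the reflection.\<close>
  define K where "K v x = f (reflection v x) * g x + f x * g (reflection v x)" for v x
  let ?R' = "{v\<in>Rp. \<kappa> v \<noteq> 0}"
  define G' where "G' x = (partial j f x * g x + f x * partial j g x) * (W x * (trunc_ratio e (W x))\<^sup>2)
      + F x * (\<Sum>v\<in>?R'. 2 * \<kappa> v * v $ j * sing_factor e v x)" for x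
  have split: "(\<Sum>v\<in>Rp. \<kappa> v * c v) = (\<Sum>v\<in>?R'. \<kappa> v * c v)" for c
    using finite_Rp by (intro sum.mono_neutral_right) auto
  have split': "(\<Sum>v\<in>Rp. 2 * \<kappa> v * v $ j * c v) = (\<Sum>v\<in>?R'. 2 * \<kappa> v * v $ j * c v)" for c
    using finite_Rp by (intro sum.mono_neutral_right) auto
  have cG': "continuous_on UNIV G'" unfolding G'_def F_def
    by (intro continuous_intros cf cg cpf W_continuous trunc_W_continuous e sing_factor_continuous) auto
  have G'0: "(\<integral>x. G' x \<partial>lborel) = 0"
  proof (rule integral_line_derivative_zero[where T=T and j=j, OF _ cG'])
    show "continuous_on UNIV (\<lambda>x. F x * (W x * (trunc_ratio e (W x))\<^sup>2))" unfolding F_def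
      by (intro continuous_intros cf cg W_continuous trunc_W_continuous e)
    show "((\<lambda>t. F (x + t *\<^sub>R axis j 1) * (W (x + t *\<^sub>R axis j 1) * (trunc_ratio e (W (x + t *\<^sub>R axis j 1)))\<^sup>2)) has_real_derivative G' x) (at 0)" for x
      using DERIV_mult[OF DERIV_mult[OF C_class_SucD(3)[OF f, of x j] C_class_SucD(3)[OF g, of x j]] trunc_W_partial[OF e, of x j]]
      unfolding F_def G'_def split' by (simp add: algebra_simps)
    show "F x * (W x * (trunc_ratio e (W x))\<^sup>2) = 0" if "norm x > T" for x using T[OF that] by (simp add: F_def)
  qed
  have iK: "integrable lborel (\<lambda>x. K v x * sing_factor e v x)" and K0: "(\<integral>x. K v x * sing_factor e v x \<partial>lborel) = 0"
    if v: "v \<in> ?R'" for v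
  proof -
    have v': "v \<in> Rp" "\<kappa> v \<noteq> 0" using v by auto
    have c: "continuous_on UNIV (\<lambda>x. K v x * sing_factor e v x)" unfolding K_def
      by (intro continuous_intros cf cg sing_factor_continuous e v'
           continuous_on_compose2[OF cf continuous_on_reflection] continuous_on_compose2[OF cg continuous_on_reflection]) auto
    show "integrable lborel (\<lambda>x. K v x * sing_factor e v x)"
      by (rule integrable_compact_support[OF c, of T]) (use T in \<open>auto simp: K_def norm_reflection\<close>)
    have "(\<integral>x. K v x * sing_factor e v x \<partial>lborel) = (\<integral>x. K v (reflection v x) * sing_factor e v (reflection v x) \<partial>lborel)"
      by (rule integral_reflection[symmetric]) (rule borel_measurable_continuous_onI[OF c])
    also have "\<dots> = (\<integral>x. - (K v x * sing_factor e v x) \<partial>lborel)"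
      by (simp add: K_def reflection_reflection sing_factor_reflection[OF v'(1)] algebra_simps)
    finally show "(\<integral>x. K v x * sing_factor e v x \<partial>lborel) = 0" by simp
  qed
  have iG': "integrable lborel G'"
  proof (rule integrable_compact_support[OF cG', of T])
    fix x :: "real^'n" assume x: "norm x > T"
    have "partial j g x = 0" by (rule partial_compact_support[OF g T x])
    then show "G' x = 0" using T[OF x] by (simp add: G'_def F_def)
  qed
  have "?I x = G' x - (\<Sum>v\<in>?R'. \<kappa> v * v $ j * (K v x * sing_factor e v x))" for x
  proof -
    have "\<kappa> v * v $ j * (dunkl_quotient f v x * g x + f x * dunkl_quotient g v x) * ((1 - (1 - trunc_ratio e (W x))\<^sup>2) * W x)
        = F x * (2 * \<kappa> v * v $ j * sing_factor e v x) - \<kappa> v * v $ j * (K v x * sing_factor e v x)" if v: "v \<in> ?R'" for v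
    proof (cases "x \<bullet> v = 0")
      case True
      then have "W x = 0" using v W_zero_on_hyperplane by blast
      then show ?thesis by (simp add: sing_factor_def)
    next
      case False
      have q: "dunkl_quotient f v x = (f x - f (reflection v x)) / (x \<bullet> v)" "dunkl_quotient g v x = (g x - g (reflection v x)) / (x \<bullet> v)"
        using False by (simp_all add: dunkl_quotient_def)
      show ?thesis unfolding q sing_factor_def F_def K_def using False by (simp add: field_simps)
    qed
    then have "(\<Sum>v\<in>?R'. \<kappa> v * v $ j * (dunkl_quotient f v x * g x + f x * dunkl_quotient g v x) * ((1 - (1 - trunc_ratio e (W x))\<^sup>2) * W x))
       = F x * (\<Sum>v\<in>?R'. 2 * \<kappa> v * v $ j * sing_factor e v x) - (\<Sum>v\<in>?R'. \<kappa> v * v $ j * (K v x * sing_factor e v x))"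
      unfolding sum_distrib_left sum_subtractf[symmetric] by (intro sum.cong) auto
    then show ?thesis
      using split[of "\<lambda>v. v $ j * (dunkl_quotient f v x * g x + f x * dunkl_quotient g v x)"]
      by (simp add: G'_def sum_distrib_right mult.assoc)
  qed
  then have "(\<integral>x. ?I x \<partial>lborel) = (\<integral>x. G' x - (\<Sum>v\<in>?R'. \<kappa> v * v $ j * (K v x * sing_factor e v x)) \<partial>lborel)"
    by (simp only:)
  also have "\<dots> = (\<integral>x. G' x \<partial>lborel) - (\<Sum>v\<in>?R'. \<kappa> v * v $ j * (\<integral>x. K v x * sing_factor e v x \<partial>lborel))"
    by (subst Bochner_Integration.integral_diff[OF iG'])
      (use iK in \<open>auto intro!: Bochner_Integration.integrable_sum simp: Bochner_Integration.integral_sum\<close>)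
  also have "\<dots> = 0" using G'0 K0 by simp
  finally show ?thesis .
qed

lemma quotient_compact_support:
  fixes g :: "real^'n \<Rightarrow> real"
  assumes g: "C_class (Suc 0) g" and T: "\<And>x. norm x > T \<Longrightarrow> g x = 0" and x: "norm x > T" and v: "v \<noteq> 0"
  shows "dunkl_quotient g v x = 0"
proof -
  have off: "dunkl_quotient g v y = 0" if "norm y > T" "y \<bullet> v \<noteq> 0" for y
    using that T[of y] T[of "reflection v y"] by (simp add: dunkl_quotient_def norm_reflection)
  show ?thesis
  proof (cases "x \<bullet> v = 0")
    case True
    define y where "y k = x + inverse (real (Suc k)) *\<^sub>R v" for k
    have "y \<longlonglongrightarrow> x + 0 *\<^sub>R v" unfolding y_def by (intro tendsto_intros LIMSEQ_inverse_real_of_nat)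
    then have y: "y \<longlonglongrightarrow> x" by simp
    have "isCont (dunkl_quotient g v) x"
      using C_class_cont[OF C_class_dunkl_quotient(1)[OF g v]] by (simp add: continuous_on_eq_continuous_at)
    from isCont_tendsto_compose[OF this y] have l: "(\<lambda>k. dunkl_quotient g v (y k)) \<longlonglongrightarrow> dunkl_quotient g v x" .
    have "eventually (\<lambda>k. norm (y k) > T) sequentially"
      using order_tendstoD(1)[OF tendsto_norm[OF y] x] .
    moreover have "y k \<bullet> v \<noteq> 0" for k using True v by (simp add: y_def inner_add_left)
    ultimately have "eventually (\<lambda>k. dunkl_quotient g v (y k) = 0) sequentially"
      by (auto elim!: eventually_mono simp: off)
    then have "(\<lambda>k. dunkl_quotient g v (y k)) \<longlonglongrightarrow> 0" by (simp add: tendsto_eventually)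
    then show ?thesis using l LIMSEQ_unique by blast
  qed (use off x in auto)
qed

lemma D_compact_support:
  assumes "C_class (Suc 0) g" and "\<And>x. norm x > T \<Longrightarrow> g x = 0" and "norm x > T"
  shows "D j g x = 0"
  unfolding dunkl_operator_def
  using partial_compact_support[OF assms] quotient_compact_support[OF assms Rp_nonzero] by simp

text \<open>Let the truncation parameter tend to zero. On the compact support the integrands are dominated
by a continuous function, and they converge wherever the weight is positive; where it vanishes
they are zero.\<close>

theorem D_antisym:
  assumes f: "C_class (Suc 0) f" and g: "C_class (Suc 0) g"
    and T: "\<And>x. norm x > T \<Longrightarrow> g x = 0"
  shows "(\<integral>x. D j f x * g x * W x \<partial>lborel) = - (\<integral>x. f x * D j g x * W x \<partial>lborel)"
proof -
  note cf = C_class_cont[OF f] and cg = C_class_cont[OF g]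
  have cp: "continuous_on UNIV (partial j f)" "continuous_on UNIV (partial j g)"
    using C_class_SucD(2)[OF f] C_class_SucD(2)[OF g] by auto
  have cq: "continuous_on UNIV (dunkl_quotient f v)" "continuous_on UNIV (dunkl_quotient g v)" if "v \<in> Rp" for v
    using C_class_cont[OF C_class_dunkl_quotient(1)[OF f Rp_nonzero[OF that]]] C_class_cont[OF C_class_dunkl_quotient(1)[OF g Rp_nonzero[OF that]]] by auto
  have cD: "continuous_on UNIV (D j f)" "continuous_on UNIV (D j g)"
    using C_class_cont[OF C_class_dunkl_operator[OF f zero_notin_Rp]] C_class_cont[OF C_class_dunkl_operator[OF g zero_notin_Rp]] by auto
  define A where "A x = partial j f x * g x + f x * partial j g x" for x
  define B where "B x = (\<Sum>v\<in>Rp. \<kappa> v * v $ j * (dunkl_quotient f v x * g x + f x * dunkl_quotient g v x))" for x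
  define r where "r k x = trunc_ratio (inverse (real (Suc k))) (W x)" for k x
  define I where "I k x = A x * (W x * (r k x)\<^sup>2) + B x * ((1 - (1 - r k x)\<^sup>2) * W x)" for k x
  have cA: "continuous_on UNIV A" unfolding A_def by (intro continuous_intros cf cg cp)
  have cB: "continuous_on UNIV B" unfolding B_def by (intro continuous_intros cf cg cq)
  have cr: "continuous_on UNIV (r k)" for k unfolding r_def by (rule trunc_W_continuous) simp
  have z: "A x = 0" "B x = 0" if "norm x > T" for x
    using T[OF that] partial_compact_support[OF g T that] quotient_compact_support[OF g T that Rp_nonzero]
    by (simp_all add: A_def B_def)
  have I0: "(\<integral>x. I k x \<partial>lborel) = 0" for k
    unfolding I_def A_def B_def r_def by (rule D_antisym_trunc[OF _ f g T]) simp_all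
  have rb: "0 \<le> r k x" "r k x \<le> 1" for k x
    using trunc_ratio_bounds[of "inverse (real (Suc k))" "W x"] W_nonneg by (auto simp: r_def)
  have "(\<lambda>k. \<integral>x. I k x \<partial>lborel) \<longlonglongrightarrow> (\<integral>x. A x * W x + B x * W x \<partial>lborel)"
  proof (rule integral_dominated_convergence[where w="\<lambda>x. (\<bar>A x\<bar> + \<bar>B x\<bar>) * W x"])
    show "(\<lambda>x. A x * W x + B x * W x) \<in> borel_measurable lborel"
      using borel_measurable_continuous_onI[of "\<lambda>x. A x * W x + B x * W x"] by (simp add: continuous_intros cA cB W_continuous)
    show "I k \<in> borel_measurable lborel" for k
      using borel_measurable_continuous_onI[of "I k"] unfolding I_def by (simp add: continuous_intros cA cB W_continuous cr)
    show "integrable lborel (\<lambda>x. (\<bar>A x\<bar> + \<bar>B x\<bar>) * W x)"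
      by (rule integrable_compact_support[of _ T]) (auto intro!: continuous_intros cA cB W_continuous simp: z)
    show "AE x in lborel. (\<lambda>k. I k x) \<longlonglongrightarrow> A x * W x + B x * W x"
    proof (rule AE_I2)
      fix x
      show "(\<lambda>k. I k x) \<longlonglongrightarrow> A x * W x + B x * W x"
      proof (cases "W x = 0")
        case False
        then have "(\<lambda>k. r k x) \<longlonglongrightarrow> 1" unfolding r_def using W_nonneg[of x] by (intro trunc_ratio_tendsto) auto
        then have "(\<lambda>k. I k x) \<longlonglongrightarrow> A x * (W x * 1\<^sup>2) + B x * ((1 - (1 - 1)\<^sup>2) * W x)"
          unfolding I_def by (intro tendsto_intros)
        then show ?thesis by simp
      qed (simp add: I_def)
    qed
    show "AE x in lborel. norm (I k x) \<le> (\<bar>A x\<bar> + \<bar>B x\<bar>) * W x" for k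
    proof (rule AE_I2)
      fix x
      have a: "\<bar>W x * (r k x)\<^sup>2\<bar> \<le> W x"
        using W_nonneg[of x] rb[of k x] mult_left_le[of "(r k x)\<^sup>2" "W x"] by (simp add: power_le_one)
      have "0 \<le> 1 - (1 - r k x)\<^sup>2" "1 - (1 - r k x)\<^sup>2 \<le> 1" using rb[of k x] by (auto simp: power_le_one)
      then have b: "\<bar>(1 - (1 - r k x)\<^sup>2) * W x\<bar> \<le> W x"
        using W_nonneg[of x] mult_right_mono[of "1 - (1 - r k x)\<^sup>2" 1 "W x"] by (simp add: abs_mult)
      have "norm (I k x) \<le> \<bar>A x\<bar> * \<bar>W x * (r k x)\<^sup>2\<bar> + \<bar>B x\<bar> * \<bar>(1 - (1 - r k x)\<^sup>2) * W x\<bar>"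
        unfolding I_def real_norm_def by (rule order_trans[OF abs_triangle_ineq]) (simp add: abs_mult)
      also have "\<dots> \<le> \<bar>A x\<bar> * W x + \<bar>B x\<bar> * W x"
        by (intro add_mono mult_left_mono a b) auto
      finally show "norm (I k x) \<le> (\<bar>A x\<bar> + \<bar>B x\<bar>) * W x" by (simp add: distrib_right)
    qed
  qed
  then have "(\<integral>x. A x * W x + B x * W x \<partial>lborel) = 0" unfolding I0 using LIMSEQ_unique tendsto_const by blast
  moreover have "A x * W x + B x * W x = D j f x * g x * W x + f x * D j g x * W x" for x
    by (simp add: A_def B_def dunkl_operator_def algebra_simps sum_distrib_left sum_distrib_right sum.distrib)
  moreover have "integrable lborel (\<lambda>x. D j f x * g x * W x)" "integrable lborel (\<lambda>x. f x * D j g x * W x)"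
    using T D_compact_support[OF g T]
    by (auto intro!: integrable_compact_support[of _ T] continuous_intros cD cf cg W_continuous)
  ultimately show ?thesis by simp
qed

theorem L_symmetric:
  assumes f: "C_class (Suc (Suc 0)) f" and g: "C_class (Suc (Suc 0)) g"
    and T: "\<And>x. norm x > T \<Longrightarrow> g x = 0"
  shows "(\<integral>x. L f x * g x * W x \<partial>lborel) = (\<integral>x. f x * L g x * W x \<partial>lborel)"
proof -
  have f1: "C_class (Suc 0) f" and g1: "C_class (Suc 0) g" using f g C_class_less by blast+
  have Df: "C_class (Suc 0) (D j f)" and Dg: "C_class (Suc 0) (D j g)" for j
    using C_class_dunkl_operator[OF f zero_notin_Rp] C_class_dunkl_operator[OF g zero_notin_Rp] by auto
  have DDf: "continuous_on UNIV (D j (D j f))" and DDg: "continuous_on UNIV (D j (D j g))" for j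
    using C_class_cont[OF C_class_dunkl_operator[OF Df zero_notin_Rp]] C_class_cont[OF C_class_dunkl_operator[OF Dg zero_notin_Rp]] by auto
  note sg = D_compact_support[OF g1 T]
  note sgg = D_compact_support[OF Dg sg]
  have i: "integrable lborel (\<lambda>x. D j (D j f) x * g x * W x)" "integrable lborel (\<lambda>x. f x * D j (D j g) x * W x)" for j
    using T sgg by (auto intro!: integrable_compact_support[of _ T] continuous_intros DDf DDg C_class_cont[OF f] C_class_cont[OF g] W_continuous simp del: C_class.simps)
  have "(\<integral>x. L f x * g x * W x \<partial>lborel) = (\<Sum>j\<in>UNIV. \<integral>x. D j (D j f) x * g x * W x \<partial>lborel)"
    unfolding dunkl_laplacian_def sum_distrib_right by (rule Bochner_Integration.integral_sum[OF i(1)])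
  also have "\<dots> = (\<Sum>j\<in>UNIV. \<integral>x. f x * D j (D j g) x * W x \<partial>lborel)"
    by (intro sum.cong refl) (simp add: D_antisym[OF Df g1 T] D_antisym[OF f1 Dg sg] del: C_class.simps)
  also have "\<dots> = (\<integral>x. f x * L g x * W x \<partial>lborel)"
    unfolding dunkl_laplacian_def sum_distrib_right sum_distrib_left by (rule Bochner_Integration.integral_sum[OF i(2), symmetric])
  finally show ?thesis .
qed

end

section \<open>Polar coordinates\<close>

text \<open>The integral over the unit sphere, divided by the dimension, written as an integral over the
ball of the function extended to be constant along rays.\<close>

definition sphere_integral :: "(real^'n \<Rightarrow> real) \<Rightarrow> real" where
  "sphere_integral F = (LINT x:ball 0 1|lborel. F (sgn x))"

lemma set_integrable_ball_continuous:
  fixes G :: "real^'n \<Rightarrow> real"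
  assumes "continuous_on UNIV G"
  shows "set_integrable lborel (ball 0 t) G"
proof -
  have "set_integrable lborel (cball 0 t) G"
    unfolding set_integrable_def by (rule borel_integrable_compact) (use assms continuous_on_subset in auto)
  then show ?thesis by (rule set_integrable_subset) auto
qed

lemma ball_borel [measurable]: "ball (x :: real^'n) t \<in> sets borel"
  by (rule borel_open) simp

lemma set_integrable_sgn:
  fixes F :: "real^'n \<Rightarrow> real"
  assumes F: "continuous_on UNIV F"
  shows "set_integrable lborel (ball 0 t) (\<lambda>x. F (c *\<^sub>R sgn x))"
proof -
  have [measurable]: "F \<in> borel_measurable borel" by (rule borel_measurable_continuous_onI[OF F])
  obtain B where B0: "B \<ge> 0" and B: "\<And>y. norm y \<le> \<bar>c\<bar> \<Longrightarrow> \<bar>F y\<bar> \<le> B"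
    using continuous_bounded_on_cball[OF F] by blast
  have nb: "norm (c *\<^sub>R sgn x) \<le> \<bar>c\<bar>" for x :: "real^'n" by (simp add: norm_sgn)
  have "set_integrable lborel (ball 0 t) (\<lambda>x::real^'n. B)"
    by (rule set_integrable_ball_continuous) simp
  then show ?thesis
    by (rule set_integrable_bound) (auto simp: set_borel_measurable_def intro!: AE_I2 order_trans[OF B[OF nb]])
qed

lemma set_integrable_sgn1: "continuous_on UNIV F \<Longrightarrow> set_integrable lborel (ball 0 t) (\<lambda>x. F (sgn x))"
  for F :: "real^'n \<Rightarrow> real"
  using set_integrable_sgn[of F t 1] by simp

lemma sphere_integral_add:
  "continuous_on UNIV F \<Longrightarrow> continuous_on UNIV G \<Longrightarrow> sphere_integral (\<lambda>y. F y + G y) = sphere_integral F + sphere_integral G"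
  unfolding sphere_integral_def by (intro set_integral_add set_integrable_sgn1)

lemma sphere_integral_diff:
  "continuous_on UNIV F \<Longrightarrow> continuous_on UNIV G \<Longrightarrow> sphere_integral (\<lambda>y. F y - G y) = sphere_integral F - sphere_integral G"
  unfolding sphere_integral_def by (intro set_integral_diff set_integrable_sgn1)

lemma sphere_integral_cmult: "sphere_integral (\<lambda>y. c * F y) = c * sphere_integral F"
  unfolding sphere_integral_def by simp

lemma sphere_integral_zero [simp]: "sphere_integral (\<lambda>y. 0) = 0"
  by (simp add: sphere_integral_def)

lemma sphere_integral_sum:
  "(\<And>i. i \<in> I \<Longrightarrow> continuous_on UNIV (F i)) \<Longrightarrow> sphere_integral (\<lambda>y. \<Sum>i\<in>I. F i y) = (\<Sum>i\<in>I. sphere_integral (F i))"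
proof (induction I rule: infinite_finite_induct)
  case (insert i I)
  then show ?case by (simp add: sphere_integral_add continuous_on_sum)
qed simp_all

lemma AE_lborel_nonzero: "AE x in lborel. (x :: real^'n) \<noteq> 0"
proof (rule AE_I[of _ _ "{0}"])
  show "emeasure lborel {0 :: real^'n} = 0" by (simp add: emeasure_lborel_countable)
qed auto

lemma sphere_integral_cong:
  fixes F G :: "real^'n \<Rightarrow> real"
  assumes "\<And>y. norm y = 1 \<Longrightarrow> F y = G y" and F: "continuous_on UNIV F" and G: "continuous_on UNIV G"
  shows "sphere_integral F = sphere_integral G"
proof -
  have [measurable]: "F \<in> borel_measurable borel" "G \<in> borel_measurable borel"
    using borel_measurable_continuous_onI F G by auto
  show ?thesis unfolding sphere_integral_def
    by (rule set_lebesgue_integral_cong_AE)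
      (use AE_lborel_nonzero in \<open>auto elim!: eventually_mono simp: assms(1) norm_sgn\<close>)
qed

lemma sphere_integral_mono:
  fixes F G :: "real^'n \<Rightarrow> real"
  assumes le: "\<And>y. norm y = 1 \<Longrightarrow> F y \<le> G y" and F: "continuous_on UNIV F" and G: "continuous_on UNIV G"
  shows "sphere_integral F \<le> sphere_integral G"
  unfolding sphere_integral_def
proof (rule set_integral_mono_AE[OF set_integrable_sgn1[OF F] set_integrable_sgn1[OF G]])
  show "AE x\<in>ball 0 1 in lborel. F (sgn x) \<le> G (sgn x)"
    using AE_lborel_nonzero by (rule eventually_mono) (auto intro: le simp: norm_sgn)
qed

lemma sphere_integral_nonneg:
  "(\<And>y. norm y = 1 \<Longrightarrow> F y \<ge> 0) \<Longrightarrow> continuous_on UNIV F \<Longrightarrow> sphere_integral F \<ge> 0"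
  using sphere_integral_mono[of "\<lambda>_. 0" F] by simp

lemma sphere_integral_abs_le:
  assumes F: "continuous_on UNIV F"
  shows "\<bar>sphere_integral F\<bar> \<le> sphere_integral (\<lambda>y. \<bar>F y\<bar>)"
proof -
  have "sphere_integral F \<le> sphere_integral (\<lambda>y. \<bar>F y\<bar>)"
    by (rule sphere_integral_mono) (auto intro!: continuous_intros F)
  moreover have "sphere_integral (\<lambda>y. - 1 * F y) \<le> sphere_integral (\<lambda>y. \<bar>F y\<bar>)"
    by (rule sphere_integral_mono) (auto intro!: continuous_intros F)
  ultimately show ?thesis unfolding sphere_integral_cmult by linarith
qed

lemma sphere_integral_eq_0D:
  fixes F :: "real^'n \<Rightarrow> real"
  assumes F: "continuous_on UNIV F" and nn: "\<And>y. norm y = 1 \<Longrightarrow> F y \<ge> 0"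
    and z: "sphere_integral F = 0"
  shows "AE x in lborel. x \<in> ball 0 1 \<longrightarrow> F (sgn x) = 0"
proof -
  have "AE x in lborel. 0 \<le> indicator (ball 0 1) x *\<^sub>R F (sgn x)"
    using AE_lborel_nonzero by (rule eventually_mono) (auto intro: nn simp: norm_sgn indicator_def)
  from integral_nonneg_eq_0_iff_AE[OF set_integrable_sgn1[OF F, of 1, unfolded set_integrable_def] this] z
  have "AE x in lborel. indicator (ball 0 1) x *\<^sub>R F (sgn x) = 0"
    by (simp add: sphere_integral_def set_lebesgue_integral_def)
  then show ?thesis by (auto elim!: eventually_mono simp: indicator_def split: if_splits)
qed

lemma sphere_integral_scale_continuous:
  fixes F :: "real^'n \<Rightarrow> real"
  assumes F: "continuous_on UNIV F"
  shows "continuous_on UNIV (\<lambda>t. sphere_integral (\<lambda>y. F (t *\<^sub>R y)))"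
  unfolding continuous_on_sequentially
proof (intro allI ballI impI, elim conjE)
  fix a and t :: "nat \<Rightarrow> real" assume t: "t \<longlonglongrightarrow> a"
  have [measurable]: "F \<in> borel_measurable borel" by (rule borel_measurable_continuous_onI[OF F])
  have "bounded (range t)" using t convergent_imp_bounded by blast
  then obtain c where c: "\<bar>t k\<bar> \<le> c" for k unfolding bounded_iff by auto
  obtain B where B0: "B \<ge> 0" and B: "\<And>y. norm y \<le> c \<Longrightarrow> \<bar>F y\<bar> \<le> B"
    using continuous_bounded_on_cball[OF F] by blast
  have nb: "norm (t k *\<^sub>R sgn x) \<le> c" for k and x :: "real^'n"
    using c[of k] order_trans[OF abs_ge_zero c[of k]] by (simp add: norm_sgn)
  show "((\<lambda>t. sphere_integral (\<lambda>y. F (t *\<^sub>R y))) \<circ> t) \<longlonglongrightarrow> sphere_integral (\<lambda>y. F (a *\<^sub>R y))"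
    unfolding sphere_integral_def set_lebesgue_integral_def o_def
  proof (rule integral_dominated_convergence[where w="\<lambda>x. indicator (ball 0 1) x *\<^sub>R B"])
    show "integrable lborel (\<lambda>x::real^'n. indicator (ball 0 1) x *\<^sub>R B)"
      using set_integrable_ball_continuous[of "\<lambda>_::real^'n. B" 1] by (simp add: set_integrable_def)
    show "AE x in lborel. (\<lambda>k. indicator (ball 0 1) x *\<^sub>R F (t k *\<^sub>R sgn x)) \<longlonglongrightarrow> indicator (ball 0 1) x *\<^sub>R F (a *\<^sub>R sgn x)"
    proof (rule AE_I2, intro tendsto_intros)
      fix x :: "real^'n"
      have "isCont F (a *\<^sub>R sgn x)" using F by (simp add: continuous_on_eq_continuous_at)
      then show "(\<lambda>k. F (t k *\<^sub>R sgn x)) \<longlonglongrightarrow> F (a *\<^sub>R sgn x)"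
        by (rule isCont_tendsto_compose) (intro tendsto_intros t)
    qed
    show "AE x in lborel. norm (indicator (ball 0 1) x *\<^sub>R F (t k *\<^sub>R sgn x)) \<le> indicator (ball 0 1) x *\<^sub>R B" for k
      using B[OF nb] by (intro AE_I2) (auto simp: indicator_def)
  qed measurable
qed

text \<open>A function that is constant along rays has an integral over balls that scales like the volume.\<close>

lemma set_integral_ball_scale:
  fixes H :: "real^'n \<Rightarrow> real"
  assumes H: "H \<in> borel_measurable borel" and \<tau>: "\<tau> > 0"
  shows "(LINT x:ball 0 \<tau>|lborel. H (sgn x)) = \<tau> ^ CARD('n) * (LINT x:ball 0 1|lborel. H (sgn x))"
proof -
  note [measurable] = H
  have "(LINT x:ball 0 \<tau>|lborel. H (sgn x))
      = (\<integral>x. indicator (ball 0 \<tau>) x *\<^sub>R H (sgn x) \<partial>density (distr lborel borel (\<lambda>x. 0 + \<tau> *\<^sub>R x)) (\<lambda>_. ennreal (\<bar>\<tau>\<bar> ^ DIM(real^'n))))"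
    unfolding set_lebesgue_integral_def using lborel_affine[of \<tau> "0::real^'n"] \<tau> by simp
  also have "\<dots> = (\<integral>x. \<tau> ^ CARD('n) * (indicator (ball 0 \<tau>) (\<tau> *\<^sub>R x) * H (sgn (\<tau> *\<^sub>R x))) \<partial>(lborel::(real^'n) measure))"
    using \<tau> by (subst integral_density) (auto simp: integral_distr)
  also have "\<dots> = (\<integral>x. \<tau> ^ CARD('n) * (indicator (ball 0 1) x * H (sgn x)) \<partial>(lborel::(real^'n) measure))"
    using \<tau> by (intro Bochner_Integration.integral_cong) (auto simp: indicator_def sgn_scaleR)
  finally show ?thesis by (simp add: set_lebesgue_integral_def)
qed

lemma set_integral_shell:
  fixes h :: "real^'n \<Rightarrow> real"
  assumes h: "\<And>t. set_integrable lborel (ball 0 t) h" and ab: "0 \<le> a" "a \<le> b"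
    and e: "\<And>x. a \<le> norm x \<Longrightarrow> norm x < b \<Longrightarrow> \<bar>h x\<bar> \<le> e"
  shows "\<bar>(LINT x:ball 0 b|lborel. h x) - (LINT x:ball 0 a|lborel. h x)\<bar>
     \<le> e * (measure lborel (ball (0::real^'n) 1) * (b ^ CARD('n) - a ^ CARD('n)))"
proof -
  let ?S = "ball 0 b - ball (0::real^'n) a"
  have sub: "ball (0::real^'n) a \<subseteq> ball 0 b" using ab by auto
  have iS: "set_integrable lborel ?S h" by (rule set_integrable_subset[OF h[of b]]) auto
  have i1: "set_integrable lborel ?S (\<lambda>x. e)"
    by (rule set_integrable_subset[OF set_integrable_ball_continuous[of "\<lambda>_. e" b]]) auto
  have "ball 0 b = ball (0::real^'n) a \<union> ?S" using sub by auto
  then have "(LINT x:ball 0 b|lborel. h x) = (LINT x:ball 0 a|lborel. h x) + (LINT x:?S|lborel. h x)"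
    using set_integral_Un[of "ball (0::real^'n) a" ?S lborel h] h iS by (metis Diff_disjoint)
  then have "\<bar>(LINT x:ball 0 b|lborel. h x) - (LINT x:ball 0 a|lborel. h x)\<bar> = \<bar>LINT x:?S|lborel. h x\<bar>" by simp
  also have "\<dots> \<le> (LINT x:?S|lborel. \<bar>h x\<bar>)"
    using set_integral_norm_bound[OF iS] by simp
  also have "\<dots> \<le> (LINT x:?S|lborel. e)"
    using iS i1 by (intro set_integral_mono) (auto intro: e set_integrable_abs)
  also have "\<dots> = e * measure lborel ?S"
    by (simp add: set_lebesgue_integral_def mult.commute)
  also have "measure lborel ?S = measure lborel (ball (0::real^'n) b) - measure lborel (ball (0::real^'n) a)"
    using sub emeasure_lborel_ball_finite[of "0::real^'n" b] by (intro measure_Diff) auto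
  also have "\<dots> = measure lborel (ball (0::real^'n) 1) * (b ^ CARD('n) - a ^ CARD('n))"
    using ab content_ball_conv_unit_ball[of b "0::real^'n"] content_ball_conv_unit_ball[of a "0::real^'n"]
    by (simp add: algebra_simps)
  finally show ?thesis .
qed

lemma power_diff_le:
  fixes a b :: real
  assumes "0 \<le> a" "a \<le> b" "b \<le> c"
  shows "b ^ n - a ^ n \<le> real n * c ^ (n - 1) * (b - a)"
proof (cases n)
  case (Suc m)
  have "b ^ n - a ^ n = (b - a) * (\<Sum>i<Suc m. b ^ i * a ^ (m - i))"
    unfolding Suc using power_diff_sumr2[of b "Suc m" a] by (simp add: mult.commute)
  also have "\<dots> \<le> (b - a) * (\<Sum>i<Suc m. c ^ m)"
  proof (intro mult_left_mono sum_mono)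
    fix i assume "i \<in> {..<Suc m}"
    then have "b ^ i * a ^ (m - i) \<le> c ^ i * c ^ (m - i)" using assms by (intro mult_mono power_mono) auto
    also have "\<dots> = c ^ m" using \<open>i \<in> {..<Suc m}\<close> by (simp flip: power_add)
    finally show "b ^ i * a ^ (m - i) \<le> c ^ m" .
  qed (use assms in auto)
  finally show ?thesis by (simp add: Suc algebra_simps)
qed simp

text \<open>Integration in polar coordinates, in differential form. On a thin shell about the radius \<open>t\<close> the
function \<open>G\<close> is uniformly close to its radial extension from the sphere of radius \<open>t\<close>, whose
integral over balls is known exactly.\<close>

theorem ball_integral_derivative:
  fixes G :: "real^'n \<Rightarrow> real"
  assumes G: "continuous_on UNIV G" and t: "t > 0"
  shows "((\<lambda>\<tau>. LINT x:ball 0 \<tau>|lborel. G x) has_real_derivative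
     real CARD('n) * t ^ (CARD('n) - 1) * sphere_integral (\<lambda>y. G (t *\<^sub>R y))) (at t)"
proof -
  define N where "N = CARD('n)"
  define E where "E \<tau> = (LINT x:ball 0 \<tau>|lborel. G x - G (t *\<^sub>R sgn x))" for \<tau>
  have Gt: "continuous_on UNIV (\<lambda>y. G (t *\<^sub>R y))" by (intro continuous_on_compose2[OF G] continuous_intros) auto
  have ih: "set_integrable lborel (ball 0 \<tau>) (\<lambda>x. G x - G (t *\<^sub>R sgn x))" for \<tau>
    by (intro set_integral_diff set_integrable_ball_continuous G set_integrable_sgn)
  \<comment> \<open>\<open>C \<bar>\<tau> - t\<bar>\<close> bounds the volume of the shell between the radii \<open>\<tau>\<close> and \<open>t\<close>.\<close>
  define C where "C = measure lborel (ball (0::real^'n) 1) * (real N * (t + 1) ^ (N - 1))"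
  have C: "C > 0" using t content_ball_pos[of 1 "0::real^'n"] by (auto simp: C_def N_def zero_less_mult_iff)
  have "((\<lambda>\<tau>. E \<tau>) has_derivative (\<lambda>h. 0)) (at t)"
    unfolding has_derivative_at_alt
  proof (intro conjI allI impI)
    fix e :: real assume e: "e > 0"
    have "uniformly_continuous_on (cball 0 (t + 1)) G"
      by (intro compact_uniformly_continuous continuous_on_subset[OF G]) auto
    then obtain d where d: "d > 0" "\<And>x y. x \<in> cball 0 (t + 1) \<Longrightarrow> y \<in> cball 0 (t + 1) \<Longrightarrow> dist y x < d \<Longrightarrow> dist (G y) (G x) < e / C"
      unfolding uniformly_continuous_on_def using e C by (metis divide_pos_pos)
    show "\<exists>d>0. \<forall>y. norm (y - t) < d \<longrightarrow> norm (E y - E t - 0) \<le> e * norm (y - t)"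
    proof (intro exI conjI allI impI)
      show "min d (min t 1) > 0" using d t by simp
      fix \<tau> :: real assume \<tau>: "norm (\<tau> - t) < min d (min t 1)"
      define a where "a = min \<tau> t"
      define b where "b = max \<tau> t"
      have ab: "0 \<le> a" "a \<le> b" "b \<le> t + 1" "b - a = \<bar>\<tau> - t\<bar>" "a \<le> t" "t \<le> b" using \<tau> t by (auto simp: a_def b_def)
      have "\<bar>E b - E a\<bar> \<le> e / C * (measure lborel (ball (0::real^'n) 1) * (b ^ CARD('n) - a ^ CARD('n)))"
        unfolding E_def
      proof (rule set_integral_shell[OF ih ab(1,2)])
        fix x :: "real^'n" assume x: "a \<le> norm x" "norm x < b"
        have "\<tau> > 0" using \<tau> by auto
        then have x0: "x \<noteq> 0" using x t by (auto simp: a_def)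
        have "x - t *\<^sub>R sgn x = ((norm x - t) / norm x) *\<^sub>R x"
          using x0 by (simp add: sgn_div_norm algebra_simps diff_divide_distrib divide_inverse)
        then have "dist x (t *\<^sub>R sgn x) = \<bar>norm x - t\<bar>" using x0 by (simp add: dist_norm)
        also have "\<dots> \<le> b - a" using x ab by linarith
        also have "\<dots> < d" using \<tau> ab(4) by simp
        finally have "dist (G x) (G (t *\<^sub>R sgn x)) < e / C"
          using x ab t x0 by (intro d(2)) (auto simp: norm_sgn)
        then show "\<bar>G x - G (t *\<^sub>R sgn x)\<bar> \<le> e / C" by (simp add: dist_real_def)
      qed
      also have "\<dots> \<le> e / C * (measure lborel (ball (0::real^'n) 1) * (real N * (t + 1) ^ (N - 1) * (b - a)))"
        using power_diff_le[OF ab(1,2,3), of N] e C by (intro mult_left_mono) (auto simp: N_def)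
      also have "\<dots> = e / C * (C * (b - a))" by (simp add: C_def mult.assoc)
      also have "\<dots> = e * (b - a)" using C by simp
      finally have "\<bar>E b - E a\<bar> \<le> e * \<bar>\<tau> - t\<bar>" using ab(4) by simp
      then show "norm (E \<tau> - E t - 0) \<le> e * norm (\<tau> - t)"
        by (cases "\<tau> \<le> t") (auto simp: a_def b_def min_def max_def abs_minus_commute split: if_splits)
    qed
  qed auto
  then have E': "(E has_real_derivative 0) (at t)" by (simp add: has_field_derivative_def lambda_zero)
  define S where "S = sphere_integral (\<lambda>y. G (t *\<^sub>R y))"
  have d: "((\<lambda>\<tau>. E \<tau> + \<tau> ^ N * S) has_real_derivative 0 + real N * t ^ (N - 1) * S) (at t)"
    by (intro DERIV_add E') (auto intro!: derivative_eq_intros)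
  have eq: "E \<tau> + \<tau> ^ N * S = (LINT x:ball 0 \<tau>|lborel. G x)" if "\<tau> > 0" for \<tau>
  proof -
    have "(LINT x:ball 0 \<tau>|lborel. G (t *\<^sub>R sgn x)) = \<tau> ^ N * S"
      unfolding S_def sphere_integral_def N_def
      by (rule set_integral_ball_scale[OF borel_measurable_continuous_onI[OF Gt] that])
    moreover have "E \<tau> = (LINT x:ball 0 \<tau>|lborel. G x) - (LINT x:ball 0 \<tau>|lborel. G (t *\<^sub>R sgn x))"
      unfolding E_def by (intro set_integral_diff set_integrable_ball_continuous G set_integrable_sgn)
    ultimately show ?thesis by simp
  qed
  have "((\<lambda>\<tau>. LINT x:ball 0 \<tau>|lborel. G x) has_real_derivative 0 + real N * t ^ (N - 1) * S) (at t)"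
    by (rule has_field_derivative_transform_within_open[OF d, of "{0<..}"]) (use t eq in auto)
  then show ?thesis by (simp add: N_def S_def)
qed

lemma ball_integral_zero:
  fixes G :: "real^'n \<Rightarrow> real"
  assumes G: "continuous_on UNIV G" and z: "\<And>t. t > 0 \<Longrightarrow> sphere_integral (\<lambda>y. G (t *\<^sub>R y)) = 0" and T: "T > 0"
  shows "(LINT x:ball 0 T|lborel. G x) = 0"
proof (rule ccontr)
  define V where "V \<tau> = (LINT x:ball 0 \<tau>|lborel. G x)" for \<tau>
  assume "(LINT x:ball 0 T|lborel. G x) \<noteq> 0"
  then have VT: "\<bar>V T\<bar> > 0" by (simp add: V_def)
  have const: "V a = V T" if a: "0 < a" "a \<le> T" for a
  proof (cases "a = T")
    case False
    then have aT: "a < T" using a by simp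
    have der: "(V has_real_derivative 0) (at x)" if "0 < x" for x
      using ball_integral_derivative[OF G that] z[OF that] unfolding V_def by simp
    have cont: "continuous_on {a..T} V"
      using a by (intro continuous_at_imp_continuous_on ballI DERIV_isCont[OF der]) auto
    have "V T = V a" by (rule DERIV_isconst2[OF aT cont der]) (use a in auto)
    then show "V a = V T" by simp
  qed simp
  obtain B where B0: "B \<ge> 0" and B: "\<And>y. norm y \<le> T \<Longrightarrow> \<bar>G y\<bar> \<le> B"
    using continuous_bounded_on_cball[OF G] by blast
  define C where "C = B * measure lborel (ball (0::real^'n) 1)"
  have C0: "C \<ge> 0" using B0 by (simp add: C_def)
  have le: "\<bar>V T\<bar> \<le> C * a ^ CARD('n)" if a: "0 < a" "a \<le> T" for a
  proof -
    have "\<bar>(LINT x:ball 0 a|lborel. G x) - (LINT x:ball 0 0|lborel. G x)\<bar> \<le> B * (measure lborel (ball (0::real^'n) 1) * (a ^ CARD('n) - 0 ^ CARD('n)))"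
      by (rule set_integral_shell) (use a B set_integrable_ball_continuous[OF G] in auto)
    moreover have "(LINT x:ball 0 0|lborel. G x) = 0" by (simp add: set_lebesgue_integral_def)
    ultimately show ?thesis using const[OF a] by (simp add: V_def C_def mult.assoc power_0_left)
  qed
  have "((\<lambda>a. C * a ^ CARD('n)) \<longlongrightarrow> C * 0 ^ CARD('n)) (at_right (0::real))"
    by (intro tendsto_intros)
  moreover have "(0::real) ^ CARD('n) = 0" by simp
  ultimately have "((\<lambda>a. C * a ^ CARD('n)) \<longlongrightarrow> 0) (at_right (0::real))" by (simp only: mult_zero_right)
  then have "eventually (\<lambda>a. C * a ^ CARD('n) < \<bar>V T\<bar>) (at_right 0)" using VT by (rule order_tendstoD)
  moreover have "eventually (\<lambda>a. 0 < a \<and> a \<le> T) (at_right (0::real))"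
    using T by (auto simp: eventually_at_right intro!: exI[of _ T])
  ultimately have "eventually (\<lambda>a::real. False) (at_right 0)"
    by eventually_elim (use le in force)
  then show False by simp
qed

text \<open>The support condition keeps the radii away from zero, where the derivative of the ball integral
is not available.\<close>

lemma polar_integral:
  fixes G :: "real^'n \<Rightarrow> real"
  assumes G: "continuous_on UNIV G" and ab: "0 < a" "a \<le> b"
    and supp: "\<And>x. norm x < a \<or> b \<le> norm x \<Longrightarrow> G x = 0"
  shows "((\<lambda>t. real CARD('n) * t ^ (CARD('n) - 1) * sphere_integral (\<lambda>y. G (t *\<^sub>R y))) has_integral (\<integral>x. G x \<partial>lborel)) {a..b}"
proof -
  define V where "V \<tau> = (LINT x:ball 0 \<tau>|lborel. G x)" for \<tau>
  have "V a = 0"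
    unfolding V_def set_lebesgue_integral_def using supp
    by (intro integral_eq_zero_AE AE_I2) (auto simp: indicator_def)
  moreover have "V b = (\<integral>x. G x \<partial>lborel)"
    unfolding V_def set_lebesgue_integral_def using supp
    by (intro Bochner_Integration.integral_cong) (auto simp: indicator_def not_less)
  moreover have "((\<lambda>t. real CARD('n) * t ^ (CARD('n) - 1) * sphere_integral (\<lambda>y. G (t *\<^sub>R y))) has_integral (V b - V a)) {a..b}"
  proof (rule fundamental_theorem_of_calculus[OF ab(2)])
    fix t assume "t \<in> {a..b}"
    then have "t > 0" using ab by simp
    from has_field_derivative_at_within[OF ball_integral_derivative[OF G this]]
    show "(V has_vector_derivative real CARD('n) * t ^ (CARD('n) - 1) * sphere_integral (\<lambda>y. G (t *\<^sub>R y))) (at t within {a..b})"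
      unfolding has_real_derivative_iff_has_vector_derivative V_def .
  qed
  ultimately show ?thesis by simp
qed

lemma integral_surface_measure:
  fixes F :: "real^'n \<Rightarrow> real"
  assumes F: "continuous_on UNIV F" and r: "r > 0"
  shows "(\<integral>y. F y \<partial>surface_measure r) = real CARD('n) * r ^ (CARD('n) - 1) * sphere_integral (\<lambda>y. F (r *\<^sub>R y))"
proof -
  have [measurable]: "F \<in> borel_measurable borel" by (rule borel_measurable_continuous_onI[OF F])
  let ?M = "distr (restrict_space lborel (ball 0 r)) borel (\<lambda>x::real^'n. (r / norm x) *\<^sub>R x)"
  have m [measurable]: "(\<lambda>x::real^'n. (r / norm x) *\<^sub>R x) \<in> restrict_space lborel (ball 0 r) \<rightarrow>\<^sub>M borel"
    by (rule measurable_restrict_space1) measurable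
  have "surface_measure r = density ?M (\<lambda>_. ennreal (real CARD('n) / r))"
    unfolding surface_measure_def
    by (rule measure_eqI) (auto simp: emeasure_density nn_integral_cmult)
  then have "(\<integral>y. F y \<partial>surface_measure r) = (\<integral>y. real CARD('n) / r * F y \<partial>?M)"
    using r by (simp add: integral_density)
  also have "\<dots> = (\<integral>x. real CARD('n) / r * F ((r / norm x) *\<^sub>R x) \<partial>restrict_space lborel (ball 0 r))"
    by (subst integral_distr) auto
  also have "\<dots> = (\<integral>x. real CARD('n) / r * F (r *\<^sub>R sgn x) \<partial>restrict_space lborel (ball 0 r))"
    by (simp add: sgn_div_norm divide_inverse)
  also have "\<dots> = (LINT x:ball 0 r|lborel. real CARD('n) / r * F (r *\<^sub>R sgn x))"
    unfolding set_lebesgue_integral_def by (rule integral_restrict_space) simp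
  also have "\<dots> = real CARD('n) / r * (LINT x:ball 0 r|lborel. F (r *\<^sub>R sgn x))"
    by (rule set_integral_mult_right)
  also have "(LINT x:ball 0 r|lborel. F (r *\<^sub>R sgn x)) = r ^ CARD('n) * sphere_integral (\<lambda>y. F (r *\<^sub>R y))"
    unfolding sphere_integral_def by (rule set_integral_ball_scale[OF _ r]) measurable
  finally show ?thesis using r by (cases "CARD('n)") (auto simp: power_Suc)
qed

section \<open>Spherical coefficients of polyharmonic functions\<close>

lemma antiderivative_exists:
  fixes \<theta> :: "real \<Rightarrow> real"
  assumes "continuous_on UNIV \<theta>"
  obtains \<Theta> where "\<And>t. (\<Theta> has_real_derivative \<theta> t) (at t)"
proof -
  have "((\<lambda>u. LBINT y=ereal 0..ereal u. \<theta> y) has_real_derivative \<theta> t) (at t)" for t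
  proof -
    define c where "c = \<bar>t\<bar> + 1"
    have "((\<lambda>u. LBINT y=ereal 0..ereal u. \<theta> y) has_vector_derivative \<theta> t) (at t within {-c..c})"
      by (rule interval_integral_FTC2) (use assms continuous_on_subset in \<open>auto simp: c_def\<close>)
    moreover have "at t within {-c..c} = at t" by (rule at_within_interior) (auto simp: c_def)
    ultimately show ?thesis by (simp add: has_real_derivative_iff_has_vector_derivative)
  qed
  then show ?thesis using that by blast
qed

lemma vanishing_derivative_const:
  fixes F :: "real \<Rightarrow> real"
  assumes F: "\<And>t. (F has_real_derivative F' t) (at t)" and z: "\<And>t. a < t \<Longrightarrow> t < b \<Longrightarrow> F' t = 0" and ab: "a \<le> b"
  shows "F b = F a"
proof (cases "a = b")
  case False
  then have "a < b" using ab by simp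
  moreover have "continuous_on {a..b} F"
    using F has_real_derivative_continuous_on continuous_on_subset by blast
  ultimately show ?thesis
    by (rule DERIV_isconst2) (use F z ab in \<open>auto intro: DERIV_cong\<close>)
qed simp

context dunkl begin

text \<open>For \<open>t = 1\<close> this is the inner product of \<open>f\<close> and \<open>H\<close> in the weighted Hilbert space of the unit
sphere, up to the factor in the definition of the spherical integral. The expression
\<open>coef F G 1\<close> is used in that sense below.\<close>

definition coef :: "(real^'n \<Rightarrow> real) \<Rightarrow> (real^'n \<Rightarrow> real) \<Rightarrow> real \<Rightarrow> real" where
  "coef f H t = sphere_integral (\<lambda>y. f (t *\<^sub>R y) * H y * W y)"

lemma continuous_scale: "continuous_on UNIV f \<Longrightarrow> continuous_on UNIV (\<lambda>y::real^'n. f (t *\<^sub>R y))"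
  by (rule continuous_on_compose2[of UNIV f]) (auto intro!: continuous_intros)

lemma coef_integrand_continuous:
  "continuous_on UNIV f \<Longrightarrow> continuous_on UNIV H \<Longrightarrow> continuous_on UNIV (\<lambda>y. f (t *\<^sub>R y) * H y * W y)"
  by (intro continuous_intros continuous_scale W_continuous)

lemma coef_add:
  "continuous_on UNIV f \<Longrightarrow> continuous_on UNIV g \<Longrightarrow> continuous_on UNIV H \<Longrightarrow>
   coef (\<lambda>x. f x + g x) H t = coef f H t + coef g H t"
  unfolding coef_def by (simp add: distrib_right sphere_integral_add coef_integrand_continuous)

lemma coef_diff:
  "continuous_on UNIV f \<Longrightarrow> continuous_on UNIV g \<Longrightarrow> continuous_on UNIV H \<Longrightarrow>
   coef (\<lambda>x. f x - g x) H t = coef f H t - coef g H t"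
  unfolding coef_def by (simp add: left_diff_distrib sphere_integral_diff coef_integrand_continuous)

lemma coef_cmult: "coef (\<lambda>x. c * f x) H t = c * coef f H t"
  unfolding coef_def by (simp add: mult.assoc sphere_integral_cmult)

lemma coef_sum:
  "(\<And>i. i \<in> I \<Longrightarrow> continuous_on UNIV (f i)) \<Longrightarrow> continuous_on UNIV H \<Longrightarrow>
   coef (\<lambda>x. \<Sum>i\<in>I. f i x) H t = (\<Sum>i\<in>I. coef (f i) H t)"
  unfolding coef_def by (simp add: sum_distrib_right sphere_integral_sum coef_integrand_continuous)

text \<open>Homogeneity of \<open>H\<close> and of the weight moves everything but \<open>f\<close> to the unit sphere.\<close>

lemma sphere_integral_radial:
  assumes f: "continuous_on UNIV f" and a: "continuous_on UNIV a" and H: "harmonic m H" and t: "t > 0"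
  shows "sphere_integral (\<lambda>y. f (t *\<^sub>R y) * (a ((t *\<^sub>R y) \<bullet> (t *\<^sub>R y)) * H (t *\<^sub>R y)) * W (t *\<^sub>R y))
     = a (t\<^sup>2) * t ^ m * t powr (2 * \<gamma>) * coef f H t"
proof -
  have h: "hpoly m H" using H by (simp add: harmonic_def)
  have cH: "continuous_on UNIV H" using hpoly_continuous[OF h] .
  have "sphere_integral (\<lambda>y. f (t *\<^sub>R y) * (a ((t *\<^sub>R y) \<bullet> (t *\<^sub>R y)) * H (t *\<^sub>R y)) * W (t *\<^sub>R y))
     = sphere_integral (\<lambda>y. a (t\<^sup>2) * t ^ m * t powr (2 * \<gamma>) * (f (t *\<^sub>R y) * H y * W y))"
  proof (rule sphere_integral_cong)
    fix y :: "real^'n" assume y: "norm y = 1"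
    then have "(t *\<^sub>R y) \<bullet> (t *\<^sub>R y) = t\<^sup>2" by (simp add: power2_eq_square dot_square_norm)
    then show "f (t *\<^sub>R y) * (a ((t *\<^sub>R y) \<bullet> (t *\<^sub>R y)) * H (t *\<^sub>R y)) * W (t *\<^sub>R y) =
        a (t\<^sup>2) * t ^ m * t powr (2 * \<gamma>) * (f (t *\<^sub>R y) * H y * W y)"
      by (simp only: hpoly_scale[OF h] W_scale[OF t] mult_ac)
  next
    show "continuous_on UNIV (\<lambda>y. f (t *\<^sub>R y) * (a ((t *\<^sub>R y) \<bullet> (t *\<^sub>R y)) * H (t *\<^sub>R y)) * W (t *\<^sub>R y))"
      by (intro continuous_intros continuous_scale f cH W_continuous continuous_on_compose2[OF a]) auto
    show "continuous_on UNIV (\<lambda>y. a (t\<^sup>2) * t ^ m * t powr (2 * \<gamma>) * (f (t *\<^sub>R y) * H y * W y))"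
      by (intro continuous_intros coef_integrand_continuous f cH)
  qed
  then show ?thesis by (simp add: sphere_integral_cmult coef_def)
qed

lemma coef_continuous:
  assumes f: "continuous_on UNIV f" and H: "harmonic m H"
  shows "continuous_on {0<..} (coef f H)"
proof -
  have h: "hpoly m H" using H by (simp add: harmonic_def)
  have cH: "continuous_on UNIV H" using hpoly_continuous[OF h] .
  define S where "S t = sphere_integral (\<lambda>y. f (t *\<^sub>R y) * (1 * H (t *\<^sub>R y)) * W (t *\<^sub>R y))" for t
  have "continuous_on UNIV (\<lambda>x. f x * (1 * H x) * W x)" by (intro continuous_intros f cH W_continuous)
  from sphere_integral_scale_continuous[OF this] have cS: "continuous_on UNIV S" unfolding S_def .
  have eq: "S t = t ^ m * t powr (2 * \<gamma>) * coef f H t" if "t > 0" for t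
    using sphere_integral_radial[OF f continuous_on_const[of _ 1] H that] by (simp add: S_def)
  have "continuous_on {0<..} (\<lambda>t. S t / (t ^ m * t powr (2 * \<gamma>)))"
    by (intro continuous_intros continuous_on_subset[OF cS]) auto
  then show ?thesis by (subst continuous_on_cong[OF refl]) (auto simp: eq)
qed

text \<open>Let \<open>K(t) = coef f H t / t\<^sup>m\<close>. As the coefficient of \<open>L f\<close> vanishes, testing the symmetry of \<open>L\<close> with
\<open>\<psi>(\<bar>x\<bar>\<^sup>2) H\<close> gives \<open>\<integral> \<theta> K = 0\<close> whenever \<open>\<theta>\<close> is supported in the interval and has mean zero; here \<open>\<theta>\<close> is the derivative of
\<open>t \<mapsto> t\<^sup>M \<psi>'(t\<^sup>2)\<close>, and the mean has to vanish for \<open>\<psi>\<close> to be constant near zero and to vanish at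
infinity. The choice \<open>\<theta> = (K - c) u\<close> with a bump \<open>u\<close> turns this into \<open>\<integral> (K - c)\<^sup>2 u = 0\<close>.\<close>

lemma coef_const_interval:
  assumes f: "C_class (Suc (Suc 0)) f" and H: "harmonic m H"
    and z: "\<And>t. t > 0 \<Longrightarrow> coef (L f) H t = 0" and ab: "0 < a" "a < b"
  obtains c where "\<And>t. a < t \<Longrightarrow> t < b \<Longrightarrow> coef f H t / t ^ m = c"
proof -
  have h: "hpoly m H" using H by (simp add: harmonic_def)
  have cH: "continuous_on UNIV H" using hpoly_continuous[OF h] .
  have cf: "continuous_on UNIV f" using f by (rule C_class_cont)
  define K where "K t = coef f H t / t ^ m" for t
  have cK: "continuous_on {0<..} K" unfolding K_def
    by (intro continuous_intros coef_continuous[OF cf H]) auto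
  \<comment> \<open>\<open>K\<close> need not be continuous at zero; clamping the argument makes it so without changing it on the interval.\<close>
  define K' where "K' t = K (max a (min b t))" for t
  have cK': "continuous_on UNIV K'" unfolding K'_def
    by (rule continuous_on_compose2[OF cK]) (use ab in \<open>auto intro!: continuous_intros\<close>)
  have K': "K' t = K t" if "a \<le> t" "t \<le> b" for t using that by (simp add: K'_def)
  \<comment> \<open>A bump supported in the interval, and the constant for which the test function has mean zero.\<close>
  define u where "u t = max 0 ((t - a) * (b - t))" for t
  have cu: "continuous_on UNIV u" unfolding u_def by (intro continuous_intros)
  have u0: "u t = 0" if "t \<le> a \<or> b \<le> t" for t
  proof -
    have "(t - a) * (b - t) \<le> 0" using that ab by (auto simp: mult_le_0_iff)
    then show ?thesis by (simp add: u_def)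
  qed
  have unn: "u t \<ge> 0" for t by (simp add: u_def)
  have upos: "u t > 0" if "a < t" "t < b" for t using that by (simp add: u_def)
  have iu: "u integrable_on {a..b}" using cu by (intro integrable_continuous_real continuous_on_subset[OF cu]) auto
  have iKu: "(\<lambda>t. K' t * u t) integrable_on {a..b}"
    by (intro integrable_continuous_real continuous_intros continuous_on_subset[OF cu] continuous_on_subset[OF cK']) auto
  have Iu: "integral {a..b} u \<noteq> 0"
  proof
    assume "integral {a..b} u = 0"
    then have "(u has_integral 0) (cbox a b)" using iu by (metis integrable_integral cbox_interval)
    then have "u ((a + b) / 2) = 0"
      using ab by (intro has_integral_0_cbox_imp_0[of a b u]) (auto intro: continuous_on_subset[OF cu] unn)
    then show False using upos[of "(a + b) / 2"] ab by simp
  qed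
  define c where "c = integral {a..b} (\<lambda>t. K' t * u t) / integral {a..b} u"
  define \<theta> where "\<theta> t = (K' t - c) * u t" for t
  have c\<theta>: "continuous_on UNIV \<theta>" unfolding \<theta>_def by (intro continuous_intros cu cK')
  have \<theta>0: "\<theta> t = 0" if "t \<le> a \<or> b \<le> t" for t using u0[OF that] by (simp add: \<theta>_def)
  have I\<theta>: "(\<theta> has_integral 0) {a..b}"
  proof -
    have "((\<lambda>t. K' t * u t - c * u t) has_integral (integral {a..b} (\<lambda>t. K' t * u t) - c * integral {a..b} u)) {a..b}"
      by (intro has_integral_diff has_integral_mult_right integrable_integral iu iKu)
    then show ?thesis using Iu by (simp add: \<theta>_def[abs_def] c_def left_diff_distrib)
  qed
  obtain \<Theta>0 where "\<And>t. (\<Theta>0 has_real_derivative \<theta> t) (at t)" using antiderivative_exists[OF c\<theta>] by blast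
  then have \<Theta>': "((\<lambda>t. \<Theta>0 t - \<Theta>0 a) has_real_derivative \<theta> t) (at t)" for t
    by (auto intro!: derivative_eq_intros)
  define \<Theta> where "\<Theta> t = \<Theta>0 t - \<Theta>0 a" for t
  have \<Theta>': "(\<Theta> has_real_derivative \<theta> t) (at t)" for t using \<Theta>' unfolding \<Theta>_def .
  have \<Theta>a: "\<Theta> t = 0" if "t \<le> a" for t
    using vanishing_derivative_const[OF \<Theta>', of t a] \<theta>0 that by (simp add: \<Theta>_def)
  have \<Theta>b: "\<Theta> b = 0"
  proof -
    have "(\<theta> has_integral (\<Theta> b - \<Theta> a)) {a..b}"
      using ab \<Theta>' by (intro fundamental_theorem_of_calculus)
        (auto intro: has_field_derivative_at_within simp flip: has_real_derivative_iff_has_vector_derivative)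
    from has_integral_unique[OF this I\<theta>] show ?thesis using \<Theta>a[of a] by simp
  qed
  have \<Theta>b: "\<Theta> t = 0" if "b \<le> t" for t
    using vanishing_derivative_const[OF \<Theta>', of b t] \<theta>0 that \<Theta>b by simp
  have a2: "sqrt s < a" if "s < a\<^sup>2" for s using that ab real_sqrt_less_mono[OF that] by simp
  have b2: "b \<le> sqrt s" if "b\<^sup>2 \<le> s" for s using that ab real_sqrt_le_mono[OF that] by simp
  \<comment> \<open>The radial test function, in terms of the squared radius.\<close>
  define \<psi>1 where "\<psi>1 s = s powr (- M m / 2) * \<Theta> (sqrt s)" for s
  define \<psi>2 where "\<psi>2 s = (if s > 0 then s powr (- M m / 2) * (\<theta> (sqrt s) * (inverse (sqrt s) / 2))
       + (- M m / 2) * s powr (- M m / 2 - 1) * \<Theta> (sqrt s) else 0)" for s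
  have low: "\<psi>1 s = 0" "\<psi>2 s = 0" if "s < a\<^sup>2" for s
    using a2[OF that] \<Theta>a \<theta>0 by (auto simp: \<psi>1_def \<psi>2_def)
  have high: "\<psi>1 s = 0" "\<psi>2 s = 0" if "b\<^sup>2 \<le> s" for s
    using b2[OF that] \<Theta>b \<theta>0 by (auto simp: \<psi>1_def \<psi>2_def)
  have op: "open {..<a\<^sup>2}" "open {0::real<..}" by auto
  have a2pos: "a\<^sup>2 > 0" using ab by simp
  have cov: "{..<a\<^sup>2} \<union> {0::real<..} = UNIV"
  proof -
    have "s < a\<^sup>2 \<or> 0 < s" for s using a2pos by linarith
    then show ?thesis by auto
  qed
  have \<psi>1': "(\<psi>1 has_real_derivative \<psi>2 s) (at s)" for s
  proof (cases "s > 0")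
    case True
    have "((\<lambda>s. \<Theta> (sqrt s)) has_real_derivative \<theta> (sqrt s) * (inverse (sqrt s) / 2)) (at s)"
      by (rule DERIV_chain2[where f=\<Theta> and g=sqrt, OF \<Theta>' DERIV_real_sqrt[OF True]])
    from DERIV_mult[OF has_real_derivative_powr[OF True, of "- M m / 2"] this]
    show ?thesis using True by (simp add: \<psi>1_def[abs_def] \<psi>2_def algebra_simps)
  next
    case False
    then have s: "s < a\<^sup>2" using a2pos by linarith
    have "((\<lambda>s. 0) has_real_derivative \<psi>2 s) (at s)" using low(2)[OF s] by simp
    then show ?thesis
      by (rule has_field_derivative_transform_within_open[OF _ op(1)]) (use s low(1) in auto)
  qed
  have c\<psi>2: "continuous_on UNIV \<psi>2"
  proof -
    have 1: "continuous_on {..<a\<^sup>2} \<psi>2"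
      using low(2) by (subst continuous_on_cong[OF refl, where g="\<lambda>_. 0"]) auto
    have c\<Theta>: "continuous_on UNIV \<Theta>" using \<Theta>' by (rule has_real_derivative_continuous_on)
    have "continuous_on {0<..} (\<lambda>s. s powr (- M m / 2) * (\<theta> (sqrt s) * (inverse (sqrt s) / 2))
       + (- M m / 2) * s powr (- M m / 2 - 1) * \<Theta> (sqrt s))"
      by (intro continuous_intros continuous_on_compose2[OF c\<theta>] continuous_on_compose2[OF c\<Theta>]) auto
    then have 2: "continuous_on {0<..} \<psi>2"
      by (rule continuous_on_eq) (simp add: \<psi>2_def)
    show ?thesis using continuous_on_open_Un[OF op 1 2] cov by simp
  qed
  have c\<psi>1: "continuous_on UNIV \<psi>1" using \<psi>1' by (rule has_real_derivative_continuous_on)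
  obtain \<psi>0 where \<psi>0: "\<And>t. (\<psi>0 has_real_derivative \<psi>1 t) (at t)" using antiderivative_exists[OF c\<psi>1] by blast
  define \<psi> where "\<psi> s = \<psi>0 s - \<psi>0 (b\<^sup>2)" for s
  have \<psi>': "(\<psi> has_real_derivative \<psi>1 t) (at t)" for t
    unfolding \<psi>_def using \<psi>0 by (auto intro!: derivative_eq_intros)
  have c\<psi>: "continuous_on UNIV \<psi>" using \<psi>' by (rule has_real_derivative_continuous_on)
  have \<psi>high: "\<psi> s = 0" if "b\<^sup>2 \<le> s" for s
    using vanishing_derivative_const[OF \<psi>', of "b\<^sup>2" s] high(1) that by (simp add: \<psi>_def)
  have normb: "b\<^sup>2 \<le> x \<bullet> x" if "norm x \<ge> b" for x :: "real^'n"
    using that ab by (simp add: dot_square_norm power_mono)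
  have norma: "x \<bullet> x < a\<^sup>2" if "norm x < a" for x :: "real^'n"
    using that ab by (simp add: dot_square_norm power_strict_mono)
  define g where "g x = \<psi> (x \<bullet> x) * H x" for x
  have g: "C_class (Suc (Suc 0)) g" unfolding g_def
    by (intro C_class_mult C_class_2_radial[OF \<psi>' \<psi>1' c\<psi>2] hpoly_C_class[OF h])
  have gT: "g x = 0" if "norm x > b" for x using that \<psi>high[OF normb, of x] by (simp add: g_def)
  define Z where "Z s = 4 * s * \<psi>2 s + 2 * M m * \<psi>1 s" for s
  have cZ: "continuous_on UNIV Z" unfolding Z_def by (intro continuous_intros c\<psi>1 c\<psi>2)
  have Lg: "L g x = Z (x \<bullet> x) * H x" for x
    unfolding g_def Z_def by (rule L_radial_harmonic[OF H \<psi>' \<psi>1' c\<psi>2])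
  have Zt: "Z (t\<^sup>2) = 2 * t * t powr (- M m) * \<theta> t" if t: "t > 0" for t
  proof -
    define P where "P = t powr (- M m)"
    have sq: "sqrt (t\<^sup>2) = t" "t\<^sup>2 > 0" using t by auto
    have t2: "t\<^sup>2 = t powr 2" using t by (simp add: powr_numeral)
    have p: "(t\<^sup>2) powr (- M m / 2) = P" unfolding t2 powr_powr P_def by simp
    have p': "(t\<^sup>2) powr (- M m / 2 - 1) = P / t\<^sup>2" using sq(2) unfolding p[symmetric] by (simp add: powr_diff)
    have "Z (t\<^sup>2) = 4 * t\<^sup>2 * (P * (\<theta> t * (inverse t / 2)) + (- M m / 2) * (P / t\<^sup>2) * \<Theta> t) + 2 * M m * (P * \<Theta> t)"
      unfolding Z_def \<psi>1_def \<psi>2_def p p' sq(1) using sq(2) by simp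
    also have "\<dots> = 2 * t * P * \<theta> t" using t by (simp add: power2_eq_square field_simps)
    finally show ?thesis unfolding P_def .
  qed
  have "(\<integral>x. L f x * g x * W x \<partial>lborel) = 0"
  proof -
    have cLf: "continuous_on UNIV (L f)" using C_class_dunkl_laplacian[OF f zero_notin_Rp] by (rule C_class_cont)
    have c: "continuous_on UNIV (\<lambda>x. L f x * g x * W x)"
      by (intro continuous_intros cLf C_class_cont[OF g] W_continuous)
    have "(\<integral>x. L f x * g x * W x \<partial>lborel) = (LINT x:ball 0 (b + 1)|lborel. L f x * g x * W x)"
      unfolding set_lebesgue_integral_def using gT
      by (intro Bochner_Integration.integral_cong) (auto simp: indicator_def not_less)
    also have "\<dots> = 0"
      using ab by (intro ball_integral_zero[OF c])
        (auto simp: g_def sphere_integral_radial[OF cLf c\<psi> H] z simp del: inner_scaleR_left inner_scaleR_right)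
    finally show ?thesis .
  qed
  then have I0: "(\<integral>x. f x * (Z (x \<bullet> x) * H x) * W x \<partial>lborel) = 0"
    using L_symmetric[OF f g gT] by (simp add: Lg)
  have cG: "continuous_on UNIV (\<lambda>x. f x * (Z (x \<bullet> x) * H x) * W x)"
    by (intro continuous_intros cf cH W_continuous continuous_on_compose2[OF cZ]) auto
  have Zz: "Z (x \<bullet> x) = 0" if "norm x < a \<or> b \<le> norm x" for x :: "real^'n"
    using that low[OF norma] high[OF normb] by (auto simp: Z_def)
  have "((\<lambda>t. real CARD('n) * t ^ (CARD('n) - 1) * sphere_integral (\<lambda>y. f (t *\<^sub>R y) * (Z ((t *\<^sub>R y) \<bullet> (t *\<^sub>R y)) * H (t *\<^sub>R y)) * W (t *\<^sub>R y)))
      has_integral 0) {a..b}"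
    using polar_integral[OF cG ab(1) less_imp_le[OF ab(2)]] Zz unfolding I0 by simp
  then have "((\<lambda>t. 2 * real CARD('n) * (\<theta> t * K t)) has_integral 0) {a..b}"
  proof (rule has_integral_eq[rotated])
    fix t assume "t \<in> {a..b}"
    then have t: "t > 0" using ab by simp
    obtain n where n: "CARD('n) = Suc n" by (metis zero_less_card_finite gr0_implies_Suc)
    have cK: "coef f H t = t ^ m * K t" using t by (simp add: K_def)
    have "t powr M m = t powr (real (2 * m)) * (t powr real (Suc n) * t powr (2 * \<gamma>))"
      unfolding M_def n by (simp add: powr_add mult_ac)
    also have "\<dots> = t ^ (2 * m) * (t ^ Suc n * t powr (2 * \<gamma>))"
      using t by (simp only: powr_realpow)
    finally have pM: "t powr M m = t ^ (2 * m) * (t ^ Suc n * t powr (2 * \<gamma>))" .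
    have "t ^ (2 * m) = t ^ m * t ^ m" by (simp only: mult_2 power_add)
    then have pw: "t powr (- M m) = 1 / (t ^ m * t ^ m * (t ^ n * t) * t powr (2 * \<gamma>))"
      unfolding powr_minus pM by (simp add: divide_inverse mult.assoc mult.commute[of t])
    define q where "q = t powr (2 * \<gamma>)"
    have q: "q > 0" using t by (simp add: q_def)
    show "real CARD('n) * t ^ (CARD('n) - 1) * sphere_integral (\<lambda>y. f (t *\<^sub>R y) * (Z ((t *\<^sub>R y) \<bullet> (t *\<^sub>R y)) * H (t *\<^sub>R y)) * W (t *\<^sub>R y))
       = 2 * real CARD('n) * (\<theta> t * K t)"
      unfolding sphere_integral_radial[OF cf cZ H t] Zt[OF t] cK pw n q_def[symmetric] using t q
      by (simp add: field_simps)
  qed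
  from has_integral_mult_right[OF this, of "1 / (2 * real CARD('n))"]
  have "((\<lambda>t. \<theta> t * K t) has_integral 0) {a..b}" by simp
  from has_integral_diff[OF this has_integral_mult_right[OF I\<theta>, of c]]
  have "((\<lambda>t. \<theta> t * K t - c * \<theta> t) has_integral 0) (cbox a b)" by simp
  then have "((\<lambda>t. (K' t - c)\<^sup>2 * u t) has_integral 0) (cbox a b)"
    by (rule has_integral_eq[rotated]) (auto simp: \<theta>_def K' power2_eq_square algebra_simps)
  moreover have "continuous_on (cbox a b) (\<lambda>t. (K' t - c)\<^sup>2 * u t)"
    by (intro continuous_intros continuous_on_subset[OF cu] continuous_on_subset[OF cK']) auto
  ultimately have "(K' t - c)\<^sup>2 * u t = 0" if "a < t" "t < b" for t
    using that ab by (intro has_integral_0_cbox_imp_0[of a b "\<lambda>t. (K' t - c)\<^sup>2 * u t"]) (auto simp: unn)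
  then have "K t = c" if "a < t" "t < b" for t using that upos[OF that] K'[of t] by fastforce
  then show ?thesis using that unfolding K_def by blast
qed

lemma coef_of_harmonic_laplacian:
  assumes f: "C_class (Suc (Suc 0)) f" and H: "harmonic m H"
    and z: "\<And>t. t > 0 \<Longrightarrow> coef (L f) H t = 0" and t: "t > 0"
  shows "coef f H t = coef f H 1 * t ^ m"
proof -
  obtain c where c: "\<And>s. min t 1 / 2 < s \<Longrightarrow> s < max t 1 + 1 \<Longrightarrow> coef f H s / s ^ m = c"
    by (rule coef_const_interval[OF f H z, of "min t 1 / 2" "max t 1 + 1"]) (use t in auto)
  have "coef f H t / t ^ m = c" "coef f H 1 / 1 ^ m = c" using c[of t] c[of 1] t by auto
  then show ?thesis using t by (auto simp: field_simps)
qed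

text \<open>A function of norm zero vanishes almost everywhere for the weight, so its inner product with
any function is zero.\<close>

lemma coef_self_zero:
  assumes f: "continuous_on UNIV f" and H: "continuous_on UNIV H" and z: "coef H H 1 = 0"
  shows "coef f H t = 0"
proof -
  have "AE x in lborel. x \<in> ball 0 1 \<longrightarrow> H (sgn x) * H (sgn x) * W (sgn x) = 0"
    using sphere_integral_eq_0D[of "\<lambda>y. H y * H y * W y"] coef_integrand_continuous[OF H H, of 1] z W_nonneg
    by (simp add: coef_def)
  then have "AE x\<in>ball 0 1 in lborel. f (t *\<^sub>R sgn x) * H (sgn x) * W (sgn x) = 0"
    by (rule eventually_mono) auto
  then show ?thesis unfolding coef_def sphere_integral_def set_lebesgue_integral_def
    by (intro integral_eq_zero_AE) (auto elim!: eventually_mono simp: indicator_def)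
qed

lemma coef_power_harmonic:
  assumes H: "harmonic m H" and G: "harmonic l G" and t: "t > 0"
  shows "coef (\<lambda>x. (x \<bullet> x) ^ j * G x) H t = t ^ (2 * j + l) * coef G H 1"
proof -
  have h: "hpoly l G" "hpoly m H" using G H by (simp_all add: harmonic_def)
  have "coef (\<lambda>x. (x \<bullet> x) ^ j * G x) H t = sphere_integral (\<lambda>y. t ^ (2 * j + l) * (G y * H y * W y))"
    unfolding coef_def
  proof (rule sphere_integral_cong)
    fix y :: "real^'n" assume y: "norm y = 1"
    then have "(t *\<^sub>R y) \<bullet> (t *\<^sub>R y) = t\<^sup>2" by (simp add: power2_eq_square dot_square_norm)
    then show "((t *\<^sub>R y) \<bullet> (t *\<^sub>R y)) ^ j * G (t *\<^sub>R y) * H y * W y = t ^ (2 * j + l) * (G y * H y * W y)"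
      by (simp only: hpoly_scale[OF h(1)]) (simp add: power_add power_mult)
  qed (intro continuous_intros continuous_scale hpoly_continuous[OF h(1)] hpoly_continuous[OF h(2)] W_continuous)+
  then show ?thesis by (simp add: sphere_integral_cmult coef_def)
qed

text \<open>Let \<open>P\<close> be the combination of the functions \<open>\<bar>x\<bar>\<close> to the power \<open>2 (j + 1)\<close> times \<open>H\<close> for which \<open>L P\<close> has
the same coefficient with respect to \<open>H\<close> as \<open>L f\<close>. Then \<open>f - P\<close> falls under the case of a
vanishing right-hand side.\<close>

theorem coef_polyharmonic:
  assumes H: "harmonic m H"
  shows "C_class (2 * p) f \<Longrightarrow> (\<And>x. (L ^^ p) f x = 0) \<Longrightarrow>
     \<exists>c. \<forall>t>0. coef f H t = (\<Sum>j<p. c j * t ^ (m + 2 * j))"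
proof (induction p arbitrary: f)
  case 0
  then have "f = (\<lambda>x. 0)" by auto
  then show ?case by (simp add: coef_def)
next
  case (Suc p)
  have h: "hpoly m H" using H by (simp add: harmonic_def)
  have cH: "continuous_on UNIV H" using hpoly_continuous[OF h] .
  have f: "C_class (Suc (Suc (2 * p))) f" using Suc.prems(1) by simp
  have f2: "C_class (Suc (Suc 0)) f" using f by (rule C_class_mono) simp
  have Lf: "C_class (2 * p) (L f)" using C_class_dunkl_laplacian[OF f zero_notin_Rp] .
  have cf: "continuous_on UNIV f" "continuous_on UNIV (L f)" using f2 Lf C_class_cont by blast+
  have "(L ^^ p) (L f) x = 0" for x using Suc.prems(2)[of x] by (simp add: funpow_swap1)
  from Suc.IH[OF Lf this] obtain c where c: "\<And>t. t > 0 \<Longrightarrow> coef (L f) H t = (\<Sum>j<p. c j * t ^ (m + 2 * j))" by blast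
  define s where "s = coef H H 1"
  show ?case
  proof (cases "s = 0")
    case True
    then have "coef f H t = 0" for t using coef_self_zero[OF cf(1) cH] by (simp add: s_def)
    then show ?thesis by (intro exI[of _ "\<lambda>_. 0"]) simp
  next
    case False
    define k where "k j = 2 * real (Suc j) * (2 * real j + M m)" for j
    have k: "k j > 0" for j using M_pos[of m] unfolding k_def by (intro mult_pos_pos add_nonneg_pos) auto
    \<comment> \<open>\<open>k j\<close> is the factor in \<open>L (\<bar>x\<bar>\<^sup>2\<^sup>j\<^sup>+\<^sup>2 H) = k j \<bar>x\<bar>\<^sup>2\<^sup>j H\<close>, and \<open>s\<close> the squared norm of \<open>H\<close>.\<close>
    define d where "d j = c j / (s * k j)" for j
    define P where "P x = (\<Sum>j<p. d j * ((x \<bullet> x) ^ Suc j * H x))" for x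
    have t: "C_class (Suc (Suc 0)) (\<lambda>x. (x \<bullet> x) ^ Suc j * H x)" for j
      by (rule hpoly_C_class[OF hpoly_mult[OF hpoly_radial h]])
    have t0: "continuous_on UNIV (\<lambda>x. (x \<bullet> x) ^ j * H x)" for j
      by (rule hpoly_continuous[OF hpoly_mult[OF hpoly_radial h]])
    have P: "C_class (Suc (Suc 0)) P" unfolding P_def by (intro C_class_sum C_class_cmult t)
    have LP: "L P = (\<lambda>x. \<Sum>j<p. (d j * k j) * ((x \<bullet> x) ^ j * H x))"
    proof
      fix x
      have "L P x = (\<Sum>j<p. L (\<lambda>x. d j * ((x \<bullet> x) ^ Suc j * H x)) x)"
        unfolding P_def[abs_def] by (rule L_sum) (intro C_class_cmult t)
      also have "\<dots> = (\<Sum>j<p. (d j * k j) * ((x \<bullet> x) ^ j * H x))"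
        unfolding L_cmult[OF t] L_power_harmonic[OF H] by (simp add: k_def mult_ac)
      finally show "L P x = (\<Sum>j<p. (d j * k j) * ((x \<bullet> x) ^ j * H x))" .
    qed
    have "coef (L (\<lambda>x. f x - P x)) H t = 0" if t0': "t > 0" for t
    proof -
      have "L (\<lambda>x. f x - P x) = (\<lambda>x. L f x - L P x)" by (rule ext) (rule L_diff[OF f2 P])
      then have "coef (L (\<lambda>x. f x - P x)) H t = coef (L f) H t - coef (L P) H t"
        by (simp add: coef_diff cf cH C_class_cont[OF C_class_dunkl_laplacian[OF P zero_notin_Rp]])
      also have "coef (L P) H t = (\<Sum>j<p. (d j * k j) * (t ^ (2 * j + m) * s))"
        unfolding LP s_def
        by (subst coef_sum) (auto intro!: continuous_intros t0 cH simp: coef_cmult coef_power_harmonic[OF H H t0'])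
      also have "\<dots> = coef (L f) H t"
        unfolding c[OF t0'] using False k by (intro sum.cong) (auto simp: d_def add.commute less_imp_neq[symmetric])
      finally show ?thesis by simp
    qed
    from coef_of_harmonic_laplacian[OF C_class_diff[OF f2 P] H this]
    have e: "coef (\<lambda>x. f x - P x) H t = coef (\<lambda>x. f x - P x) H 1 * t ^ m" if "t > 0" for t using that by blast
    define c' where "c' j = (case j of 0 \<Rightarrow> coef (\<lambda>x. f x - P x) H 1 | Suc j \<Rightarrow> d j * s)" for j
    have "coef f H t = (\<Sum>j<Suc p. c' j * t ^ (m + 2 * j))" if t0': "t > 0" for t
    proof -
      have "coef f H t = coef (\<lambda>x. f x - P x) H t + coef P H t"
        by (simp add: coef_diff cf cH C_class_cont[OF P])
      also have "coef P H t = (\<Sum>j<p. d j * (t ^ (2 * Suc j + m) * s))"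
        unfolding P_def s_def
        by (subst coef_sum) (auto intro!: continuous_intros t0 cH simp: coef_cmult coef_power_harmonic[OF H H t0'] simp del: power_Suc mult_Suc_right)
      finally show ?thesis unfolding sum.lessThan_Suc_shift e[OF t0']
        by (simp add: c'_def add_ac mult_ac)
    qed
    then show ?thesis by blast
  qed
qed

text \<open>The coefficient \<open>coef G H t\<close> is proportional to \<open>t\<close> to the power \<open>l\<close> by homogeneity of \<open>G\<close>, and to
\<open>t\<^sup>m\<close> because \<open>L G = 0\<close>. The radii 1 and 2 tell these apart.\<close>

lemma harmonic_orthogonal:
  assumes H: "harmonic m H" and G: "harmonic l G" and ne: "l \<noteq> m"
  shows "coef G H 1 = 0"
proof -
  have g: "hpoly l G" using G by (simp add: harmonic_def)
  have "L G = (\<lambda>x. 0)" using G by (auto simp: harmonic_def)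
  then have "coef (L G) H t = 0" for t by (simp add: coef_def)
  then have "coef G H 2 = coef G H 1 * 2 ^ m"
    by (intro coef_of_harmonic_laplacian[OF hpoly_C_class[OF g] H]) auto
  moreover have "coef G H 2 = 2 ^ l * coef G H 1"
    using coef_power_harmonic[OF H G, of 2 0] by simp
  ultimately have "coef G H 1 = 0 \<or> (2::real) ^ l = 2 ^ m" by auto
  then show ?thesis using ne by simp
qed

end

section \<open>Monomials and polynomials\<close>

definition monomial :: "nat^'n \<Rightarrow> real^'n \<Rightarrow> real" where
  "monomial \<alpha> x = (\<Prod>i\<in>UNIV. (x $ i) ^ (\<alpha> $ i))"

definition total_degree :: "nat^'n \<Rightarrow> nat" where
  "total_degree \<alpha> = (\<Sum>i\<in>UNIV. \<alpha> $ i)"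

lemma hpoly_coord_power: "hpoly k (\<lambda>x. (x $ i) ^ k)"
proof (induction k)
  case 0 then show ?case using hpoly_const[of 1] by simp
next
  case (Suc k) then show ?case using hpoly_coord[OF Suc, of i] by simp
qed

lemma hpoly_monomial: "hpoly (total_degree \<alpha>) (monomial \<alpha>)"
proof -
  have "hpoly (\<Sum>i\<in>I. \<alpha> $ i) (\<lambda>x. \<Prod>i\<in>I. (x $ i) ^ (\<alpha> $ i))" for I
  proof (induction I rule: infinite_finite_induct)
    case (insert i I)
    then show ?case using hpoly_mult[OF hpoly_coord_power[of "\<alpha> $ i" i] insert.IH] by simp
  qed (use hpoly_const[of 1] in simp_all)
  then show ?thesis unfolding total_degree_def monomial_def[abs_def] .
qed

lemma coord_mult_monomial: "x $ i * monomial \<alpha> x = monomial (\<alpha> + axis i 1) x"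
proof -
  have "monomial (\<alpha> + axis i 1) x = (\<Prod>j\<in>UNIV. (x $ j) ^ (\<alpha> $ j) * (if j = i then x $ j else 1))"
    unfolding monomial_def by (intro prod.cong) (auto simp: axis_def)
  then show ?thesis by (simp add: prod.distrib monomial_def)
qed

lemma total_degree_add_axis: "total_degree (\<alpha> + axis i 1) = Suc (total_degree \<alpha>)"
proof -
  have "total_degree (\<alpha> + axis i 1) = total_degree \<alpha> + (\<Sum>j\<in>UNIV. if j = i then 1 else 0)"
    unfolding total_degree_def by (simp add: sum.distrib axis_def)
  then show ?thesis by simp
qed

text \<open>Homogeneous polynomials again, generated by monomials. This form connects the inductive predicate
for homogeneous polynomials with families of coefficients.\<close>

inductive monomial_sum :: "nat \<Rightarrow> (real^'n \<Rightarrow> real) \<Rightarrow> bool" where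
  monomial_sum_base: "total_degree \<alpha> = k \<Longrightarrow> monomial_sum k (\<lambda>x. c * monomial \<alpha> x)"
| monomial_sum_add: "monomial_sum k q \<Longrightarrow> monomial_sum k q' \<Longrightarrow> monomial_sum k (\<lambda>x. q x + q' x)"

lemma monomial_sum_coord: "monomial_sum k q \<Longrightarrow> monomial_sum (Suc k) (\<lambda>x. x $ i * q x)"
proof (induction rule: monomial_sum.induct)
  case (monomial_sum_base \<alpha> k c)
  have "(\<lambda>x. x $ i * (c * monomial \<alpha> x)) = (\<lambda>x. c * monomial (\<alpha> + axis i 1) x)"
    by (rule ext) (simp only: coord_mult_monomial[symmetric] mult_ac)
  moreover have "total_degree (\<alpha> + axis i 1) = Suc k" using monomial_sum_base by (simp only: total_degree_add_axis)
  ultimately show ?case using monomial_sum.monomial_sum_base by metis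
next
  case (monomial_sum_add k q q')
  then show ?case using monomial_sum.monomial_sum_add[OF monomial_sum_add.IH] by (simp add: distrib_left)
qed

lemma hpoly_monomial_sum: "hpoly k q \<Longrightarrow> monomial_sum k q"
proof (induction rule: hpoly.induct)
  case (hpoly_const c)
  have "total_degree (0 :: nat^'a) = 0" by (simp add: total_degree_def)
  from monomial_sum_base[OF this, of c] show ?case by (simp add: monomial_def)
qed (auto intro: monomial_sum_coord monomial_sum_add)

lemma mpoly_fun_superset:
  fixes P :: "'n::finite mpolynomial"
  assumes "finite A" "Poly_Mapping.keys P \<subseteq> A"
  shows "mpoly_fun P x = (\<Sum>\<alpha>\<in>A. Poly_Mapping.lookup P \<alpha> * monomial \<alpha> x)"
  unfolding mpoly_fun_def monomial_def[symmetric]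
  using assms by (intro sum.mono_neutral_left) (auto simp: in_keys_iff)

lemma mpoly_fun_add: "mpoly_fun (P + Q) x = mpoly_fun P x + mpoly_fun Q x"
proof -
  let ?A = "Poly_Mapping.keys P \<union> Poly_Mapping.keys Q"
  have "Poly_Mapping.keys (P + Q) \<subseteq> ?A" by (rule Poly_Mapping.keys_add)
  then show ?thesis
    by (simp add: mpoly_fun_superset[of ?A] lookup_add distrib_right sum.distrib)
qed

definition poly_of_degree_le :: "nat \<Rightarrow> (real^'n \<Rightarrow> real) \<Rightarrow> bool" where
  "poly_of_degree_le s q \<longleftrightarrow> (\<exists>P. q = mpoly_fun P \<and> (\<forall>\<alpha>\<in>Poly_Mapping.keys P. total_degree \<alpha> \<le> s))"

lemma poly_of_degree_le_add:
  assumes "poly_of_degree_le s q" "poly_of_degree_le s q'"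
  shows "poly_of_degree_le s (\<lambda>x. q x + q' x)"
proof -
  obtain P Q where P: "q = mpoly_fun P" "\<forall>\<alpha>\<in>Poly_Mapping.keys P. total_degree \<alpha> \<le> s"
    and Q: "q' = mpoly_fun Q" "\<forall>\<alpha>\<in>Poly_Mapping.keys Q. total_degree \<alpha> \<le> s"
    using assms unfolding poly_of_degree_le_def by blast
  have "(\<lambda>x. q x + q' x) = mpoly_fun (P + Q)" using P Q by (auto simp: mpoly_fun_add)
  moreover have "\<forall>\<alpha>\<in>Poly_Mapping.keys (P + Q). total_degree \<alpha> \<le> s"
    using Poly_Mapping.keys_add[of P Q] P Q by blast
  ultimately show ?thesis unfolding poly_of_degree_le_def by blast
qed

lemma poly_of_degree_le_zero: "poly_of_degree_le s (\<lambda>x. 0)"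
  unfolding poly_of_degree_le_def by (rule exI[of _ 0]) (auto simp: mpoly_fun_def)

lemma poly_of_degree_le_sum:
  "(\<And>i. i \<in> I \<Longrightarrow> poly_of_degree_le s (q i)) \<Longrightarrow> poly_of_degree_le s (\<lambda>x. \<Sum>i\<in>I. q i x)"
  by (induction I rule: infinite_finite_induct) (auto intro: poly_of_degree_le_add poly_of_degree_le_zero)

lemma poly_of_degree_le_hpoly:
  assumes "hpoly k q" "k \<le> s"
  shows "poly_of_degree_le s q"
  using hpoly_monomial_sum[OF assms(1)] assms(2)
proof (induction rule: monomial_sum.induct)
  case (monomial_sum_base \<alpha> k c)
  have "(\<lambda>x. c * monomial \<alpha> x) = mpoly_fun (Poly_Mapping.single \<alpha> c)"
    by (rule ext, subst mpoly_fun_superset[of "{\<alpha>}"]) auto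
  moreover have "\<forall>\<beta>\<in>Poly_Mapping.keys (Poly_Mapping.single \<alpha> c). total_degree \<beta> \<le> s"
    using monomial_sum_base by (auto split: if_splits)
  ultimately show ?case unfolding poly_of_degree_le_def by blast
qed (auto intro: poly_of_degree_le_add)

lemma finite_total_degree_le: "finite {\<alpha> :: nat^'n. total_degree \<alpha> \<le> s}"
proof -
  have "{\<alpha> :: nat^'n. total_degree \<alpha> \<le> s} \<subseteq> vec_lambda ` (PiE UNIV (\<lambda>_. {..s}))"
  proof
    fix \<alpha> :: "nat^'n" assume "\<alpha> \<in> {\<alpha>. total_degree \<alpha> \<le> s}"
    then have "\<alpha> $ i \<le> s" for i
      using member_le_sum[of i UNIV "\<lambda>i. \<alpha> $ i"] by (auto simp: total_degree_def)
    then have "vec_nth \<alpha> \<in> PiE UNIV (\<lambda>_. {..s})" by auto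
    then show "\<alpha> \<in> vec_lambda ` (PiE UNIV (\<lambda>_. {..s}))" by (metis image_eqI vec_nth_inverse)
  qed
  then show ?thesis by (rule finite_subset) (intro finite_imageI finite_PiE, auto)
qed

text \<open>Polynomials as sums of homogeneous ones, the form in which the polynomials of the
Stone--Weierstrass theorem meet the Fischer decomposition.\<close>

inductive graded_poly :: "(real^'n \<Rightarrow> real) \<Rightarrow> bool" where
  graded_poly_base: "hpoly k q \<Longrightarrow> graded_poly q"
| graded_poly_add: "graded_poly q \<Longrightarrow> graded_poly q' \<Longrightarrow> graded_poly (\<lambda>x. q x + q' x)"

lemma graded_poly_hpoly_mult: "graded_poly q' \<Longrightarrow> hpoly k q \<Longrightarrow> graded_poly (\<lambda>x. q x * q' x)"
proof (induction rule: graded_poly.induct)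
  case (graded_poly_base l q')
  then show ?case using hpoly_mult graded_poly.graded_poly_base by blast
next
  case (graded_poly_add q1 q2)
  then show ?case using graded_poly.graded_poly_add[OF graded_poly_add.IH] by (simp add: distrib_left)
qed

lemma graded_poly_mult: "graded_poly q \<Longrightarrow> graded_poly q' \<Longrightarrow> graded_poly (\<lambda>x. q x * q' x)"
proof (induction rule: graded_poly.induct)
  case (graded_poly_base l q)
  then show ?case using graded_poly_hpoly_mult by blast
next
  case (graded_poly_add q1 q2)
  then show ?case using graded_poly.graded_poly_add[OF graded_poly_add.IH] by (simp add: distrib_right)
qed

lemma graded_poly_continuous: "graded_poly q \<Longrightarrow> continuous_on UNIV q"
  by (induction rule: graded_poly.induct) (auto intro: hpoly_continuous continuous_on_add)

lemma real_polynomial_function_graded_poly: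
  fixes q :: "real^'n \<Rightarrow> real"
  shows "real_polynomial_function q \<Longrightarrow> graded_poly q"
proof (induction rule: real_polynomial_function.induct)
  case (linear q)
  define u where "u = (\<chi> i. q (axis i 1))"
  have "q = (\<lambda>x. (x \<bullet> u) * 1)"
  proof
    fix x :: "real^'n"
    have "(\<Sum>i\<in>UNIV. x $ i *\<^sub>R axis i 1) = x"
      by (simp add: vec_eq_iff axis_def if_distrib cong: if_cong)
    then have "q x = q (\<Sum>i\<in>UNIV. x $ i *\<^sub>R axis i 1)" by simp
    also have "\<dots> = (\<Sum>i\<in>UNIV. x $ i * q (axis i 1))"
      using bounded_linear.linear[OF linear] by (simp add: linear_sum linear_scale)
    finally show "q x = (x \<bullet> u) * 1" by (simp add: inner_vec_def u_def)
  qed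
  then show ?case using hpoly_inner[OF hpoly_const[of 1], of u] graded_poly_base by metis
next
  case (const c)
  show ?case by (rule graded_poly_base[OF hpoly_const])
qed (auto intro: graded_poly_add graded_poly_mult)

context dunkl begin

section \<open>Expansion on the unit sphere\<close>

lemma harmonic_hpoly: "harmonic m H \<Longrightarrow> hpoly m H" by (simp add: harmonic_def)

lemma harmonic_continuous: "harmonic m H \<Longrightarrow> continuous_on S H"
  using hpoly_continuous harmonic_hpoly by blast

lemma harmonic_cmult: "harmonic m H \<Longrightarrow> harmonic m (\<lambda>x. c * H x)"
  using hpoly_cmult[of m H c] L_cmult[OF hpoly_C_class[of m H], of c] by (simp add: harmonic_def)

lemma harmonic_diff: "harmonic m H \<Longrightarrow> harmonic m G \<Longrightarrow> harmonic m (\<lambda>x. H x - G x)"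
  using hpoly_diff[of m H G] L_diff[OF hpoly_C_class[of m H] hpoly_C_class[of m G]] by (simp add: harmonic_def)

lemma harmonic_sum: "(\<And>i. i \<in> I \<Longrightarrow> harmonic m (H i)) \<Longrightarrow> harmonic m (\<lambda>x. \<Sum>i\<in>I. H i x)"
  using hpoly_sum[of I m H] L_sum[of I H] by (auto simp: harmonic_def intro!: hpoly_C_class simp del: C_class.simps)

lemma coef_sym: "coef F G 1 = coef G F 1"
  by (simp add: coef_def mult.commute)

lemma coef_scale: "coef (\<lambda>x. f (t *\<^sub>R x)) H 1 = coef f H t"
  by (simp add: coef_def)

lemma coef_self_nonneg: "continuous_on UNIV F \<Longrightarrow> coef F F 1 \<ge> 0"
  unfolding coef_def using W_nonneg coef_integrand_continuous[of F F 1]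
  by (intro sphere_integral_nonneg) auto

lemma coef_radial_power:
  assumes "continuous_on UNIV G" "continuous_on UNIV H"
  shows "coef (\<lambda>x. (x \<bullet> x) ^ j * G x) H 1 = coef G H 1"
  unfolding coef_def
  by (rule sphere_integral_cong) (auto simp: dot_square_norm intro!: continuous_intros assms W_continuous)

lemma coef_sum_radial_power:
  assumes "\<And>i. i \<in> I \<Longrightarrow> continuous_on UNIV (h i)" "continuous_on UNIV G"
  shows "coef (\<lambda>x. \<Sum>i\<in>I. (x \<bullet> x) ^ i * h i x) G 1 = (\<Sum>i\<in>I. coef (h i) G 1)"
proof -
  have "coef (\<lambda>x. \<Sum>i\<in>I. (x \<bullet> x) ^ i * h i x) G 1 = (\<Sum>i\<in>I. coef (\<lambda>x. (x \<bullet> x) ^ i * h i x) G 1)"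
    by (rule coef_sum) (intro continuous_intros assms, assumption?)+
  also have "\<dots> = (\<Sum>i\<in>I. coef (h i) G 1)"
    by (intro sum.cong refl coef_radial_power assms)
  finally show ?thesis .
qed

text \<open>Gram--Schmidt. The given functions may be linearly dependent; a new function whose remainder has
norm zero contributes nothing.\<close>

lemma orthonormalization:
  "finite U \<Longrightarrow> (\<And>u. u \<in> U \<Longrightarrow> harmonic m u) \<Longrightarrow>
   \<exists>E. finite E \<and> (\<forall>e\<in>E. harmonic m e) \<and>
     (\<forall>F. continuous_on UNIV F \<longrightarrow> (\<forall>u\<in>U \<union> E. coef (\<lambda>x. F x - (\<Sum>e\<in>E. coef F e 1 * e x)) u 1 = 0))"
proof (induction U rule: finite_induct)
  case empty
  show ?case by (rule exI[of _ "{}"]) auto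
next
  case (insert z U)
  then obtain E where E: "finite E" "\<And>e. e \<in> E \<Longrightarrow> harmonic m e"
    "\<And>F u. continuous_on UNIV F \<Longrightarrow> u \<in> U \<union> E \<Longrightarrow> coef (\<lambda>x. F x - (\<Sum>e\<in>E. coef F e 1 * e x)) u 1 = 0"
    by auto
  have hz: "harmonic m z" using insert.prems by simp
  have cE: "continuous_on UNIV e" if "e \<in> E" for e using harmonic_continuous[OF E(2)[OF that]] .
  have cE': "continuous_on UNIV (\<lambda>x. c * e x)" if "e \<in> E" for c e
    by (intro continuous_intros cE that)
  have cz: "continuous_on UNIV z" using harmonic_continuous[OF hz] .
  have cU: "continuous_on UNIV u" if "u \<in> U" for u using that insert.prems harmonic_continuous by blast
  define pr where "pr F x = (\<Sum>e\<in>E. coef F e 1 * e x)" for F :: "real^'n \<Rightarrow> real" and x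
  have cpr: "continuous_on UNIV (pr F)" for F unfolding pr_def by (intro continuous_intros cE)
  have E3: "coef (\<lambda>x. F x - pr F x) u 1 = 0" if "continuous_on UNIV F" "u \<in> U \<union> E" for F u
    unfolding pr_def by (rule E(3)[OF that])
  define z' where "z' x = z x - pr z x" for x
  have hz': "harmonic m z'" unfolding z'_def pr_def by (intro harmonic_diff hz harmonic_sum harmonic_cmult E(2))
  have cz': "continuous_on UNIV z'" using harmonic_continuous[OF hz'] .
  have zo: "coef z' u 1 = 0" if "u \<in> U \<union> E" for u unfolding z'_def by (rule E3[OF cz that])
  have split: "coef z G 1 = coef z' G 1 + (\<Sum>e\<in>E. coef z e 1 * coef e G 1)" if G: "continuous_on UNIV G" for G
  proof -
    have "coef z' G 1 = coef z G 1 - coef (pr z) G 1"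
      unfolding z'_def by (rule coef_diff[OF cz cpr G])
    also have "coef (pr z) G 1 = (\<Sum>e\<in>E. coef z e 1 * coef e G 1)"
      unfolding pr_def by (subst coef_sum) (auto intro: cE' G simp: coef_cmult)
    finally show ?thesis by simp
  qed
  define s where "s = coef z' z' 1"
  show ?case
  proof (cases "s = 0")
    case True
    have "coef (\<lambda>x. F x - pr F x) z 1 = 0" if F: "continuous_on UNIV F" for F
    proof -
      have c: "continuous_on UNIV (\<lambda>x. F x - pr F x)" by (intro continuous_intros F cpr)
      have "coef (\<lambda>x. F x - pr F x) z' 1 = 0" using coef_self_zero[OF c cz'] True by (simp add: s_def)
      moreover have "coef e (\<lambda>x. F x - pr F x) 1 = 0" if "e \<in> E" for e
        using E3[OF F, of e] that by (simp add: coef_sym)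
      ultimately show ?thesis using split[OF c] by (simp add: coef_sym)
    qed
    then show ?thesis using E E3 unfolding pr_def by (intro exI[of _ E]) auto
  next
    case False
    then have s: "s > 0" using coef_self_nonneg[OF cz'] by (simp add: s_def)
    define w where "w x = (1 / sqrt s) * z' x" for x
    have hw: "harmonic m w" unfolding w_def by (rule harmonic_cmult[OF hz'])
    have cw: "continuous_on UNIV w" using harmonic_continuous[OF hw] .
    have wl: "coef w G 1 = (1 / sqrt s) * coef z' G 1" for G unfolding w_def by (rule coef_cmult)
    have wo: "coef w u 1 = 0" if "u \<in> U \<union> E" for u by (simp add: wl zo[OF that])
    have "coef z' w 1 = (1 / sqrt s) * s" unfolding coef_sym[of z' w] wl s_def ..
    then have z'w: "coef z' w 1 = sqrt s" using s by (simp add: real_div_sqrt)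
    have ww: "coef w w 1 = 1" using s by (simp add: wl z'w)
    have wE: "w \<notin> E" using wo ww by fastforce
    have main: "coef (\<lambda>x. F x - (\<Sum>e\<in>insert w E. coef F e 1 * e x)) u 1 = 0"
      if F: "continuous_on UNIV F" and u: "u \<in> insert z U \<union> insert w E" for F u
    proof -
      define d where "d x = F x - (\<Sum>e\<in>insert w E. coef F e 1 * e x)" for x
      have d: "d = (\<lambda>x. (F x - pr F x) - coef F w 1 * w x)"
        using E(1) wE by (auto simp: d_def pr_def)
      have cd: "continuous_on UNIV d" unfolding d by (intro continuous_intros F cpr cw)
      have dl: "coef d G 1 = coef (\<lambda>x. F x - pr F x) G 1 - coef F w 1 * coef w G 1" if G: "continuous_on UNIV G" for G
        unfolding d by (subst coef_diff) (auto intro!: continuous_intros F cpr cw G simp: coef_cmult)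
      have d1: "coef d u 1 = 0" if "u \<in> U \<union> E" for u
        using that cU cE by (auto simp: dl E3[OF F] wo)
      have d2: "coef d w 1 = 0"
      proof -
        have "coef (\<lambda>x. F x - pr F x) w 1 = coef F w 1 - coef (pr F) w 1" by (rule coef_diff[OF F cpr cw])
        also have "coef (pr F) w 1 = (\<Sum>e\<in>E. coef F e 1 * coef e w 1)"
          unfolding pr_def by (subst coef_sum) (auto intro: cE' cw simp: coef_cmult)
        also have "\<dots> = 0" using wo by (intro sum.neutral) (auto simp: coef_sym[of _ w])
        finally show ?thesis by (simp add: dl[OF cw] ww)
      qed
      have d3: "coef d z 1 = 0"
      proof -
        have "coef z' d 1 = sqrt s * coef w d 1" using s by (simp add: wl)
        then show ?thesis using split[OF cd] d1 d2 by (simp add: coef_sym[of _ d])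
      qed
      show ?thesis using u d1 d2 d3 unfolding d_def by auto
    qed
    then show ?thesis using E(1,2) hw by (intro exI[of _ "insert w E"]) auto
  qed
qed

lemma AE_W_nonzero: "AE x in lborel. W x \<noteq> 0"
proof -
  have "negligible (\<Union>v\<in>Rp. {x. v \<bullet> x = 0})"
    using finite_Rp Rp_nonzero by (intro negligible_Union) (auto intro: negligible_hyperplane)
  moreover have "closed (\<Union>v\<in>Rp. {x. v \<bullet> x = 0})"
    using finite_Rp by (intro closed_UN) (auto intro: closed_hyperplane)
  ultimately have "(\<Union>v\<in>Rp. {x. v \<bullet> x = 0}) \<in> null_sets lborel"
    by (simp add: negligible_iff_null_sets null_sets_completion_iff borel_closed)
  then show ?thesis by (rule AE_I') (auto simp: W_eq_0_iff)
qed

text \<open>The weight vanishes on finitely many hyperplanes only, so a continuous function of norm zero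
vanishes on a dense subset of the sphere.\<close>

lemma zero_on_sphere:
  assumes d: "continuous_on UNIV d" and z: "coef d d 1 = 0" and y: "norm y = 1"
  shows "d y = 0"
proof (rule ccontr)
  assume ne: "d y \<noteq> 0"
  have "AE x in lborel. x \<in> ball 0 1 \<longrightarrow> d (sgn x) * d (sgn x) * W (sgn x) = 0"
    using sphere_integral_eq_0D[of "\<lambda>y. d y * d y * W y"] coef_integrand_continuous[OF d d, of 1] z W_nonneg
    by (simp add: coef_def)
  define S where "S = {x :: real^'n. x \<noteq> 0 \<and> norm x < 1 \<and> d (sgn x) \<noteq> 0}"
  have "AE x in lborel. x \<notin> S"
    using \<open>AE x in lborel. x \<in> ball 0 1 \<longrightarrow> d (sgn x) * d (sgn x) * W (sgn x) = 0\<close> AE_W_nonzero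
  proof eventually_elim
    case (elim x)
    show ?case
    proof
      assume x: "x \<in> S"
      then have "W (sgn x) = inverse (norm x) powr (2 * \<gamma>) * W x"
        using W_scale[of "inverse (norm x)" x] by (simp add: sgn_div_norm S_def)
      moreover have "inverse (norm x) powr (2 * \<gamma>) \<noteq> 0" using x by (simp add: S_def)
      ultimately have "W (sgn x) \<noteq> 0" using elim(2) by simp
      then show False using elim(1) x by (simp add: S_def)
    qed
  qed
  moreover have oS: "open S"
  proof -
    have "continuous_on (- {0}) (\<lambda>x::real^'n. d (sgn x))"
      by (intro continuous_on_compose2[OF d] continuous_intros) auto
    then have "open ((\<lambda>x. d (sgn x)) -` (- {0}) \<inter> - {0::real^'n})"
      by (intro continuous_on_open_vimage[THEN iffD1, rule_format]) auto
    moreover have "S = ((\<lambda>x. d (sgn x)) -` (- {0}) \<inter> - {0}) \<inter> ball 0 1" by (auto simp: S_def)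
    ultimately show ?thesis by auto
  qed
  ultimately have "S \<in> null_sets lborel"
    by (simp add: AE_iff_null_sets borel_open)
  then have "negligible S" by (simp add: negligible_iff_null_sets null_sets_completion_iff oS borel_open)
  moreover have "(1 / 2) *\<^sub>R y \<in> S" using y ne by (auto simp: S_def sgn_div_norm)
  ultimately show False using open_not_negligible[OF oS] by blast
qed

text \<open>By the Stone--Weierstrass theorem \<open>d\<close> is uniformly close to a polynomial, to which it is orthogonal.\<close>

lemma orthogonal_to_polynomials_zero:
  assumes d: "continuous_on UNIV d" and o: "\<And>k q. hpoly k q \<Longrightarrow> coef d q 1 = 0" and y: "norm y = 1"
  shows "d y = 0"
proof (rule zero_on_sphere[OF d _ y])
  have os: "coef d q 1 = 0" if "graded_poly q" for q
    using that
  proof (induction rule: graded_poly.induct)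
    case (graded_poly_add q q')
    have "coef (\<lambda>x. q x + q' x) d 1 = coef q d 1 + coef q' d 1"
      by (rule coef_add) (use graded_poly_add graded_poly_continuous d in auto)
    then show ?case using graded_poly_add by (simp add: coef_sym[of _ d])
  qed (rule o)
  define C where "C = sphere_integral (\<lambda>y. \<bar>d y\<bar> * W y)"
  have C: "C \<ge> 0" unfolding C_def
    by (intro sphere_integral_nonneg) (auto intro!: continuous_intros d W_continuous simp: W_nonneg)
  have le: "coef d d 1 \<le> e * C" if e: "e > 0" for e
  proof -
    obtain g where g: "real_polynomial_function g" "\<And>x. x \<in> cball 0 1 \<Longrightarrow> \<bar>d x - g x\<bar> < e"
      using Stone_Weierstrass_real_polynomial_function[of "cball 0 1" d e] e continuous_on_subset[OF d] by auto
    have hg: "graded_poly g" by (rule real_polynomial_function_graded_poly[OF g(1)])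
    have cg: "continuous_on UNIV g" by (rule graded_poly_continuous[OF hg])
    have "coef d d 1 = coef (\<lambda>x. d x - g x) d 1"
      using os[OF hg] by (simp add: coef_diff d cg coef_sym[of g])
    also have "\<dots> \<le> sphere_integral (\<lambda>y. e * (\<bar>d y\<bar> * W y))"
      unfolding coef_def
    proof (rule sphere_integral_mono)
      fix y :: "real^'n" assume y: "norm y = 1"
      have "(d y - g y) * d y \<le> \<bar>d y - g y\<bar> * \<bar>d y\<bar>" by (metis abs_ge_self abs_mult)
      also have "\<dots> \<le> e * \<bar>d y\<bar>" using g(2)[of y] y by (intro mult_right_mono) auto
      finally have "(d y - g y) * d y * W y \<le> e * \<bar>d y\<bar> * W y" by (rule mult_right_mono[OF _ W_nonneg])
      then show "(d (1 *\<^sub>R y) - g (1 *\<^sub>R y)) * d y * W y \<le> e * (\<bar>d y\<bar> * W y)" by (simp add: mult.assoc)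
    qed (simp_all, (intro continuous_intros d cg W_continuous)+)
    finally show ?thesis by (simp add: sphere_integral_cmult C_def)
  qed
  have "coef d d 1 \<le> 0"
  proof (rule field_le_epsilon)
    fix e :: real assume e: "e > 0"
    have "coef d d 1 \<le> e / (C + 1) * C" using e C by (intro le) auto
    also have "\<dots> \<le> e" using e C by (simp add: field_simps)
    finally show "coef d d 1 \<le> 0 + e" by simp
  qed
  then show "coef d d 1 = 0" using coef_self_nonneg[OF d] by simp
qed

text \<open>By hypothesis the coefficients of \<open>f\<close> contain no power of \<open>t\<close> beyond \<open>s\<close>, and those with respect to
harmonics of degree above \<open>s\<close> vanish. For each degree \<open>m \<le> s\<close> the
harmonic parts of degree \<open>m\<close> of the monomials of degree at most \<open>s\<close> form a finite family \<open>U m\<close>. On the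
sphere \<open>f (t \<cdot>)\<close> minus its projections to these families is orthogonal to every polynomial: to
those of degree at most \<open>s\<close> because on the sphere these are combinations of the families, and to
harmonics of higher degree by hypothesis. The coefficients of the projections are known
polynomials in \<open>t\<close>, which turns the expansion into a polynomial identity in \<open>x = t y\<close>.\<close>

theorem polynomial_from_coefficients:
  assumes f: "continuous_on UNIV f"
    and c: "\<And>m H. harmonic m H \<Longrightarrow> \<exists>c. \<forall>t>0. coef f H t = (\<Sum>j\<in>{j. j < p \<and> m + 2 * j \<le> s}. c j * t ^ (m + 2 * j))"
  shows "poly_of_degree_le s f"
proof -
  have "\<forall>\<alpha>. \<exists>H. (\<forall>i\<le>total_degree \<alpha> div 2. harmonic (total_degree \<alpha> - 2 * i) (H i)) \<and>
       (\<forall>x. monomial \<alpha> x = (\<Sum>i\<le>total_degree \<alpha> div 2. (x \<bullet> x) ^ i * H i x))"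
    using fischer_decomposition[OF hpoly_monomial] by blast
  then obtain h where h: "\<And>\<alpha> i. i \<le> total_degree \<alpha> div 2 \<Longrightarrow> harmonic (total_degree \<alpha> - 2 * i) (h \<alpha> i)"
    "\<And>\<alpha> x. monomial \<alpha> x = (\<Sum>i\<le>total_degree \<alpha> div 2. (x \<bullet> x) ^ i * h \<alpha> i x)" by metis
  define U where "U m = (\<lambda>(\<alpha>, i). h \<alpha> i) ` {(\<alpha>, i). total_degree \<alpha> \<le> s \<and> i \<le> total_degree \<alpha> div 2 \<and> total_degree \<alpha> - 2 * i = m}" for m
  have finU: "finite (U m)" for m
  proof -
    have "{(\<alpha> :: nat^'n, i). total_degree \<alpha> \<le> s \<and> i \<le> total_degree \<alpha> div 2 \<and> total_degree \<alpha> - 2 * i = m}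
      \<subseteq> {\<alpha>. total_degree \<alpha> \<le> s} \<times> {..s}" by auto
    from finite_subset[OF this] show ?thesis unfolding U_def using finite_total_degree_le[of s] by auto
  qed
  have hU: "harmonic m u" if "u \<in> U m" for m u using that h(1) unfolding U_def by auto
  have "\<forall>m. \<exists>E. finite E \<and> (\<forall>e\<in>E. harmonic m e) \<and>
     (\<forall>F. continuous_on UNIV F \<longrightarrow> (\<forall>u\<in>U m \<union> E. coef (\<lambda>x. F x - (\<Sum>e\<in>E. coef F e 1 * e x)) u 1 = 0))"
    using orthonormalization[OF finU hU] by blast
  from choice[OF this] obtain E where E0: "\<forall>m. finite (E m) \<and> (\<forall>e\<in>E m. harmonic m e) \<and>
     (\<forall>F. continuous_on UNIV F \<longrightarrow> (\<forall>u\<in>U m \<union> E m. coef (\<lambda>x. F x - (\<Sum>e\<in>E m. coef F e 1 * e x)) u 1 = 0))"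
    by blast
  have E: "\<And>m. finite (E m)" "\<And>m e. e \<in> E m \<Longrightarrow> harmonic m e"
     "\<And>m F u. continuous_on UNIV F \<Longrightarrow> u \<in> U m \<Longrightarrow> coef (\<lambda>x. F x - (\<Sum>e\<in>E m. coef F e 1 * e x)) u 1 = 0"
    using E0 by blast+
  have cE: "continuous_on UNIV e" if "e \<in> E m" for m e using harmonic_continuous[OF E(2)[OF that]] .
  have expansion: "f (t *\<^sub>R y) = (\<Sum>m\<le>s. \<Sum>e\<in>E m. coef f e t * e y)" if t: "t > 0" and y: "norm y = 1" for t y
  proof -
    define F where "F x = f (t *\<^sub>R x)" for x
    have cF: "continuous_on UNIV F" unfolding F_def by (rule continuous_scale[OF f])
    have Fe: "coef F H 1 = coef f H t" for H unfolding F_def by (rule coef_scale)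
    define pr where "pr m x = (\<Sum>e\<in>E m. coef F e 1 * e x)" for m x
    have cpr: "continuous_on UNIV (pr m)" for m unfolding pr_def by (intro continuous_intros cE)
    define d where "d x = F x - (\<Sum>m\<le>s. pr m x)" for x
    have cd: "continuous_on UNIV d" unfolding d_def by (intro continuous_intros cF cpr)
    have hpr: "harmonic m (pr m)" for m unfolding pr_def by (intro harmonic_sum harmonic_cmult E(2))
    have dH: "coef d H 1 = coef F H 1 - (\<Sum>m\<le>s. coef (pr m) H 1)" if H: "continuous_on UNIV H" for H
    proof -
      have "coef (\<lambda>x. \<Sum>m\<le>s. pr m x) H 1 = (\<Sum>m\<le>s. coef (pr m) H 1)" by (rule coef_sum) (rule cpr H)+
      moreover have "continuous_on UNIV (\<lambda>x. \<Sum>m\<le>s. pr m x)" by (intro continuous_intros cpr)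
      ultimately show ?thesis unfolding d_def by (simp add: coef_diff cF H)
    qed
    have dU: "coef d u 1 = 0" if u: "u \<in> U m" and m: "m \<le> s" for u m
    proof -
      have "(\<Sum>m'\<le>s. coef (pr m') u 1) = (\<Sum>m'\<le>s. if m' = m then coef (pr m) u 1 else 0)"
        using harmonic_orthogonal[OF hU[OF u] hpr] by (intro sum.cong) auto
      then have "coef d u 1 = coef F u 1 - coef (pr m) u 1"
        using m harmonic_continuous[OF hU[OF u]] by (simp add: dH)
      also have "\<dots> = coef (\<lambda>x. F x - pr m x) u 1"
        using harmonic_continuous[OF hU[OF u]] by (simp add: coef_diff cF cpr)
      also have "\<dots> = 0" unfolding pr_def by (rule E(3)[OF cF u])
      finally show ?thesis .
    qed
    have dmono: "coef d (monomial \<alpha>) 1 = 0" if a: "total_degree \<alpha> \<le> s" for \<alpha>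
    proof -
      have ch: "continuous_on UNIV (h \<alpha> i)" if "i \<le> total_degree \<alpha> div 2" for i using harmonic_continuous[OF h(1)[OF that]] .
      have "coef (monomial \<alpha>) d 1 = (\<Sum>i\<le>total_degree \<alpha> div 2. coef (h \<alpha> i) d 1)"
        unfolding h(2)[of \<alpha>, abs_def] by (rule coef_sum_radial_power) (auto intro: ch cd)
      also have "\<dots> = 0"
      proof (intro sum.neutral ballI)
        fix i assume i: "i \<in> {..total_degree \<alpha> div 2}"
        have "h \<alpha> i \<in> U (total_degree \<alpha> - 2 * i)"
          unfolding U_def by (rule image_eqI[of _ _ "(\<alpha>, i)"]) (use a i in auto)
        then show "coef (h \<alpha> i) d 1 = 0" using dU[of "h \<alpha> i"] a by (simp add: coef_sym[of _ d])
      qed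
      finally show ?thesis by (simp add: coef_sym[of _ "monomial \<alpha>"])
    qed
    have dlow: "coef d q 1 = 0" if "hpoly k q" "k \<le> s" for k q
      using hpoly_monomial_sum[OF that(1)] that(2)
    proof (induction rule: monomial_sum.induct)
      case (monomial_sum_base \<alpha> k c)
      then show ?case using dmono[of \<alpha>] by (simp add: coef_sym[of d] coef_cmult)
    next
      case (monomial_sum_add k q q')
      have c: "continuous_on UNIV q" if "monomial_sum k q" for k and q :: "real^'n \<Rightarrow> real"
        using that hpoly_continuous[OF hpoly_monomial] by (induction rule: monomial_sum.induct) (auto intro!: continuous_intros)
      have "coef (\<lambda>x. q x + q' x) d 1 = coef q d 1 + coef q' d 1"
        by (rule coef_add) (use monomial_sum_add c cd in blast)+
      then show ?case using monomial_sum_add by (simp add: coef_sym[of _ d])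
    qed
    have dhigh: "coef d H 1 = 0" if H: "harmonic m H" and m: "m > s" for m H
    proof -
      have "coef (pr m') H 1 = 0" if "m' \<le> s" for m' using harmonic_orthogonal[OF H hpr] that m by simp
      moreover have "coef f H t = 0"
      proof -
        obtain cc where "coef f H t = (\<Sum>j\<in>{j. j < p \<and> m + 2 * j \<le> s}. cc j * t ^ (m + 2 * j))" using c[OF H] t by blast
        moreover have "{j. j < p \<and> m + 2 * j \<le> s} = {}" using m by auto
        ultimately show ?thesis by (simp only: sum.empty)
      qed
      ultimately show ?thesis using harmonic_continuous[OF H] by (simp add: dH Fe)
    qed
    have dall: "coef d q 1 = 0" if q: "hpoly k q" for k q
    proof -
      obtain H where H: "\<And>i. i \<le> k div 2 \<Longrightarrow> harmonic (k - 2 * i) (H i)"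
        "\<And>x. q x = (\<Sum>i\<le>k div 2. (x \<bullet> x) ^ i * H i x)" using fischer_decomposition[OF q] by blast
      have cH: "continuous_on UNIV (H i)" if "i \<le> k div 2" for i using harmonic_continuous[OF H(1)[OF that]] .
      have "coef q d 1 = (\<Sum>i\<le>k div 2. coef (H i) d 1)"
        unfolding H(2)[abs_def] by (rule coef_sum_radial_power) (auto intro: cH cd)
      also have "\<dots> = 0"
      proof (intro sum.neutral ballI)
        fix i assume "i \<in> {..k div 2}"
        then have "harmonic (k - 2 * i) (H i)" using H(1) by simp
        then have "coef d (H i) 1 = 0" using dlow[OF harmonic_hpoly] dhigh by (cases "k - 2 * i \<le> s") auto
        then show "coef (H i) d 1 = 0" by (simp add: coef_sym)
      qed
      finally show ?thesis by (simp add: coef_sym)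
    qed
    have "d y = 0" by (rule orthogonal_to_polynomials_zero[OF cd dall y])
    then have "F y = (\<Sum>m\<le>s. \<Sum>e\<in>E m. coef f e t * e y)" by (simp add: d_def pr_def Fe)
    then show ?thesis by (simp add: F_def)
  qed
  define cc where "cc m e = (SOME c. \<forall>t>0. coef f e t = (\<Sum>j\<in>{j. j < p \<and> m + 2 * j \<le> s}. c j * t ^ (m + 2 * j)))" for m e
  have cc: "coef f e t = (\<Sum>j\<in>{j. j < p \<and> m + 2 * j \<le> s}. cc m e j * t ^ (m + 2 * j))"
    if "e \<in> E m" "t > 0" for m e t
    using someI_ex[OF c[OF E(2)[OF that(1)]]] that(2) unfolding cc_def by blast
  define P where "P x = (\<Sum>m\<le>s. \<Sum>e\<in>E m. \<Sum>j\<in>{j. j < p \<and> m + 2 * j \<le> s}. cc m e j * ((x \<bullet> x) ^ j * e x))" for x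
  have term_hpoly: "hpoly (2 * j + m) (\<lambda>x. (x \<bullet> x) ^ j * e x)" if "e \<in> E m" for j m e
    by (rule hpoly_mult[OF hpoly_radial harmonic_hpoly[OF E(2)[OF that]]])
  have polyP: "poly_of_degree_le s P" unfolding P_def
    by (intro poly_of_degree_le_sum poly_of_degree_le_hpoly[OF hpoly_cmult[OF term_hpoly]]) auto
  have cP: "continuous_on UNIV P" unfolding P_def
    by (intro continuous_intros cE)
  have off: "f x = P x" if x: "x \<noteq> 0" for x
  proof -
    define t where "t = norm x"
    define y where "y = sgn x"
    have t: "t > 0" and y: "norm y = 1" and ty: "t *\<^sub>R y = x"
      using x by (auto simp: t_def y_def norm_sgn sgn_div_norm)
    have "coef f e t * e y = (\<Sum>j\<in>{j. j < p \<and> m + 2 * j \<le> s}. cc m e j * ((x \<bullet> x) ^ j * e x))" if e: "e \<in> E m" for m e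
    proof -
      have ex: "e x = t ^ m * e y" using hpoly_scale[OF harmonic_hpoly[OF E(2)[OF e]], of t y] ty by simp
      have xx: "(x \<bullet> x) ^ j = t ^ (2 * j)" for j by (simp add: dot_square_norm t_def power_mult)
      show ?thesis unfolding cc[OF e t] sum_distrib_right ex xx
        by (intro sum.cong) (auto simp: power_add mult_ac)
    qed
    then show ?thesis using expansion[OF t y] unfolding ty P_def by simp
  qed
  have "f x = P x" for x
  proof -
    have "closed {x. f x = P x}" by (intro closed_Collect_eq f cP)
    moreover have "- {0} \<subseteq> {x. f x = P x}" using off by auto
    ultimately have "closure (- {0 :: real^'n}) \<subseteq> {x. f x = P x}" by (simp add: closure_minimal)
    moreover have "closure (- {0 :: real^'n}) = UNIV" by (simp add: closure_complement)
    ultimately show ?thesis by auto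
  qed
  then have "f = P" by blast
  then show ?thesis using polyP by simp
qed

end

section \<open>Growth of polynomials\<close>

lemma power_ratio_tendsto_0:
  assumes "a < b"
  shows "((\<lambda>r::real. r ^ a / r ^ b) \<longlongrightarrow> 0) at_top"
proof -
  have "((\<lambda>r::real. inverse r ^ (b - a)) \<longlongrightarrow> 0 ^ (b - a)) at_top"
    by (intro tendsto_power tendsto_inverse_0_at_top filterlim_ident)
  then have "((\<lambda>r::real. inverse r ^ (b - a)) \<longlongrightarrow> 0) at_top"
    using assms by (simp add: power_0_left)
  moreover have "eventually (\<lambda>r::real. inverse r ^ (b - a) = r ^ a / r ^ b) at_top"
    using eventually_gt_at_top[of 0]
  proof eventually_elim
    case (elim r)
    have "r ^ b = r ^ a * r ^ (b - a)" using assms by (simp flip: power_add)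
    then show ?case using elim by (simp add: power_inverse divide_inverse)
  qed
  ultimately show ?thesis by (rule Lim_transform_eventually)
qed

text \<open>A finite lower limit bounds the expression along an unbounded set of radii, while the highest
power that is present dominates for all large radii.\<close>

lemma large_coefficients_vanish:
  fixes c :: "nat \<Rightarrow> real"
  assumes fr: "\<exists>\<^sub>F r in at_top. \<bar>\<Sum>j<p. c j * r ^ (m + 2 * j)\<bar> \<le> K * r ^ s"
    and j: "j < p" "m + 2 * j > s"
  shows "c j = 0"
proof (rule ccontr)
  assume "c j \<noteq> 0"
  define N where "N = Max {j. j < p \<and> m + 2 * j > s \<and> c j \<noteq> 0}"
  have fin: "finite {j. j < p \<and> m + 2 * j > s \<and> c j \<noteq> 0}" by simp
  have ne: "{j. j < p \<and> m + 2 * j > s \<and> c j \<noteq> 0} \<noteq> {}" using j \<open>c j \<noteq> 0\<close> by auto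
  have N: "N < p" "m + 2 * N > s" "c N \<noteq> 0" using Max_in[OF fin ne] unfolding N_def by auto
  have above: "c i = 0" if "N < i" "i < p" for i
  proof (rule ccontr)
    assume "c i \<noteq> 0"
    then have "i \<in> {j. j < p \<and> m + 2 * j > s \<and> c j \<noteq> 0}" using that N by simp
    then have "i \<le> N" unfolding N_def by (rule Max_ge[OF fin])
    then show False using that by simp
  qed
  define d where "d = m + 2 * N"
  have term_lim: "((\<lambda>r. c i * (r ^ (m + 2 * i) / r ^ d)) \<longlongrightarrow> (if i = N then c N else 0)) at_top" if i: "i < p" for i
  proof -
    consider "i < N" | "i = N" | "i > N" by linarith
    then show ?thesis
    proof cases
      case 1
      then have "((\<lambda>r. c i * (r ^ (m + 2 * i) / r ^ d)) \<longlongrightarrow> c i * 0) at_top"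
        by (intro tendsto_intros power_ratio_tendsto_0) (simp add: d_def)
      then show ?thesis using 1 by simp
    next
      case 2
      have "eventually (\<lambda>r. c N = c i * (r ^ (m + 2 * i) / r ^ d)) at_top"
        using eventually_gt_at_top[of 0] by eventually_elim (simp add: 2 d_def)
      with tendsto_const show ?thesis using 2 by (auto intro: Lim_transform_eventually)
    qed (use above i in simp)
  qed
  have "((\<lambda>r. \<Sum>i<p. c i * (r ^ (m + 2 * i) / r ^ d)) \<longlongrightarrow> (\<Sum>i<p. if i = N then c N else 0)) at_top"
    by (intro tendsto_sum term_lim) simp
  moreover have "(\<Sum>i<p. if i = N then c N else 0) = c N" using N by simp
  ultimately have "((\<lambda>r. \<bar>\<Sum>i<p. c i * (r ^ (m + 2 * i) / r ^ d)\<bar>) \<longlongrightarrow> \<bar>c N\<bar>) at_top"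
    by (intro tendsto_rabs) simp
  moreover have "\<bar>c N\<bar> / 2 < \<bar>c N\<bar>" using N by simp
  ultimately have 1: "eventually (\<lambda>r. \<bar>c N\<bar> / 2 < \<bar>\<Sum>i<p. c i * (r ^ (m + 2 * i) / r ^ d)\<bar>) at_top"
    by (rule order_tendstoD)
  have "((\<lambda>r. K * (r ^ s / r ^ d)) \<longlongrightarrow> K * 0) at_top"
    by (intro tendsto_intros power_ratio_tendsto_0) (use N in \<open>simp add: d_def\<close>)
  moreover have "K * 0 < \<bar>c N\<bar> / 2" using N by simp
  ultimately have 2: "eventually (\<lambda>r. K * (r ^ s / r ^ d) < \<bar>c N\<bar> / 2) at_top"
    by (rule order_tendstoD)
  have "eventually (\<lambda>r. \<not> \<bar>\<Sum>j<p. c j * r ^ (m + 2 * j)\<bar> \<le> K * r ^ s) at_top"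
    using 1 2 eventually_gt_at_top[of 0]
  proof eventually_elim
    case (elim r)
    have eq: "(\<Sum>i<p. c i * (r ^ (m + 2 * i) / r ^ d)) = (\<Sum>j<p. c j * r ^ (m + 2 * j)) / r ^ d"
      by (simp add: sum_divide_distrib)
    have "K * (r ^ s / r ^ d) < \<bar>(\<Sum>j<p. c j * r ^ (m + 2 * j)) / r ^ d\<bar>"
      using elim(1,2) unfolding eq by linarith
    then have "K * r ^ s / r ^ d < \<bar>\<Sum>j<p. c j * r ^ (m + 2 * j)\<bar> / r ^ d"
      using elim(3) by (simp add: abs_divide)
    then show ?case using elim(3) by (simp add: divide_less_cancel not_le)
  qed
  then show False using fr by (simp add: frequently_def)
qed

definition homogeneous_part :: "'n::finite mpolynomial \<Rightarrow> nat \<Rightarrow> real^'n \<Rightarrow> real" where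
  "homogeneous_part P k x = (\<Sum>\<alpha>\<in>{\<alpha>\<in>Poly_Mapping.keys P. total_degree \<alpha> = k}. Poly_Mapping.lookup P \<alpha> * monomial \<alpha> x)"

lemma hpoly_homogeneous_part: "hpoly k (homogeneous_part P k)"
  unfolding homogeneous_part_def[abs_def] using hpoly_monomial by (intro hpoly_sum hpoly_cmult) auto

lemma mpoly_fun_homogeneous_parts:
  fixes P :: "'n::finite mpolynomial"
  assumes "\<forall>\<alpha>\<in>Poly_Mapping.keys P. total_degree \<alpha> \<le> s"
  shows "mpoly_fun P x = (\<Sum>k\<le>s. homogeneous_part P k x)"
proof -
  have "(\<Sum>k\<le>s. homogeneous_part P k x) = (\<Sum>\<alpha>\<in>Poly_Mapping.keys P. Poly_Mapping.lookup P \<alpha> * monomial \<alpha> x)"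
    unfolding homogeneous_part_def by (rule sum.group) (use assms in auto)
  then show ?thesis by (simp add: mpoly_fun_superset[of "Poly_Mapping.keys P"])
qed

lemma mpoly_degree_le_iff: "mpoly_degree P \<le> int s \<longleftrightarrow> (\<forall>\<alpha>\<in>Poly_Mapping.keys P. total_degree \<alpha> \<le> s)"
  unfolding mpoly_degree_def total_degree_def[symmetric] by (subst Max_le_iff) auto

lemma mpoly_degree_less_iff: "mpoly_degree P < int s \<longleftrightarrow> (\<forall>\<alpha>\<in>Poly_Mapping.keys P. total_degree \<alpha> < s)"
  unfolding mpoly_degree_def total_degree_def[symmetric] by (subst Max_less_iff) auto

text \<open>After division by the fastest growing exponential only its own coefficient survives in the limit.\<close>

lemma exponentials_independent:
  fixes c l :: "'a \<Rightarrow> real"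
  assumes A: "finite A" and inj: "inj_on l A" and z: "\<And>t. (\<Sum>\<alpha>\<in>A. c \<alpha> * exp (l \<alpha> * t)) = 0"
  shows "\<forall>\<alpha>\<in>A. c \<alpha> = 0"
proof (rule ccontr)
  assume "\<not> (\<forall>\<alpha>\<in>A. c \<alpha> = 0)"
  define B where "B = {\<alpha>\<in>A. c \<alpha> \<noteq> 0}"
  have B: "finite B" "B \<noteq> {}" using A \<open>\<not> _\<close> by (auto simp: B_def)
  have "Max (l ` B) \<in> l ` B" using B by (intro Max_in) auto
  then obtain \<beta> where \<beta>B: "\<beta> \<in> B" and \<beta>m: "l \<beta> = Max (l ` B)" by auto
  have \<beta>: "\<beta> \<in> B" "\<And>\<alpha>. \<alpha> \<in> B \<Longrightarrow> l \<alpha> \<le> l \<beta>"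
    using \<beta>B B unfolding \<beta>m by auto
  have zB: "(\<Sum>\<alpha>\<in>B. c \<alpha> * exp ((l \<alpha> - l \<beta>) * t)) = 0" for t
  proof -
    have "(\<Sum>\<alpha>\<in>B. c \<alpha> * exp ((l \<alpha> - l \<beta>) * t)) = (\<Sum>\<alpha>\<in>B. c \<alpha> * exp (l \<alpha> * t)) * exp (- l \<beta> * t)"
      unfolding sum_distrib_right
      by (intro sum.cong) (auto simp: left_diff_distrib exp_diff exp_minus divide_inverse mult.assoc)
    also have "(\<Sum>\<alpha>\<in>B. c \<alpha> * exp (l \<alpha> * t)) = (\<Sum>\<alpha>\<in>A. c \<alpha> * exp (l \<alpha> * t))"
      unfolding B_def using A by (intro sum.mono_neutral_left) auto
    finally show ?thesis using z by simp
  qed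
  have "((\<lambda>t. \<Sum>\<alpha>\<in>B. c \<alpha> * exp ((l \<alpha> - l \<beta>) * t)) \<longlongrightarrow> (\<Sum>\<alpha>\<in>B. if \<alpha> = \<beta> then c \<beta> else 0)) at_top"
  proof (intro tendsto_sum)
    fix \<alpha> assume a: "\<alpha> \<in> B"
    show "((\<lambda>t. c \<alpha> * exp ((l \<alpha> - l \<beta>) * t)) \<longlongrightarrow> (if \<alpha> = \<beta> then c \<beta> else 0)) at_top"
    proof (cases "\<alpha> = \<beta>")
      case False
      then have "l \<alpha> \<noteq> l \<beta>" using inj a \<beta>(1) by (auto simp: B_def inj_on_def)
      then have neg: "l \<alpha> - l \<beta> < 0" using \<beta>(2)[OF a] by simp
      have "filterlim (\<lambda>t. (l \<alpha> - l \<beta>) * t) at_bot at_top"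
        by (rule filterlim_tendsto_neg_mult_at_bot[OF tendsto_const neg filterlim_ident])
      then have "((\<lambda>t. c \<alpha> * exp ((l \<alpha> - l \<beta>) * t)) \<longlongrightarrow> c \<alpha> * 0) at_top"
        by (intro tendsto_intros filterlim_compose[OF exp_at_bot])
      then show ?thesis using False by simp
    qed simp
  qed
  then have "((\<lambda>t::real. 0::real) \<longlongrightarrow> c \<beta>) at_top" using B \<beta>(1) by (simp add: zB)
  then have "c \<beta> = 0" using tendsto_unique[OF trivial_limit_at_top_linorder tendsto_const] by metis
  then show False using \<beta>(1) by (simp add: B_def)
qed

text \<open>On the curve \<open>x\<^sub>i = exp (a\<^sub>i t)\<close> monomials become exponentials, and for \<open>a\<close> outside finitely many
hyperplanes different monomials have different exponents.\<close>

lemma monomials_independent: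
  fixes A :: "(nat^'n) set"
  assumes A: "finite A" and z: "\<And>x. (\<Sum>\<alpha>\<in>A. c \<alpha> * monomial \<alpha> x) = 0"
  shows "\<forall>\<alpha>\<in>A. c \<alpha> = 0"
proof -
  define rv where "rv \<alpha> = (\<chi> i. real (\<alpha> $ i))" for \<alpha> :: "nat^'n"
  have "negligible (\<Union>p\<in>{(\<alpha>, \<beta>)\<in>A \<times> A. \<alpha> \<noteq> \<beta>}. {x. (rv (fst p) - rv (snd p)) \<bullet> x = 0})"
  proof (intro negligible_Union)
    show "finite ((\<lambda>p. {x. (rv (fst p) - rv (snd p)) \<bullet> x = 0}) ` {(\<alpha>, \<beta>)\<in>A \<times> A. \<alpha> \<noteq> \<beta>})"
      by (rule finite_imageI, rule finite_subset[of _ "A \<times> A"]) (use A in auto)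
    fix S assume "S \<in> (\<lambda>p. {x. (rv (fst p) - rv (snd p)) \<bullet> x = 0}) ` {(\<alpha>, \<beta>)\<in>A \<times> A. \<alpha> \<noteq> \<beta>}"
    then obtain \<alpha> \<beta> where S: "S = {x. (rv \<alpha> - rv \<beta>) \<bullet> x = 0}" and ne: "\<alpha> \<noteq> \<beta>" by auto
    have "rv \<alpha> - rv \<beta> \<noteq> 0" using ne by (auto simp: rv_def vec_eq_iff)
    then show "negligible S" unfolding S by (intro negligible_hyperplane) simp
  qed
  then have "(\<Union>p\<in>{(\<alpha>, \<beta>)\<in>A \<times> A. \<alpha> \<noteq> \<beta>}. {x. (rv (fst p) - rv (snd p)) \<bullet> x = 0}) \<noteq> UNIV"
    using non_negligible_UNIV by metis
  then obtain a where a0: "a \<notin> (\<Union>p\<in>{(\<alpha>, \<beta>)\<in>A \<times> A. \<alpha> \<noteq> \<beta>}. {x. (rv (fst p) - rv (snd p)) \<bullet> x = 0})"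
    by blast
  have a: "(rv \<alpha> - rv \<beta>) \<bullet> a \<noteq> 0" if "\<alpha> \<in> A" "\<beta> \<in> A" "\<alpha> \<noteq> \<beta>" for \<alpha> \<beta>
    using a0 that by force
  show ?thesis
  proof (rule exponentials_independent[OF A, of "\<lambda>\<alpha>. rv \<alpha> \<bullet> a"])
    show "inj_on (\<lambda>\<alpha>. rv \<alpha> \<bullet> a) A" using a by (auto simp: inj_on_def inner_diff_left)
    fix t
    have "monomial \<alpha> (\<chi> i. exp (a $ i * t)) = exp (rv \<alpha> \<bullet> a * t)" for \<alpha>
    proof -
      have "exp (rv \<alpha> \<bullet> a * t) = exp (\<Sum>i\<in>UNIV. real (\<alpha> $ i) * (a $ i * t))"
        by (simp add: rv_def inner_vec_def sum_distrib_right mult.assoc)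
      also have "\<dots> = (\<Prod>i\<in>UNIV. exp (real (\<alpha> $ i) * (a $ i * t)))" by (rule exp_sum) simp
      finally show ?thesis by (simp add: monomial_def exp_of_nat_mult)
    qed
    then show "(\<Sum>\<alpha>\<in>A. c \<alpha> * exp (rv \<alpha> \<bullet> a * t)) = 0" using z[of "\<chi> i. exp (a $ i * t)"] by simp
  qed
qed

lemma homogeneous_part_zeroD:
  fixes P :: "'n::finite mpolynomial"
  assumes "\<And>x. homogeneous_part P k x = 0" "\<alpha> \<in> Poly_Mapping.keys P"
  shows "total_degree \<alpha> \<noteq> k"
proof
  assume "total_degree \<alpha> = k"
  moreover have "\<forall>\<alpha>\<in>{\<alpha>\<in>Poly_Mapping.keys P. total_degree \<alpha> = k}. Poly_Mapping.lookup P \<alpha> = 0"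
    by (rule monomials_independent) (use assms(1) in \<open>auto simp: homogeneous_part_def\<close>)
  ultimately show False using assms(2) by (auto simp: in_keys_iff)
qed

section \<open>Growth of the positive part\<close>

lemma fplus_nonneg: "fplus f x \<ge> 0" by (simp add: fplus_def)
lemma abs_eq_fplus:
  fixes f :: "real^'n \<Rightarrow> real"
  shows "\<bar>f x\<bar> = 2 * fplus f x - f x"
proof -
  have "2 * ((\<bar>a\<bar> + a) / 2) - a = \<bar>a\<bar>" for a :: real by (simp add: field_simps)
  then show ?thesis by (simp only: fplus_def)
qed
lemma fplus_continuous: "continuous_on S f \<Longrightarrow> continuous_on S (fplus f)"
  unfolding fplus_def[abs_def] by (intro continuous_intros) auto

context dunkl begin

text \<open>The mean is not normalised: its value at \<open>f = 1\<close> is a positive constant.\<close>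

definition mean :: "(real^'n \<Rightarrow> real) \<Rightarrow> real \<Rightarrow> real" where
  "mean f r = coef f (\<lambda>_. 1) r"

lemma harmonic_one: "harmonic 0 (\<lambda>_. 1)"
  by (simp add: harmonic_def hpoly_const L_const)

lemma mean_le:
  assumes "continuous_on UNIV f" "continuous_on UNIV g" "\<And>y. norm y = 1 \<Longrightarrow> f (r *\<^sub>R y) \<le> g (r *\<^sub>R y)"
  shows "mean f r \<le> mean g r"
  unfolding mean_def coef_def
proof (rule sphere_integral_mono)
  show "f (r *\<^sub>R y) * 1 * W y \<le> g (r *\<^sub>R y) * 1 * W y" if "norm y = 1" for y
    using mult_right_mono[OF assms(3)[OF that] W_nonneg] by simp
qed (intro coef_integrand_continuous assms continuous_on_const)+

text \<open>The powers of \<open>r\<close> in the denominator are those by which surface measure and weight scale, so what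
is compared with \<open>r\<^sup>s\<close> is the mean over the unit sphere.\<close>

lemma M1_fplus:
  assumes f: "continuous_on UNIV f" and r: "r > 0"
  shows "M1 Rp \<kappa> r (fplus f) / r powr (real s + real CARD('n) - 1 + 2 * \<gamma>) = real CARD('n) * mean (fplus f) r / r ^ s"
proof -
  have c: "continuous_on UNIV (\<lambda>y. fplus f y * (1 * 1) * W y)"
    by (intro continuous_intros fplus_continuous f W_continuous)
  have "M1 Rp \<kappa> r (fplus f) = (\<integral>y. fplus f y * (1 * 1) * W y \<partial>surface_measure r)"
    unfolding M1_def W_def using fplus_nonneg[of f] by simp
  also have "\<dots> = real CARD('n) * r ^ (CARD('n) - 1) * (r powr (2 * \<gamma>) * mean (fplus f) r)"
    unfolding integral_surface_measure[OF c r]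
    using sphere_integral_radial[OF fplus_continuous[OF f] continuous_on_const[of _ 1] harmonic_one r]
    by (simp add: mean_def)
  finally have M: "M1 Rp \<kappa> r (fplus f) = real CARD('n) * r ^ (CARD('n) - 1) * (r powr (2 * \<gamma>) * mean (fplus f) r)" .
  have e: "real s + real CARD('n) - 1 + 2 * \<gamma> = real s + (real (CARD('n) - 1) + 2 * \<gamma>)"
    by (simp add: of_nat_diff)
  have pw: "r powr (real s + real CARD('n) - 1 + 2 * \<gamma>) = r ^ s * (r ^ (CARD('n) - 1) * r powr (2 * \<gamma>))"
    unfolding e powr_add using r by (simp only: powr_realpow)
  have "r powr (2 * \<gamma>) > 0" "r ^ (CARD('n) - 1) > 0" using r by simp_all
  then show ?thesis unfolding M pw by (simp add: field_simps)
qed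

lemma mean_polyharmonic:
  assumes "C_class (2 * p) f" "\<And>x. (L ^^ p) f x = 0"
  obtains c where "\<And>t. t > 0 \<Longrightarrow> mean f t = (\<Sum>j<p. c j * t ^ (2 * j))"
  using coef_polyharmonic[OF harmonic_one assms] unfolding mean_def by auto

lemma mean_abs:
  assumes "continuous_on UNIV f"
  shows "mean (\<lambda>x. \<bar>f x\<bar>) r = 2 * mean (fplus f) r - mean f r"
  unfolding mean_def abs_eq_fplus
  using assms fplus_continuous[OF assms] by (simp add: coef_diff coef_cmult continuous_on_mult_left)

lemma coef_le_mean_abs:
  assumes f: "continuous_on UNIV f" and H: "continuous_on UNIV H"
  obtains B where "B \<ge> 0" "\<And>r. \<bar>coef f H r\<bar> \<le> B * mean (\<lambda>x. \<bar>f x\<bar>) r"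
proof -
  obtain B where B0: "B \<ge> 0" and B: "\<And>y. norm y \<le> 1 \<Longrightarrow> \<bar>H y\<bar> \<le> B"
    using continuous_bounded_on_cball[OF H] by blast
  have "\<bar>coef f H r\<bar> \<le> B * mean (\<lambda>x. \<bar>f x\<bar>) r" for r
  proof -
    have "\<bar>coef f H r\<bar> \<le> sphere_integral (\<lambda>y. \<bar>f (r *\<^sub>R y) * H y * W y\<bar>)"
      unfolding coef_def by (rule sphere_integral_abs_le[OF coef_integrand_continuous[OF f H]])
    also have "\<dots> \<le> sphere_integral (\<lambda>y. B * (\<bar>f (r *\<^sub>R y)\<bar> * 1 * W y))"
    proof (rule sphere_integral_mono)
      fix y :: "real^'n" assume y: "norm y = 1"
      have "\<bar>H y\<bar> * (\<bar>f (r *\<^sub>R y)\<bar> * W y) \<le> B * (\<bar>f (r *\<^sub>R y)\<bar> * W y)"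
        using B[of y] y W_nonneg by (intro mult_right_mono) auto
      then show "\<bar>f (r *\<^sub>R y) * H y * W y\<bar> \<le> B * (\<bar>f (r *\<^sub>R y)\<bar> * 1 * W y)"
        using W_nonneg[of y] by (simp add: abs_mult mult_ac)
    qed (intro continuous_intros continuous_scale f H W_continuous)+
    finally show ?thesis by (simp add: sphere_integral_cmult mean_def coef_def)
  qed
  then show ?thesis using that B0 by blast
qed

text \<open>The mean of \<open>f\<close> grows at most like \<open>r\<close> to the power \<open>2 (p - 1) \<le> s\<close>. So a bound on the positive part is
a bound on \<open>\<bar>f\<bar>\<close>, and with it on every coefficient.\<close>

theorem polynomial_of_growth:
  assumes p: "p \<ge> 1" and s: "s \<ge> 2 * (p - 1)" and f: "C_class (2 * p) f" and z: "\<And>x. (L ^^ p) f x = 0"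
    and fr: "\<exists>\<^sub>F r in at_top. mean (fplus f) r \<le> C * r ^ s"
  shows "poly_of_degree_le s f"
proof -
  have cf: "continuous_on UNIV f" using f by (rule C_class_cont)
  obtain c0 where c0: "\<And>t. t > 0 \<Longrightarrow> mean f t = (\<Sum>j<p. c0 j * t ^ (2 * j))"
    using mean_polyharmonic[OF f z] by blast
  define D where "D = (\<Sum>j<p. \<bar>c0 j\<bar>)"
  have meanf: "\<bar>mean f r\<bar> \<le> D * r ^ s" if r: "r \<ge> 1" for r
  proof -
    have "\<bar>mean f r\<bar> \<le> (\<Sum>j<p. \<bar>c0 j * r ^ (2 * j)\<bar>)" using r by (simp add: c0 sum_abs)
    also have "\<dots> \<le> (\<Sum>j<p. \<bar>c0 j\<bar> * r ^ s)"
    proof (intro sum_mono)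
      fix j assume "j \<in> {..<p}"
      then have "2 * j \<le> s" using s by auto
      then have "r ^ (2 * j) \<le> r ^ s" using r by (rule power_increasing)
      then show "\<bar>c0 j * r ^ (2 * j)\<bar> \<le> \<bar>c0 j\<bar> * r ^ s" using r by (simp add: abs_mult mult_left_mono)
    qed
    finally show ?thesis by (simp add: D_def sum_distrib_right)
  qed
  have "\<exists>\<^sub>F r in at_top. mean (fplus f) r \<le> C * r ^ s \<and> r \<ge> 1"
    using fr eventually_ge_at_top[of "1::real"] by (rule frequently_eventually_frequently)
  then have frabs: "\<exists>\<^sub>F r in at_top. mean (\<lambda>x. \<bar>f x\<bar>) r \<le> (2 * C + D) * r ^ s"
  proof (rule frequently_mono[rotated], intro allI impI)
    fix r assume r: "mean (fplus f) r \<le> C * r ^ s \<and> r \<ge> 1"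
    then have "- mean f r \<le> D * r ^ s" using meanf[of r] by linarith
    then show "mean (\<lambda>x. \<bar>f x\<bar>) r \<le> (2 * C + D) * r ^ s"
      unfolding mean_abs[OF cf] using r by (simp add: algebra_simps)
  qed
  show ?thesis
  proof (rule polynomial_from_coefficients[OF cf])
    fix m H assume H: "harmonic m H"
    obtain c where c: "\<And>t. t > 0 \<Longrightarrow> coef f H t = (\<Sum>j<p. c j * t ^ (m + 2 * j))"
      using coef_polyharmonic[OF H f z] by blast
    obtain B where B: "B \<ge> 0" "\<And>r. \<bar>coef f H r\<bar> \<le> B * mean (\<lambda>x. \<bar>f x\<bar>) r"
      using coef_le_mean_abs[OF cf harmonic_continuous[OF H]] by blast
    have "\<exists>\<^sub>F r in at_top. mean (\<lambda>x. \<bar>f x\<bar>) r \<le> (2 * C + D) * r ^ s \<and> r > 0"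
      using frabs eventually_gt_at_top[of "0::real"] by (rule frequently_eventually_frequently)
    then have "\<exists>\<^sub>F r in at_top. \<bar>\<Sum>j<p. c j * r ^ (m + 2 * j)\<bar> \<le> (B * (2 * C + D)) * r ^ s"
    proof (rule frequently_mono[rotated], intro allI impI)
      fix r assume r: "mean (\<lambda>x. \<bar>f x\<bar>) r \<le> (2 * C + D) * r ^ s \<and> r > 0"
      have "\<bar>coef f H r\<bar> \<le> B * mean (\<lambda>x. \<bar>f x\<bar>) r" by (rule B(2))
      also have "\<dots> \<le> B * ((2 * C + D) * r ^ s)" using r B(1) by (intro mult_left_mono) auto
      finally show "\<bar>\<Sum>j<p. c j * r ^ (m + 2 * j)\<bar> \<le> (B * (2 * C + D)) * r ^ s" using r by (simp add: c mult.assoc)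
    qed
    note van = large_coefficients_vanish[OF this]
    have "coef f H t = (\<Sum>j\<in>{j. j < p \<and> m + 2 * j \<le> s}. c j * t ^ (m + 2 * j))" if "t > 0" for t
      unfolding c[OF that] by (rule sum.mono_neutral_right) (auto simp: van)
    then show "\<exists>c. \<forall>t>0. coef f H t = (\<Sum>j\<in>{j. j < p \<and> m + 2 * j \<le> s}. c j * t ^ (m + 2 * j))" by blast
  qed
qed

lemma polynomial_mean_tendsto:
  assumes P: "\<And>x. f x = (\<Sum>k\<le>s. h k x)" and h: "\<And>k. k \<le> s \<Longrightarrow> hpoly k (h k)"
  shows "((\<lambda>r. mean (fplus f) r / r ^ s) \<longlongrightarrow> mean (fplus (h s)) 1) at_top"
    and "((\<lambda>r. mean f r / r ^ s) \<longlongrightarrow> mean (h s) 1) at_top"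
proof -
  have ch: "continuous_on UNIV (h k)" if "k \<le> s" for k using hpoly_continuous[OF h[OF that]] .
  have cf: "continuous_on UNIV f" unfolding P[abs_def] by (intro continuous_intros ch) auto
  define A where "A r = (\<Sum>k<s. r ^ k / r ^ s * mean (\<lambda>x. \<bar>h k x\<bar>) 1)" for r :: real
  have A0: "(A \<longlongrightarrow> 0) at_top"
  proof -
    have "(A \<longlongrightarrow> (\<Sum>k<s. 0 * mean (\<lambda>x. \<bar>h k x\<bar>) 1)) at_top"
      unfolding A_def by (intro tendsto_intros power_ratio_tendsto_0) auto
    then show ?thesis by simp
  qed
  \<comment> \<open>Both limits follow from the same comparison of integrands on the unit sphere.\<close>
  have gen: "((\<lambda>r. mean (\<lambda>x. \<phi> (f x)) r / r ^ s) \<longlongrightarrow> mean (\<lambda>x. \<phi> (h s x)) 1) at_top"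
    if c\<phi>: "continuous_on UNIV \<phi>" and lip: "\<And>a b. \<bar>\<phi> a - \<phi> b\<bar> \<le> \<bar>a - b\<bar>" and hom: "\<And>t a. t > 0 \<Longrightarrow> \<phi> (t * a) = t * \<phi> a"
    for \<phi> :: "real \<Rightarrow> real"
  proof -
    have c\<phi>': "continuous_on UNIV (\<lambda>x. \<phi> (q x))" if "continuous_on UNIV q" for q :: "real^'n \<Rightarrow> real"
      by (rule continuous_on_compose2[OF c\<phi> that]) auto
    have "\<bar>mean (\<lambda>x. \<phi> (f x)) r / r ^ s - mean (\<lambda>x. \<phi> (h s x)) 1\<bar> \<le> A r" if r: "r > 0" for r
    proof -
      let ?g = "\<lambda>y. (1 / r ^ s) * \<phi> (f (r *\<^sub>R y)) - \<phi> (h s y)"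
      have cg: "continuous_on UNIV ?g"
        by (intro continuous_intros c\<phi>' continuous_scale cf ch) simp
      have "mean (\<lambda>x. \<phi> (f x)) r / r ^ s - mean (\<lambda>x. \<phi> (h s x)) 1 = mean ?g 1"
      proof -
        have c1: "continuous_on UNIV (\<lambda>y. (1 / r ^ s) * \<phi> (f (r *\<^sub>R y)))"
          by (intro continuous_intros c\<phi>' continuous_scale cf)
        have c2: "continuous_on UNIV (\<lambda>y. \<phi> (h s y))" by (intro c\<phi>' ch) simp
        have "mean ?g 1 = mean (\<lambda>y. (1 / r ^ s) * \<phi> (f (r *\<^sub>R y))) 1 - mean (\<lambda>x. \<phi> (h s x)) 1"
          unfolding mean_def by (rule coef_diff[OF c1 c2 continuous_on_const])
        also have "mean (\<lambda>y. (1 / r ^ s) * \<phi> (f (r *\<^sub>R y))) 1 = (1 / r ^ s) * mean (\<lambda>x. \<phi> (f x)) r"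
          unfolding mean_def coef_cmult by (simp add: coef_def)
        finally show ?thesis by simp
      qed
      then have "\<bar>mean (\<lambda>x. \<phi> (f x)) r / r ^ s - mean (\<lambda>x. \<phi> (h s x)) 1\<bar> = \<bar>mean ?g 1\<bar>" by simp
      also have "\<dots> \<le> mean (\<lambda>y. \<bar>?g y\<bar>) 1"
        unfolding mean_def coef_def
        using sphere_integral_abs_le[OF coef_integrand_continuous[OF cg continuous_on_const[of _ 1], of 1]] W_nonneg
        by (simp add: abs_mult)
      also have "\<dots> \<le> mean (\<lambda>y. \<Sum>k<s. r ^ k / r ^ s * \<bar>h k y\<bar>) 1"
      proof (rule mean_le)
        show "continuous_on UNIV (\<lambda>y. \<bar>?g y\<bar>)" by (intro continuous_on_rabs cg)
        show "continuous_on UNIV (\<lambda>y. \<Sum>k<s. r ^ k / r ^ s * \<bar>h k y\<bar>)"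
          by (intro continuous_intros ch) auto
        fix y :: "real^'n"
        have rs: "r ^ s > 0" using r by simp
        have "(1 / r ^ s) * \<phi> (f (r *\<^sub>R y)) = \<phi> ((1 / r ^ s) * f (r *\<^sub>R y))"
          using hom[of "1 / r ^ s"] rs by simp
        then have "\<bar>?g y\<bar> \<le> \<bar>(1 / r ^ s) * f (r *\<^sub>R y) - h s y\<bar>" using lip by simp
        also have "(1 / r ^ s) * f (r *\<^sub>R y) - h s y = (\<Sum>k<s. r ^ k / r ^ s * h k y)"
        proof -
          have "f (r *\<^sub>R y) = (\<Sum>k\<le>s. r ^ k * h k y)"
            unfolding P by (intro sum.cong) (auto simp: hpoly_scale[OF h])
          also have "\<dots> = (\<Sum>k<s. r ^ k * h k y) + r ^ s * h s y"
            by (simp add: lessThan_Suc_atMost[symmetric])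
          finally show ?thesis using r rs by (simp add: distrib_left sum_distrib_left)
        qed
        also have "\<bar>\<Sum>k<s. r ^ k / r ^ s * h k y\<bar> \<le> (\<Sum>k<s. \<bar>r ^ k / r ^ s * h k y\<bar>)" by (rule sum_abs)
        also have "\<dots> = (\<Sum>k<s. r ^ k / r ^ s * \<bar>h k y\<bar>)" using r by (simp add: abs_mult abs_divide)
        finally show "\<bar>(1 / r ^ s) * \<phi> (f (r *\<^sub>R (1 *\<^sub>R y))) - \<phi> (h s (1 *\<^sub>R y))\<bar> \<le> (\<Sum>k<s. r ^ k / r ^ s * \<bar>h k (1 *\<^sub>R y)\<bar>)" by simp
      qed
      also have "\<dots> = (\<Sum>k<s. mean (\<lambda>y. r ^ k / r ^ s * \<bar>h k y\<bar>) 1)"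
        unfolding mean_def
      proof (rule coef_sum)
        fix k assume "k \<in> {..<s}"
        then have "continuous_on UNIV (h k)" using ch by simp
        then show "continuous_on UNIV (\<lambda>y. r ^ k / r ^ s * \<bar>h k y\<bar>)" by (intro continuous_on_mult_left continuous_on_rabs)
      qed simp
      also have "\<dots> = A r" unfolding A_def mean_def coef_cmult ..
      finally show ?thesis .
    qed
    then have "eventually (\<lambda>r. norm (mean (\<lambda>x. \<phi> (f x)) r / r ^ s - mean (\<lambda>x. \<phi> (h s x)) 1) \<le> A r) at_top"
      by (intro eventually_mono[OF eventually_gt_at_top[of 0]]) simp
    from Lim_null_comparison[OF this A0] show ?thesis by (simp add: Lim_null[symmetric])
  qed
  show "((\<lambda>r. mean (fplus f) r / r ^ s) \<longlongrightarrow> mean (fplus (h s)) 1) at_top"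
    unfolding fplus_def[abs_def]
  proof (rule gen)
    show "continuous_on UNIV (\<lambda>a::real. (\<bar>a\<bar> + a) / 2)" by (intro continuous_intros) auto
    show "\<bar>(\<bar>a\<bar> + a) / 2 - (\<bar>b\<bar> + b) / 2\<bar> \<le> \<bar>a - b\<bar>" for a b :: real by (auto simp: abs_if)
    show "t > 0 \<Longrightarrow> (\<bar>t * a\<bar> + t * a) / 2 = t * ((\<bar>a\<bar> + a) / 2)" for t a :: real
      by (simp add: abs_mult distrib_left)
  qed
  show "((\<lambda>r. mean f r / r ^ s) \<longlongrightarrow> mean (h s) 1) at_top"
    using gen[of "\<lambda>a. a"] by auto
qed

text \<open>The mean of \<open>f\<close> is \<open>o(r\<^sup>s)\<close>, because the exponents in the formula for it are at most \<open>2 (p - 1) < s\<close>.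
So the top part \<open>h s\<close> has mean zero. If its positive part also has mean zero, then so does \<open>\<bar>h s\<bar>\<close>.\<close>

lemma top_part_zero:
  assumes P: "\<And>x. f x = (\<Sum>k\<le>s. h k x)" and h: "\<And>k. k \<le> s \<Longrightarrow> hpoly k (h k)"
    and s: "s > 2 * (p - 1)" and f: "C_class (2 * p) f" and z: "\<And>x. (L ^^ p) f x = 0"
    and zero: "mean (fplus (h s)) 1 = 0"
  shows "h s x = 0"
proof -
  have ch: "continuous_on UNIV (h s)" using hpoly_continuous[OF h] by simp
  obtain c where c: "\<And>t. t > 0 \<Longrightarrow> mean f t = (\<Sum>j<p. c j * t ^ (2 * j))"
    using mean_polyharmonic[OF f z] by blast
  have "((\<lambda>r. \<Sum>j<p. c j * (r ^ (2 * j) / r ^ s)) \<longlongrightarrow> (\<Sum>j<p. c j * 0)) at_top"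
    by (intro tendsto_intros power_ratio_tendsto_0) (use s in auto)
  moreover have "eventually (\<lambda>r. (\<Sum>j<p. c j * (r ^ (2 * j) / r ^ s)) = mean f r / r ^ s) at_top"
    using eventually_gt_at_top[of 0] by eventually_elim (simp add: c sum_divide_distrib)
  ultimately have "((\<lambda>r. mean f r / r ^ s) \<longlongrightarrow> (\<Sum>j<p. c j * 0)) at_top" by (rule Lim_transform_eventually)
  from tendsto_unique[OF trivial_limit_at_top_linorder this polynomial_mean_tendsto(2)[OF P h]]
  have "mean (h s) 1 = 0" by simp
  then have "mean (\<lambda>x. \<bar>h s x\<bar>) 1 = 0" using mean_abs[OF ch, of 1] zero by simp
  \<comment> \<open>The square root presents the vanishing mean of \<open>\<bar>h s\<bar>\<close> as a vanishing norm.\<close>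
  then have "coef (\<lambda>x. sqrt \<bar>h s x\<bar>) (\<lambda>x. sqrt \<bar>h s x\<bar>) 1 = 0"
    by (simp add: mean_def coef_def)
  moreover have "continuous_on UNIV (\<lambda>x. sqrt \<bar>h s x\<bar>)" by (intro continuous_intros ch)
  ultimately have sph: "h s y = 0" if "norm y = 1" for y
    using zero_on_sphere[of "\<lambda>x. sqrt \<bar>h s x\<bar>" y] that by simp
  have zs: "(0::real) ^ s = 0" using s by simp
  show "h s x = 0"
  proof (cases "x = 0")
    case True
    then show ?thesis using hpoly_scale[OF h[of s], of 0 x] zs by simp
  next
    case False
    then have "h s (norm x *\<^sub>R sgn x) = 0"
      unfolding hpoly_scale[OF h[OF order_refl]] using sph[of "sgn x"] by (simp add: norm_sgn)
    then show ?thesis using False by (simp add: sgn_div_norm)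
  qed
qed

end

section \<open>Characterisation of polyharmonic polynomials by growth\<close>

theorem theorem1:
  fixes R Rp :: "(real^'n) set" and \<kappa> f :: "real^'n \<Rightarrow> real" and s p :: nat
  assumes "p \<ge> 1" and "s \<ge> 2 * (p - 1)"
    and "root_system R" and "positive_subsystem R Rp"
    and "multiplicity_function R \<kappa>" and "\<forall>v\<in>R. \<kappa> v \<ge> 0"
    and "C_class (2 * p) f"
    and "\<forall>x. (dunkl_laplacian Rp \<kappa> ^^ p) f x = 0"
  shows "let \<gamma> = (\<Sum>v\<in>Rp. \<kappa> v);
             L = Liminf at_top (\<lambda>r::real. ereal (M1 Rp \<kappa> r (fplus f) /
                   r powr (real s + real CARD('n) - 1 + 2 * \<gamma>)))
         in ((\<exists>P. f = mpoly_fun P \<and> mpoly_degree P \<le> int s) \<longleftrightarrow> L \<in> {0..<\<infinity>}) \<and>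
            (s > 2 * (p - 1) \<longrightarrow>
               ((\<exists>P. f = mpoly_fun P \<and> mpoly_degree P < int s) \<longleftrightarrow> L = 0) \<and>
               ((\<exists>P. f = mpoly_fun P \<and> mpoly_degree P = int s) \<longleftrightarrow> L \<in> {0<..<\<infinity>}))"
proof -
  interpret dunkl R Rp \<kappa> by (rule dunkl.intro) (rule assms(3-6))+
  have z: "(L ^^ p) f x = 0" for x using assms(8) by simp
  have cf: "continuous_on UNIV f" using assms(7) by (rule C_class_cont)
  define g where "g r = real CARD('n) * mean (fplus f) r / r ^ s" for r
  define l where "l = Liminf at_top (\<lambda>r::real. ereal (M1 Rp \<kappa> r (fplus f) / r powr (real s + real CARD('n) - 1 + 2 * \<gamma>)))"
  have ev: "eventually (\<lambda>r. ereal (M1 Rp \<kappa> r (fplus f) / r powr (real s + real CARD('n) - 1 + 2 * \<gamma>)) = ereal (g r)) at_top"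
    using eventually_gt_at_top[of 0] by eventually_elim (simp only: M1_fplus[OF cf] g_def)
  have l: "l = Liminf at_top (\<lambda>r. ereal (g r))" unfolding l_def by (rule Liminf_eq[OF ev])
  have mean_nonneg: "mean (fplus f) r \<ge> 0" for r
    using mean_le[of "\<lambda>_. 0" "fplus f" r] fplus_nonneg[of f] fplus_continuous[OF cf] by (simp add: mean_def coef_def)
  have l0: "l \<ge> 0"
    unfolding l by (intro Liminf_bounded eventually_mono[OF eventually_gt_at_top[of 0]]) (simp add: g_def mean_nonneg)
  have limit: "l = ereal (real CARD('n) * mean (fplus (homogeneous_part P s)) 1)"
    if P: "f = mpoly_fun P" "\<forall>\<alpha>\<in>Poly_Mapping.keys P. total_degree \<alpha> \<le> s" for P
  proof -
    have "((\<lambda>r. real CARD('n) * (mean (fplus f) r / r ^ s)) \<longlongrightarrow> real CARD('n) * mean (fplus (homogeneous_part P s)) 1) at_top"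
      by (intro tendsto_intros polynomial_mean_tendsto(1)[where h="homogeneous_part P"])
        (use P mpoly_fun_homogeneous_parts[OF P(2)] hpoly_homogeneous_part in auto)
    then have "((\<lambda>r. ereal (g r)) \<longlongrightarrow> ereal (real CARD('n) * mean (fplus (homogeneous_part P s)) 1)) at_top"
      by (simp add: g_def)
    then show ?thesis unfolding l by (rule lim_imp_Liminf[OF trivial_limit_at_top_linorder])
  qed
  have deg_le: "l < \<infinity> \<Longrightarrow> \<exists>P. f = mpoly_fun P \<and> (\<forall>\<alpha>\<in>Poly_Mapping.keys P. total_degree \<alpha> \<le> s)"
  proof -
    assume "l < \<infinity>"
    then obtain n :: nat where "l < ereal (real n)" using less_PInf_Ex_of_nat[of l] by auto
    then obtain C where C: "l < ereal C" by blast
    have "\<not> eventually (\<lambda>r. ereal C \<le> ereal (g r)) at_top"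
      using Liminf_bounded[of "ereal C" "\<lambda>r. ereal (g r)" at_top] C unfolding l by (metis not_less)
    then have "\<exists>\<^sub>F r in at_top. g r < C" by (simp add: frequently_def not_le not_less)
    then have "\<exists>\<^sub>F r in at_top. g r < C \<and> r > 0"
      using eventually_gt_at_top[of "0::real"] by (rule frequently_eventually_frequently)
    then have "\<exists>\<^sub>F r in at_top. mean (fplus f) r \<le> C * r ^ s"
    proof (rule frequently_mono[rotated], intro allI impI)
      fix r assume r: "g r < C \<and> r > 0"
      have "mean (fplus f) r / r ^ s \<le> real CARD('n) * (mean (fplus f) r / r ^ s)"
      proof -
        have 1: "1 \<le> real CARD('n)" by (simp add: Suc_le_eq)
        have 2: "0 \<le> mean (fplus f) r / r ^ s" using mean_nonneg r by simp
        from mult_right_mono[OF 1 2] show ?thesis by (simp only: mult_1_left)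
      qed
      then have "mean (fplus f) r / r ^ s \<le> C" using r by (simp add: g_def)
      then show "mean (fplus f) r \<le> C * r ^ s" using r by (simp add: divide_le_eq)
    qed
    from polynomial_of_growth[OF assms(1,2,7) z this] show ?thesis unfolding poly_of_degree_le_def .
  qed
  have main: "(\<exists>P. f = mpoly_fun P \<and> mpoly_degree P \<le> int s) \<longleftrightarrow> l \<in> {0..<\<infinity>}"
    unfolding mpoly_degree_le_iff
  proof
    assume "\<exists>P. f = mpoly_fun P \<and> (\<forall>\<alpha>\<in>Poly_Mapping.keys P. total_degree \<alpha> \<le> s)"
    then obtain P where P: "f = mpoly_fun P" "\<forall>\<alpha>\<in>Poly_Mapping.keys P. total_degree \<alpha> \<le> s" by blast
    show "l \<in> {0..<\<infinity>}" using limit[OF P] l0 by simp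
  next
    assume "l \<in> {0..<\<infinity>}"
    then show "\<exists>P. f = mpoly_fun P \<and> (\<forall>\<alpha>\<in>Poly_Mapping.keys P. total_degree \<alpha> \<le> s)"
      using deg_le by simp
  qed
  moreover have "((\<exists>P. f = mpoly_fun P \<and> mpoly_degree P < int s) \<longleftrightarrow> l = 0) \<and>
      ((\<exists>P. f = mpoly_fun P \<and> mpoly_degree P = int s) \<longleftrightarrow> l \<in> {0<..<\<infinity>})" if s: "s > 2 * (p - 1)"
  proof -
    have lower: "mpoly_degree P < int s" if P: "f = mpoly_fun P" "mpoly_degree P \<le> int s" and "l = 0" for P
    proof -
      have keys: "\<forall>\<alpha>\<in>Poly_Mapping.keys P. total_degree \<alpha> \<le> s" using P(2) by (simp add: mpoly_degree_le_iff)
      have m0: "mean (fplus (homogeneous_part P s)) 1 = 0" using limit[OF P(1) keys] \<open>l = 0\<close> by simp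
      have top0: "homogeneous_part P s x = 0" for x
        by (rule top_part_zero[where h="homogeneous_part P", OF _ hpoly_homogeneous_part s assms(7) z m0])
          (simp add: P(1) mpoly_fun_homogeneous_parts[OF keys])
      show ?thesis unfolding mpoly_degree_less_iff
      proof
        fix \<alpha> assume a: "\<alpha> \<in> Poly_Mapping.keys P"
        show "total_degree \<alpha> < s"
          using homogeneous_part_zeroD[OF top0 a] keys a by (intro le_neq_implies_less) auto
      qed
    qed
    have less0: "l = 0" if P: "f = mpoly_fun P" "mpoly_degree P < int s" for P
    proof -
      have "{\<alpha>\<in>Poly_Mapping.keys P. total_degree \<alpha> = s} = {}" using P(2) by (auto simp: mpoly_degree_less_iff)
      then have "homogeneous_part P s = (\<lambda>x. 0)" by (simp only: homogeneous_part_def[abs_def] sum.empty)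
      moreover have "mean (fplus (\<lambda>x. 0)) 1 = 0" by (simp add: mean_def coef_def fplus_def)
      moreover have keys: "\<forall>\<alpha>\<in>Poly_Mapping.keys P. total_degree \<alpha> \<le> s"
        using P(2) by (simp add: mpoly_degree_less_iff less_imp_le)
      ultimately show ?thesis using limit[OF P(1) keys] by simp
    qed
    show ?thesis
    proof (intro conjI iffI)
      show "l = 0" if "\<exists>P. f = mpoly_fun P \<and> mpoly_degree P < int s" using that less0 by blast
      show "\<exists>P. f = mpoly_fun P \<and> mpoly_degree P < int s" if "l = 0"
      proof -
        have "l \<in> {0..<\<infinity>}" using that by simp
        then obtain P where "f = mpoly_fun P" "mpoly_degree P \<le> int s" using main by blast
        then show ?thesis using lower that by blast
      qed
      show "l \<in> {0<..<\<infinity>}" if ex: "\<exists>P. f = mpoly_fun P \<and> mpoly_degree P = int s"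
      proof -
        obtain P where P: "f = mpoly_fun P" "mpoly_degree P = int s" using ex by blast
        then have "l \<noteq> 0" using lower[of P] by auto
        moreover have "l \<in> {0..<\<infinity>}" using main P by auto
        ultimately show ?thesis by (auto simp: less_le)
      qed
      show "\<exists>P. f = mpoly_fun P \<and> mpoly_degree P = int s" if li: "l \<in> {0<..<\<infinity>}"
      proof -
        obtain P where P: "f = mpoly_fun P" "mpoly_degree P \<le> int s" using main li by auto
        have "\<not> mpoly_degree P < int s" using less0[OF P(1)] li by auto
        then show ?thesis using P by (intro exI[of _ P]) simp
      qed
    qed
  qed
  ultimately show ?thesis unfolding Let_def l_def \<gamma>_def by blast
qed

end
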